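(* Let $n$ be a positive integer. Let $\alpha=(\alpha_1,\dots,\alpha_n)$ and $\beta=(\beta_1,\dots,\beta_{n-1})$ be tuples of rational numbers with $\alpha_i,\beta_j\notin-\mathbb N$ for all $i,j$. Let $d$ be the smallest common denominator of the $\alpha_i$ and $\beta_j$, and let $\mathbb Q(\zeta_d)$ be the $d$-th cyclotomic extension of $\mathbb Q$. Let $K$ be the subextension of $\mathbb Q(\zeta_d)$ corresponding under the Galois correspondence to the group $$D:=\{\lambda\in(\mathbb Z/d\mathbb Z)^\times : \lambda\cdot\alpha\equiv\alpha \pmod{\mathbb Z}\text{ and }\lambda\cdot\beta\equiv\beta\pmod{\mathbb Z}\text{ as multisets}\}\subseteq(\mathbb Z/d\mathbb Z)^\times\simeq\mathrm{Gal}(\mathbb Q(\zeta_d)/\mathbb Q),$$ i.e. $K=\mathbb Q(\zeta_d)^D$. Let $p>2d\cdot\max\{|\alpha_i|+1,|\beta_j|+1\}$ be a prime number such that ${}_nF_{n-1}(\alpha,\beta;x)\in\mathbb Z_{(p)}[[x]]$. Then, letting $k_{\mathfrak p}$ be the residue field of $K$ at a place $\mathfrak p$ above $p$ and writing $q:=\mathrm{Card}(k_{\mathfrak p})$, the function ${}_nF_{n-1}(\alpha,\beta;x)\bmod p$ is annihilated by a nonzero polynomial of the form $$Z_p(Y)=c_0(x)Y+c_1(x)Y^q+\cdots+c_n(x)Y^{q^n}\quad\text{with}\quad c_i(x)\in k_{\mathfrak p}(x).$$ In particular, the Galois group of ${}_nF_{n-1}(\alpha,\beta;x)\bmod p$ over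 $k_{\mathfrak p}(x)$ embeds into $\mathrm{GL}_n(k_{\mathfrak p})$.
   Context: $-\mathbb N$ denotes the set of nonpositive integers. $\mathbb Z_{(p)}$ is the localization of $\mathbb Z$ at $p$. The hypergeometric series is $${}_nF_{n-1}(\alpha,\beta;x)=\sum_{k\ge0}\frac{(\alpha_1)_k\cdots(\alpha_n)_k}{(\beta_1)_k\cdots(\beta_{n-1})_k}\cdot\frac{x^k}{k!}\in\mathbb Q[[x]],\qquad (\gamma)_k=\gamma(\gamma+1)\cdots(\gamma+k-1).$$ An element $\lambda\in(\mathbb Z/d\mathbb Z)^\times$ corresponds to the automorphism of $\mathbb Q(\zeta_d)$ with $\zeta_d\mapsto\zeta_d^\lambda$. The notation $\lambda\cdot\alpha$ means $(\lambda\alpha_1,\dots,\lambda\alpha_n)$, which is well defined modulo $\mathbb Z$. For a field $F$ and $a$ in a separable closure of $F$, the Galois group of $a$ over $F$ is $\mathrm{Gal}(L/F)$, where $L$ is the extension of $F$ generated by $a$ and all its Galois conjugates. A power series over $\mathbb F_p$ that is algebraic over $\mathbb F_p(x)$ is separable, so it can be regarded as an element of a separable closure of $\mathbb F_p(x)$ (which contains $k_{\mathfrak p}(x)$), and its Galois group is well defined up to isomorphism. *)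

theory Defs
  imports
    "HOL-Library.Cardinality"
    "HOL-Library.Nonpos_Ints"
    "HOL-Computational_Algebra.Computational_Algebra"
    "HOL-Algebra.Algebra"
    "HOL-Algebra.Algebraic_Closure_Type"
    "Jordan_Normal_Form.Matrix"
begin

section \<open>Galois groups\<close>

text \<open>
  Subrings and subfields of a field type are treated as carriers inside the record
  \<^const>\<open>ring_of_type_algebra\<close> of the type.
\<close>

abbreviation subring_of_type :: "'a::field set \<Rightarrow> 'a ring" where
  "subring_of_type L \<equiv> ring_of_type_algebra\<lparr>carrier := L\<rparr>"

definition galois_group :: "'a::field set \<Rightarrow> 'a set \<Rightarrow> ('a \<Rightarrow> 'a) monoid" where
  "galois_group F L = BijGroup L
     \<lparr>carrier := {\<sigma> \<in> Bij L. \<sigma> \<in> ring_iso (subring_of_type L) (subring_of_type L) \<and>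
                             (\<forall>z\<in>F. \<sigma> z = z)}\<rparr>"

text \<open>
  In the next two definitions, \<open>\<iota> : F \<rightarrow> \<Omega>\<close> is a field embedding, \<open>\<Omega>\<close> is algebraically
  closed and \<open>a \<in> \<Omega>\<close>. The conjugates of \<open>a\<close> are the roots in \<open>\<Omega>\<close> of its minimal polynomial
  over \<open>F\<close>; the latter is, up to a unit, the only irreducible polynomial over \<open>F\<close> that vanishes
  at \<open>a\<close>. If \<open>a\<close> is separable over \<open>F\<close>, all its conjugates lie in the separable closure of \<open>F\<close>
  in \<open>\<Omega>\<close>, and hence so does the field that they generate.
\<close>

definition conjugates :: "('f::field \<Rightarrow> 'o::field) \<Rightarrow> 'o \<Rightarrow> 'o set" where
  "conjugates \<iota> a =
     {b. \<exists>m. Factorial_Ring.irreducible m \<and> poly (map_poly \<iota> m) a = 0 \<and> poly (map_poly \<iota> m) b = 0}"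

definition galois_group_of :: "('f::field \<Rightarrow> 'o::field) \<Rightarrow> 'o \<Rightarrow> ('o \<Rightarrow> 'o) monoid" where
  "galois_group_of \<iota> a = galois_group (range \<iota>)
     (generate_field ring_of_type_algebra (range \<iota> \<union> insert a (conjugates \<iota> a)))"

definition GL :: "nat \<Rightarrow> 'k::field mat monoid" where
  "GL n = units_of (ring_mat TYPE('k) n ())"


section \<open>The number field attached to the parameters\<close>

definition common_denom :: "rat set \<Rightarrow> nat" where
  "common_denom A = (LEAST d. d > 0 \<and> (\<forall>a\<in>A. of_nat d * a \<in> \<int>))"

definition residues_mod_Ints :: "rat list \<Rightarrow> rat multiset" where
  "residues_mod_Ints \<gamma> = image_mset frac (mset \<gamma>)"

text \<open>A class in \<open>(\<int>/d\<int>)\<^sup>\<times>\<close> is represented by its representative in \<open>{0..<d}\<close>.\<close>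

definition stab_group :: "nat \<Rightarrow> rat list \<Rightarrow> rat list \<Rightarrow> nat set" where
  "stab_group d \<alpha> \<beta> = {l \<in> {0..<d}. coprime l d \<and>
     residues_mod_Ints (map ((*) (of_nat l)) \<alpha>) = residues_mod_Ints \<alpha> \<and>
     residues_mod_Ints (map ((*) (of_nat l)) \<beta>) = residues_mod_Ints \<beta>}"

definition zeta :: "nat \<Rightarrow> complex" where
  "zeta d = cis (2 * pi / real d)"

definition cyclotomic_field :: "nat \<Rightarrow> complex set" where
  "cyclotomic_field d = generate_field ring_of_type_algebra {zeta d}"

text \<open>
  The fixed field in \<open>\<rat>(\<zeta>\<^sub>d)\<close> of the automorphisms \<open>\<zeta>\<^sub>d \<mapsto> \<zeta>\<^sub>d\<^sup>l\<close>, where \<open>l\<close> runs over \<open>D\<close>.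
\<close>

definition cyclotomic_fixed_field :: "nat \<Rightarrow> nat set \<Rightarrow> complex set" where
  "cyclotomic_fixed_field d D = {z \<in> cyclotomic_field d.
     \<forall>\<sigma>\<in>carrier (galois_group \<rat> (cyclotomic_field d)).
       \<forall>l\<in>D. \<sigma> (zeta d) = zeta d ^ l \<longrightarrow> \<sigma> z = z}"

definition hypergeom_field :: "rat list \<Rightarrow> rat list \<Rightarrow> complex set" where
  "hypergeom_field \<alpha> \<beta> =
     (let d = common_denom (set \<alpha> \<union> set \<beta>)
      in cyclotomic_fixed_field d (stab_group d \<alpha> \<beta>))"

definition ring_of_integers :: "complex set \<Rightarrow> complex ring" where
  "ring_of_integers K = subring_of_type {z \<in> K. algebraic_int z}"

text \<open>
  A place of \<open>K\<close> above \<open>p\<close> is a prime ideal of the ring of integers that contains \<open>p\<close>.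
\<close>

definition place_above :: "complex set \<Rightarrow> nat \<Rightarrow> complex set \<Rightarrow> bool" where
  "place_above K p P \<longleftrightarrow> primeideal P (ring_of_integers K) \<and> of_nat p \<in> P"

text \<open>
  As residue fields depend on the place, they cannot be types by construction; instead,
  a field type \<open>'k\<close> is said to be the residue field if it is isomorphic to it.
\<close>

definition is_residue_field :: "'k::field itself \<Rightarrow> complex set \<Rightarrow> complex set \<Rightarrow> bool" where
  "is_residue_field _ K P \<longleftrightarrow>
     ring_of_integers K Quot P \<simeq> (ring_of_type_algebra :: 'k ring)"


section \<open>Reduction of power series, rational functions\<close>

definition Zloc :: "nat \<Rightarrow> rat set" where
  "Zloc p = {of_int a / of_int b | a b. \<not> int p dvd b}"

text \<open>
  If the field \<open>'k\<close> has characteristic \<open>p\<close>, then on \<open>\<int>\<close> localized at \<open>p\<close> the following is the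
  reduction modulo \<open>p\<close>, followed by the inclusion of the prime field into \<open>'k\<close>.
\<close>

definition reduce_rat :: "rat \<Rightarrow> 'k::field" where
  "reduce_rat r = of_int (fst (quotient_of r)) / of_int (snd (quotient_of r))"

definition reduce_fps :: "rat fps \<Rightarrow> 'k::field fps" where
  "reduce_fps F = Abs_fps (\<lambda>k. reduce_rat (fps_nth F k))"

definition fls_of_ratfun :: "'k::field poly fract \<Rightarrow> 'k fls" where
  "fls_of_ratfun r = (THE y. \<exists>a b. b \<noteq> 0 \<and> r = Fract a b \<and>
     y = fps_to_fls (fps_of_poly a) / fps_to_fls (fps_of_poly b))"

lemma fls_of_ratfun_Fract:
  assumes "b \<noteq> 0"
  shows "fls_of_ratfun (Fract a b) = fps_to_fls (fps_of_poly a) / fps_to_fls (fps_of_poly b)"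
  unfolding fls_of_ratfun_def
proof (rule the_equality)
  fix y
  assume "\<exists>a' b'. b' \<noteq> 0 \<and> Fract a b = Fract a' b' \<and>
    y = fps_to_fls (fps_of_poly a') / fps_to_fls (fps_of_poly b')"
  then obtain a' b' where *: "b' \<noteq> 0" "Fract a b = Fract a' b'"
    "y = fps_to_fls (fps_of_poly a') / fps_to_fls (fps_of_poly b')" by blast
  from * assms have "a * b' = a' * b"
    by (simp add: eq_fract)
  then have "fps_to_fls (fps_of_poly a) * fps_to_fls (fps_of_poly b') =
      fps_to_fls (fps_of_poly a') * fps_to_fls (fps_of_poly b)"
    by (metis fls_times_fps_to_fls fps_of_poly_mult)
  with * assms show "y = fps_to_fls (fps_of_poly a) / fps_to_fls (fps_of_poly b)"
    by (simp add: frac_eq_eq)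
qed (use assms in blast)

text \<open>
  The algebraic closure of \<open>k((x))\<close> contains \<open>k[[x]]\<close> as well as an algebraic closure of \<open>k(x)\<close>.
\<close>

definition ac_of_ratfun :: "'k::field poly fract \<Rightarrow> 'k fls alg_closure" where
  "ac_of_ratfun r = to_ac (fls_of_ratfun r)"

definition ac_of_fps :: "'k::field fps \<Rightarrow> 'k fls alg_closure" where
  "ac_of_fps f = to_ac (fps_to_fls f)"

end

theory Submission
  imports Defs "Jordan_Normal_Form.Char_Poly"
begin

text \<open>
  Modulo \<open>p\<close>, the coefficients of a hypergeometric series in an arithmetic progression of difference
  \<open>p\<close> are again those of a hypergeometric series. Its parameters are obtained by Dwork's map, which
  divides them by \<open>p\<close> modulo \<open>\<int>\<close>, up to shifts by 1. As Frobenius fixes the prime field, the reduction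
  of a series is a combination of \<open>p\<close>-th powers of such reductions, with polynomials as coefficients.
  In characteristic 0 all the shifted series with given parameters modulo \<open>\<int>\<close> lie in a space of
  dimension \<open>n\<close> over \<open>\<rat>(x)\<close>, on account of the differential equation. Reducing primitive relations
  shows that their reductions span a space \<open>W\<close> of dimension at most \<open>n\<close>.

  The coefficients of \<open>\<Prod>(T - e\<^bsup>2\<pi>i\<alpha>\<^sub>j\<^esup>)\<close> are integers of \<open>K\<close>, so the \<open>q\<close>-th power map fixes them
  modulo the place. As the \<open>d\<close>-th roots of unity are distinct modulo \<open>p\<close>, multiplication by
  \<open>q = p\<^sup>s\<close> permutes the \<open>\<alpha>\<^sub>j\<close> modulo \<open>\<int>\<close>, and likewise the \<open>\<beta>\<^sub>j\<close>. Hence \<open>s\<close> steps of Dwork's map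
  lead back to \<open>W\<close>, and both \<open>f\<close> and \<open>W\<close> lie in the span of the \<open>q\<close>-th powers of \<open>W\<close>. Thus the
  \<open>n + 1\<close> series \<open>f\<^bsup>q\<^sup>i\<^esup>\<close> with \<open>i \<le> n\<close> lie in the span of the powers of \<open>W\<close> with exponent \<open>q\<^bsup>n+1\<^esup>\<close>,
  and they are linearly dependent.

  The conjugates of \<open>f\<close> are roots of the resulting linearized polynomial. Its roots form a vector
  space over the residue field with at most \<open>q\<^sup>n\<close> elements, on which the Galois group acts linearly.
\<close>

section \<open>Laurent series as a vector space over the rational functions\<close>

text \<open>The parameters themselves may be negative or large, while the dimension count uses
  positive ones. The bound on p is what makes a single step of Dwork's map move every parameter into
  the interval (0, 1], where it stays. This is why W is attached to the parameters reached after s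
  steps, and why f is only known to lie in the span of the q-th powers of W; the latter costs the
  additional factor q in the common exponent.

  Shifts by 1 are forced, since the section at r replaces a by a + r before dividing by p. They
  never accumulate: shifts by 0 or 1 are again turned into shifts by 0 or 1.

  The roots of unity need not lie in K, so they cannot be compared modulo the place. They are
  compared modulo a prime of the ring of all algebraic integers that lies above it.

  The residue field is given only up to isomorphism, so its finiteness has to be proved. It follows
  from the fact that d times an integer of the cyclotomic field is an integral combination of powers
  of the root of unity.\<close>

lemma fps_to_fls_sum: "fps_to_fls (sum g A) = (\<Sum>i\<in>A. fps_to_fls (g i))"
  by (induction A rule: infinite_finite_induct) simp_all

lemma fls_of_ratfun_add: "fls_of_ratfun (r + s) = fls_of_ratfun r + fls_of_ratfun s"
proof -
  obtain a b where r: "r = Fract a b" "b \<noteq> 0" by (cases r)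
  obtain c e where s: "s = Fract c e" "e \<noteq> 0" by (cases s)
  have "fls_of_ratfun (r + s) = fls_of_ratfun (Fract (a * e + c * b) (b * e))"
    using r s by simp
  also have "\<dots> = fls_of_ratfun r + fls_of_ratfun s"
    using r s by (simp add: fls_of_ratfun_Fract fps_of_poly_mult fps_of_poly_add add_frac_eq
        fls_times_fps_to_fls)
  finally show ?thesis .
qed

lemma fls_of_ratfun_mult: "fls_of_ratfun (r * s) = fls_of_ratfun r * fls_of_ratfun s"
proof -
  obtain a b where r: "r = Fract a b" "b \<noteq> 0" by (cases r)
  obtain c e where s: "s = Fract c e" "e \<noteq> 0" by (cases s)
  show ?thesis
    using r s by (simp add: fls_of_ratfun_Fract fps_of_poly_mult fls_times_fps_to_fls)
qed

lemma fls_of_ratfun_to_fract: "fls_of_ratfun (to_fract a) = fps_to_fls (fps_of_poly a)"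
  by (simp add: to_fract_def fls_of_ratfun_Fract)

lemma fls_of_ratfun_1 [simp]: "fls_of_ratfun 1 = 1"
  using fls_of_ratfun_to_fract[of 1] by simp

lemma fls_of_ratfun_0 [simp]: "fls_of_ratfun 0 = 0"
  using fls_of_ratfun_to_fract[of 0] by simp

lemma fls_of_ratfun_power: "fls_of_ratfun (r ^ n) = fls_of_ratfun r ^ n"
  by (induction n) (simp_all add: fls_of_ratfun_mult)

lemma fls_of_ratfun_uminus: "fls_of_ratfun (- r) = - fls_of_ratfun r"
  using fls_of_ratfun_add[of r "- r"] by (simp add: eq_neg_iff_add_eq_0 add.commute)

lemma fls_of_ratfun_eq_0_iff [simp]: "fls_of_ratfun r = 0 \<longleftrightarrow> r = 0"
proof
  assume *: "fls_of_ratfun r = 0"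
  show "r = 0"
  proof (rule ccontr)
    assume "r \<noteq> 0"
    then have "fls_of_ratfun (r * inverse r) = 1" by simp
    with * show False by (simp only: fls_of_ratfun_mult) simp
  qed
qed simp

text \<open>The linear algebra takes place in k((x)) as a vector space over k(x). The interpretation
  is generic in the field, since dimensions are counted over the rationals and then transferred to
  characteristic p.\<close>

interpretation ratfun: vector_space
  "(\<lambda>r v. fls_of_ratfun r * v) :: 'a::field poly fract \<Rightarrow> 'a fls \<Rightarrow> 'a fls"
  by unfold_locales (simp_all add: fls_of_ratfun_add fls_of_ratfun_mult algebra_simps)

lemma ratfun_span_poly:
  fixes v :: "'a::field fls"
  shows "v \<in> ratfun.span S \<Longrightarrow> fps_to_fls (fps_of_poly a) * v \<in> ratfun.span S"
  using ratfun.span_scale[of v S "to_fract a"] by (simp add: fls_of_ratfun_to_fract)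

lemma ratfun_span_poly_cancel:
  fixes v :: "'a::field fls"
  assumes "fps_to_fls (fps_of_poly a) * v \<in> ratfun.span S" "a \<noteq> 0"
  shows "v \<in> ratfun.span S"
proof -
  have "fls_of_ratfun (inverse (to_fract a)) * (fls_of_ratfun (to_fract a) * v) \<in> ratfun.span S"
    using assms(1) by (metis fls_of_ratfun_to_fract ratfun.span_scale)
  also have "fls_of_ratfun (inverse (to_fract a)) * (fls_of_ratfun (to_fract a) * v) =
     fls_of_ratfun (inverse (to_fract a) * to_fract a) * v"
    by (simp add: fls_of_ratfun_mult algebra_simps)
  also have "\<dots> = v" using assms(2) by simp
  finally show ?thesis .
qed

text \<open>Multiplication by the product of all denominators leaves polynomial coefficients, and in
  this form a relation between power series can be reduced modulo p.\<close>

lemma ratfun_dependent_polyE: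
  fixes S :: "'a::field fps set"
  assumes "finite S" "ratfun.dependent (fps_to_fls ` S)"
  obtains c where "(\<Sum>s\<in>S. fps_of_poly (c s) * s) = 0" "\<exists>s\<in>S. c s \<noteq> 0"
proof -
  have inj: "inj_on fps_to_fls S" by (auto simp: inj_on_def)
  from assms obtain u where u: "(\<Sum>v\<in>fps_to_fls ` S. fls_of_ratfun (u v) * v) = 0"
    "\<exists>v\<in>fps_to_fls ` S. u v \<noteq> 0"
    by (subst (asm) ratfun.dependent_finite) auto
  define u' where "u' s = u (fps_to_fls s)" for s
  have u': "(\<Sum>s\<in>S. fls_of_ratfun (u' s) * fps_to_fls s) = 0" "\<exists>s\<in>S. u' s \<noteq> 0"
    using u inj by (auto simp: sum.reindex u'_def)
  have "\<exists>a b. u' s = Fract a b \<and> b \<noteq> 0" for s by (cases "u' s") auto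
  then obtain a b where ab: "\<And>s. u' s = Fract (a s) (b s)" "\<And>s. b s \<noteq> 0" by metis
  define c where "c s = a s * prod b (S - {s})" for s
  have c: "to_fract (prod b S) * u' s = to_fract (c s)" if "s \<in> S" for s
  proof -
    have "prod b S = b s * prod b (S - {s})"
      using that assms(1) by (simp add: prod.remove)
    then show ?thesis using ab
      by (simp add: c_def to_fract_def eq_fract)
  qed
  have "fps_to_fls (\<Sum>s\<in>S. fps_of_poly (c s) * s) = (\<Sum>s\<in>S. fls_of_ratfun (to_fract (c s)) * fps_to_fls s)"
    by (simp add: fps_to_fls_sum fls_times_fps_to_fls fls_of_ratfun_to_fract)
  also have "\<dots> = (\<Sum>s\<in>S. fls_of_ratfun (to_fract (prod b S)) * (fls_of_ratfun (u' s) * fps_to_fls s))"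
    by (rule sum.cong[OF refl]) (metis c fls_of_ratfun_mult mult.assoc)
  also have "\<dots> = 0"
    by (subst sum_distrib_left[symmetric]) (simp add: u'(1))
  finally have 1: "(\<Sum>s\<in>S. fps_of_poly (c s) * s) = 0" by simp
  have "\<exists>s\<in>S. c s \<noteq> 0"
  proof -
    obtain s where s: "s \<in> S" "u' s \<noteq> 0" using u' by blast
    have "to_fract (prod b S) \<noteq> 0" using ab assms(1) by simp
    then have "c s \<noteq> 0" using c[OF s(1)] s(2) by auto
    then show ?thesis using s by blast
  qed
  with 1 show ?thesis using that by blast
qed

lemma ratfun_dependentI:
  fixes S :: "'a::field fps set"
  assumes "finite S" "(\<Sum>s\<in>S. fps_of_poly (c s) * s) = 0" "\<exists>s\<in>S. c s \<noteq> 0"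
  shows "ratfun.dependent (fps_to_fls ` S)"
proof -
  have inj: "inj_on fps_to_fls S" by (auto simp: inj_on_def)
  define u where "u v = to_fract (c (the_inv_into S fps_to_fls v))" for v
  have u: "u (fps_to_fls s) = to_fract (c s)" if "s \<in> S" for s
    using that inj by (simp add: u_def the_inv_into_f_f)
  have "(\<Sum>v\<in>fps_to_fls ` S. fls_of_ratfun (u v) * v) = fps_to_fls (\<Sum>s\<in>S. fps_of_poly (c s) * s)"
    using inj by (simp add: sum.reindex u fls_of_ratfun_to_fract fls_times_fps_to_fls fps_to_fls_sum)
  also have "\<dots> = 0" using assms(2) by simp
  finally show ?thesis using assms(1,3) u
    by (subst ratfun.dependent_finite) (auto intro!: exI[of _ u])
qed

text \<open>Stated for a family because the powers to which it is applied may coincide, for instance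
  if the series is constant. A repetition gives the relation with coefficients 1 and -1.\<close>

lemma ratfun_family_dependent:
  fixes g :: "nat \<Rightarrow> 'a::field fls"
  assumes "finite B" "card B \<le> n" "\<And>i. i \<le> n \<Longrightarrow> g i \<in> ratfun.span B"
  obtains c where "(\<Sum>i\<le>n. fls_of_ratfun (c i) * g i) = 0" "\<exists>i\<le>n. c i \<noteq> 0"
proof (cases "inj_on g {..n}")
  case True
  have "ratfun.dependent (g ` {..n})"
  proof (rule ccontr)
    assume "\<not> ?thesis"
    then have "card (g ` {..n}) \<le> card B"
      using ratfun.independent_span_bound[of B "g ` {..n}"] assms by auto
    then show False using True assms(2) by (simp add: card_image)
  qed
  then obtain u where u: "(\<Sum>v\<in>g ` {..n}. fls_of_ratfun (u v) * v) = 0" "\<exists>v\<in>g ` {..n}. u v \<noteq> 0"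
    by (subst (asm) ratfun.dependent_finite) auto
  have "(\<Sum>i\<le>n. fls_of_ratfun (u (g i)) * g i) = 0"
    using u(1) True by (simp add: sum.reindex)
  then show ?thesis using that[of "u \<circ> g"] u(2) by auto
next
  case False
  then obtain i j where ij: "i \<le> n" "j \<le> n" "i \<noteq> j" "g i = g j" by (auto simp: inj_on_def)
  define c :: "nat \<Rightarrow> 'a poly fract" where "c k = (if k = i then 1 else if k = j then -1 else 0)" for k
  have "(\<Sum>k\<le>n. fls_of_ratfun (c k) * g k) = (\<Sum>k\<in>{i, j}. fls_of_ratfun (c k) * g k)"
    using ij by (intro sum.mono_neutral_right) (auto simp: c_def)
  also have "\<dots> = 0" using ij by (simp add: c_def fls_of_ratfun_uminus)
  finally have "(\<Sum>k\<le>n. fls_of_ratfun (c k) * g k) = 0" .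
  moreover have "\<exists>k\<le>n. c k \<noteq> 0" using ij by (intro exI[of _ i]) (simp add: c_def)
  ultimately show ?thesis using that by blast
qed

section \<open>Reduction modulo a prime\<close>

text \<open>Only the characteristic of the field enters here, as the reductions of rational numbers
  lie in its prime field.\<close>

locale residue_char =
  fixes p :: nat and TYPE_k :: "'k::field itself"
  assumes prime_p: "Factorial_Ring.prime p" and CHAR_k: "CHAR('k) = p"
begin

abbreviation red :: "rat \<Rightarrow> 'k" where "red \<equiv> reduce_rat"
abbreviation redf :: "rat fps \<Rightarrow> 'k fps" where "redf \<equiv> reduce_fps"

lemma p_gt_1: "p > 1"
  using prime_p prime_gt_1_nat by blast

lemma prime_int_p: "Factorial_Ring.prime (int p)"
  using prime_p by simp

lemma of_int_k_eq_0_iff: "of_int b = (0::'k) \<longleftrightarrow> int p dvd b"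
  using of_int_eq_0_iff_char_dvd[where ?'a = 'k] CHAR_k by simp

lemma ZlocI: "\<not> int p dvd b \<Longrightarrow> x = of_int a / of_int b \<Longrightarrow> x \<in> Zloc p"
  by (auto simp: Zloc_def)

lemma ZlocE:
  assumes "x \<in> Zloc p"
  obtains a b where "\<not> int p dvd b" "b \<noteq> 0" "x = of_int a / of_int b"
  using assms by (auto simp: Zloc_def)

text \<open>\<open>reduce_rat\<close> uses lowest terms. Their denominator \<open>v\<close> divides
  any other denominator \<open>b\<close>, so it is a unit modulo p when \<open>b\<close> is, and the
  two quotients agree by cross-multiplication.\<close>

lemma red_of_int_div:
  assumes "\<not> int p dvd b"
  shows "red (of_int a / of_int b) = of_int a / of_int b"
proof -
  have b: "b \<noteq> 0" using assms by auto
  obtain u v where uv: "quotient_of (of_int a / of_int b) = (u, v)" by (cases "quotient_of (of_int a / of_int b)")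
  have cop: "Rings.coprime u v" and v: "v > 0"
    using uv quotient_of_coprime quotient_of_denom_pos by blast+
  have "(of_int a / of_int b :: rat) = of_int u / of_int v"
    using uv quotient_of_div by blast
  then have "(of_int (a * v) :: rat) = of_int (u * b)"
    using b v by (simp add: frac_eq_eq)
  then have eq: "a * v = u * b" by (simp only: of_int_eq_iff)
  have "v dvd b"
    using cop eq by (metis coprime_commute coprime_dvd_mult_right_iff dvd_triv_right)
  then have "\<not> int p dvd v" using assms dvd_trans by blast
  then have "(of_int v :: 'k) \<noteq> 0" "(of_int b :: 'k) \<noteq> 0"
    using assms by (simp_all add: of_int_k_eq_0_iff)
  moreover have "(of_int a * of_int v :: 'k) = of_int u * of_int b"
    using eq by (metis of_int_mult)
  ultimately show ?thesis using uv
    by (simp add: reduce_rat_def frac_eq_eq)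
qed

lemma red_of_int [simp]: "red (of_int a) = of_int a"
  using red_of_int_div[of 1 a] p_gt_1 by simp

lemma red_of_nat [simp]: "red (of_nat a) = of_nat a"
  using red_of_int[of "int a"] by simp

lemma red_0 [simp]: "red 0 = 0" and red_1 [simp]: "red 1 = 1"
  using red_of_int[of 0] red_of_int[of 1] by simp_all

lemma Zloc_add_red:
  assumes "x \<in> Zloc p" "y \<in> Zloc p"
  shows "x + y \<in> Zloc p \<and> red (x + y) = red x + red y"
proof -
  obtain a b where x: "\<not> int p dvd b" "b \<noteq> 0" "x = of_int a / of_int b" using assms(1) by (rule ZlocE)
  obtain c e where y: "\<not> int p dvd e" "e \<noteq> 0" "y = of_int c / of_int e" using assms(2) by (rule ZlocE)
  have ndvd: "\<not> int p dvd b * e" using x y prime_int_p by (simp add: prime_dvd_mult_iff)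
  have eq: "x + y = of_int (a * e + c * b) / of_int (b * e)" using x y by (simp add: add_frac_eq)
  have "(of_int b::'k) \<noteq> 0" "(of_int e::'k) \<noteq> 0" using x y by (simp_all add: of_int_k_eq_0_iff)
  then have "red (x + y) = red x + red y"
    using x y unfolding eq red_of_int_div[OF ndvd] by (simp add: red_of_int_div add_frac_eq)
  with eq ndvd show ?thesis by (blast intro: ZlocI)
qed

lemma Zloc_mult_red:
  assumes "x \<in> Zloc p" "y \<in> Zloc p"
  shows "x * y \<in> Zloc p \<and> red (x * y) = red x * red y"
proof -
  obtain a b where x: "\<not> int p dvd b" "b \<noteq> 0" "x = of_int a / of_int b" using assms(1) by (rule ZlocE)
  obtain c e where y: "\<not> int p dvd e" "e \<noteq> 0" "y = of_int c / of_int e" using assms(2) by (rule ZlocE)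
  have ndvd: "\<not> int p dvd b * e" using x y prime_int_p by (simp add: prime_dvd_mult_iff)
  have eq: "x * y = of_int (a * c) / of_int (b * e)" using x y by simp
  have "red (x * y) = red x * red y"
    using x y unfolding eq red_of_int_div[OF ndvd] by (simp add: red_of_int_div)
  with eq ndvd show ?thesis by (blast intro: ZlocI)
qed

lemmas Zloc_add = Zloc_add_red[THEN conjunct1] and red_add = Zloc_add_red[THEN conjunct2]
lemmas Zloc_mult = Zloc_mult_red[THEN conjunct1] and red_mult = Zloc_mult_red[THEN conjunct2]

lemma Zloc_of_int [simp]: "of_int a \<in> Zloc p"
  using ZlocI[of 1 "of_int a" a] p_gt_1 by simp

lemma Zloc_of_nat [simp]: "of_nat a \<in> Zloc p"
  using Zloc_of_int[of "int a"] by simp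

lemma Zloc_0 [simp]: "0 \<in> Zloc p" and Zloc_1 [simp]: "1 \<in> Zloc p"
  using Zloc_of_int[of 0] Zloc_of_int[of 1] by simp_all

lemma Zloc_minus: "x \<in> Zloc p \<Longrightarrow> - x \<in> Zloc p"
  using Zloc_mult[of "-1" x] Zloc_of_int[of "-1"] by simp

lemma Zloc_diff: "x \<in> Zloc p \<Longrightarrow> y \<in> Zloc p \<Longrightarrow> x - y \<in> Zloc p"
  using Zloc_add[of x "-y"] Zloc_minus[of y] by simp

lemma Zloc_sum_red:
  assumes "\<And>i. i \<in> A \<Longrightarrow> g i \<in> Zloc p"
  shows "sum g A \<in> Zloc p \<and> red (sum g A) = (\<Sum>i\<in>A. red (g i))"
  using assms by (induction A rule: infinite_finite_induct) (auto simp: Zloc_add red_add)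

lemma Zloc_prod_red:
  assumes "\<And>i. i \<in> A \<Longrightarrow> g i \<in> Zloc p"
  shows "prod g A \<in> Zloc p \<and> red (prod g A) = (\<Prod>i\<in>A. red (g i))"
  using assms by (induction A rule: infinite_finite_induct) (auto simp: Zloc_mult red_mult)

lemmas Zloc_sum = Zloc_sum_red[THEN conjunct1] and red_sum = Zloc_sum_red[THEN conjunct2]
lemmas Zloc_prod = Zloc_prod_red[THEN conjunct1] and red_prod = Zloc_prod_red[THEN conjunct2]

lemma Zloc_inverse_red:
  assumes "x \<in> Zloc p" "red x \<noteq> 0"
  shows "inverse x \<in> Zloc p \<and> red (inverse x) = inverse (red x)"
proof -
  obtain a b where x: "\<not> int p dvd b" "b \<noteq> 0" "x = of_int a / of_int b" using assms(1) by (rule ZlocE)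
  then have "\<not> int p dvd a" using assms(2) by (auto simp: red_of_int_div of_int_k_eq_0_iff)
  moreover have eq: "inverse x = of_int b / of_int a" using x by simp
  ultimately show ?thesis using x by (auto simp: red_of_int_div intro: ZlocI)
qed

lemma of_int_k_power_p: "(of_int a :: 'k) ^ p = of_int a"
proof -
  have nat: "(of_nat n :: 'k) ^ p = of_nat n" for n
  proof (induction n)
    case (Suc n)
    have "(of_nat n + 1 :: 'k) ^ p = of_nat n ^ p + 1 ^ p"
      by (rule freshmans_dream) (use prime_p CHAR_k in auto)
    with Suc show ?case by (simp add: add.commute)
  qed (use p_gt_1 in auto)
  show ?thesis
  proof (cases "a \<ge> 0")
    case True
    then show ?thesis using nat[of "nat a"] by simp
  next
    case False
    then have "(of_int a :: 'k) = - of_nat (nat (- a))" by simp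
    moreover have "(- of_nat (nat (- a)) :: 'k) ^ p = - (of_nat (nat (- a)) ^ p)"
      by (rule minus_power_prime_CHAR) (use prime_p CHAR_k in auto)
    ultimately show ?thesis using nat by simp
  qed
qed

lemma red_power_p [simp]: "red x ^ p = red x"
  by (simp add: reduce_rat_def power_divide of_int_k_power_p)

section \<open>Coefficientwise reduction and Frobenius on power series\<close>

definition integral :: "rat fps \<Rightarrow> bool" where
  "integral h \<longleftrightarrow> (\<forall>k. fps_nth h k \<in> Zloc p)"

lemma redf_nth [simp]: "fps_nth (redf h) k = red (fps_nth h k)"
  by (simp add: reduce_fps_def)

lemma integral_mult: "integral g \<Longrightarrow> integral h \<Longrightarrow> integral (g * h)"
  by (simp add: integral_def fps_mult_nth Zloc_sum Zloc_mult)

lemma redf_mult: "integral g \<Longrightarrow> integral h \<Longrightarrow> redf (g * h) = redf g * redf h"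
  by (simp add: integral_def fps_mult_nth fps_eq_iff red_sum Zloc_mult red_mult)

lemma redf_sum:
  "(\<And>i. i \<in> A \<Longrightarrow> integral (g i)) \<Longrightarrow> integral (sum g A) \<and> redf (sum g A) = (\<Sum>i\<in>A. redf (g i))"
  by (simp add: integral_def fps_sum_nth fps_eq_iff Zloc_sum red_sum)

lemma redf_of_int_poly:
  "integral (fps_of_poly (map_poly of_int c)) \<and>
   redf (fps_of_poly (map_poly of_int c)) = fps_of_poly (map_poly of_int c)"
  by (simp add: integral_def fps_eq_iff coeff_map_poly)

text \<open>If Frobenius fixes the coefficients, then f^p = f(x^p). Additivity of the p-th power
  applies to finite sums, so f is cut after the coefficient m; the p-th power of the tail starts at
  degree (m + 1) p.\<close>

lemma frobenius_fps_nth: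
  fixes f :: "'k fps"
  assumes "\<And>k. fps_nth f k ^ p = fps_nth f k"
  shows "fps_nth (f ^ p) m = (if p dvd m then fps_nth f (m div p) else 0)"
proof -
  have CH: "Factorial_Ring.prime CHAR('k fps)" "p = CHAR('k fps)" using prime_p CHAR_k by simp_all
  define t where "t = (\<Sum>i\<le>m. fps_const (fps_nth f i) * fps_X ^ i)"
  define u where "u = fps_shift (Suc m) f"
  have f: "f = t + fps_X ^ Suc m * u"
  proof (rule fps_ext)
    fix k
    have "fps_nth t k = (\<Sum>i\<le>m. if k = i then fps_nth f i else 0)"
      by (simp add: t_def fps_sum_nth fps_mult_left_const_nth fps_X_power_nth if_distrib cong: if_cong)
    then have "fps_nth t k = (if k \<le> m then fps_nth f k else 0)" by (simp add: sum.delta)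
    then show "fps_nth f k = fps_nth (t + fps_X ^ Suc m * u) k"
      by (simp add: fps_X_power_mult_nth u_def del: power_Suc)
  qed
  have "f ^ p = t ^ p + (fps_X ^ Suc m * u) ^ p"
    by (subst f, rule freshmans_dream) (use CH in auto)
  also have "t ^ p = (\<Sum>i\<le>m. (fps_const (fps_nth f i) * fps_X ^ i) ^ p)"
    unfolding t_def by (rule freshmans_dream_sum) (use CH in auto)
  also have "\<dots> = (\<Sum>i\<le>m. fps_const (fps_nth f i) * fps_X ^ (i * p))"
    using assms by (simp add: power_mult_distrib fps_const_power power_mult)
  finally have eq: "f ^ p = (\<Sum>i\<le>m. fps_const (fps_nth f i) * fps_X ^ (i * p)) + (fps_X ^ Suc m * u) ^ p" .
  have "Suc m \<le> Suc m * p" using mult_le_mono2[of 1 p "Suc m"] p_gt_1 by (simp only: mult_1_right less_imp_le)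
  then have "fps_nth ((fps_X ^ Suc m * u) ^ p) m = 0"
    by (simp add: power_mult_distrib fps_X_power_mult_nth del: power_Suc flip: power_mult)
  then have "fps_nth (f ^ p) m = (\<Sum>i\<le>m. if m = i * p then fps_nth f i else 0)"
    by (simp add: eq fps_sum_nth fps_mult_left_const_nth fps_X_power_nth if_distrib cong: if_cong)
  also have "\<dots> = (if p dvd m then fps_nth f (m div p) else 0)"
  proof (cases "p dvd m")
    case True
    then obtain l where l: "m = l * p" by (metis dvd_div_mult_self)
    have "(\<Sum>i\<le>m. if m = i * p then fps_nth f i else 0) = (\<Sum>i\<le>m. if i = l then fps_nth f i else 0)"
      using l p_gt_1 by (intro sum.cong) auto
    also have "\<dots> = fps_nth f l" using l p_gt_1 by (simp add: sum.delta)
    finally show ?thesis using l p_gt_1 by simp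
  next
    case False
    then show ?thesis by (intro trans[OF sum.neutral]) auto
  qed
  finally show ?thesis .
qed

text \<open>The coefficients of f are sorted by the residue of their index modulo p: h_r collects
  those of index r + p m, and its p-th power is h_r(x^p).\<close>

lemma fps_section_decomposition:
  fixes f :: "'k fps"
  assumes "\<And>r k. fps_nth (h r) k ^ p = fps_nth (h r) k"
    and "\<And>r m. r < p \<Longrightarrow> fps_nth (h r) m = fps_nth f (r + p * m)"
  shows "f = (\<Sum>r<p. fps_X ^ r * h r ^ p)"
proof (rule fps_ext)
  fix k
  have p: "k mod p < p" using p_gt_1 by simp
  have "fps_nth (\<Sum>r<p. fps_X ^ r * h r ^ p) k = (\<Sum>r<p. if r = k mod p then fps_nth f k else 0)"
    unfolding fps_sum_nth
  proof (intro sum.cong refl)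
    fix r assume "r \<in> {..<p}"
    then have r: "r < p" by simp
    show "fps_nth (fps_X ^ r * h r ^ p) k = (if r = k mod p then fps_nth f k else 0)"
    proof (cases "k < r")
      case True
      then show ?thesis using r by (auto simp: fps_X_power_mult_nth)
    next
      case False
      have "p dvd k - r \<longleftrightarrow> r = k mod p"
        using False r by (metis le_add_diff_inverse2 mod_less mod_eq_dvd_iff_nat not_less)
      moreover have "r + p * ((k - r) div p) = k" if "p dvd k - r" using that False by simp
      ultimately show ?thesis using False r
        by (simp add: fps_X_power_mult_nth frobenius_fps_nth[OF assms(1)] assms(2))
    qed
  qed
  also have "\<dots> = fps_nth f k" using p by (simp add: sum.delta)
  finally show "fps_nth f k = fps_nth (\<Sum>r<p. fps_X ^ r * h r ^ p) k" by simp
qed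

end

section \<open>Dwork's map and sections of hypergeometric series\<close>

text \<open>The factorial is treated as a lower parameter 1, so that numerator and denominator
  behave alike under Dwork's map. The factor c is carried along because the section at r starts with
  the r-th coefficient of the series.\<close>

definition hyp :: "rat list \<Rightarrow> rat list \<Rightarrow> rat \<Rightarrow> rat fps" where
  "hyp A B c = Abs_fps (\<lambda>k. c * (\<Prod>a\<leftarrow>A. pochhammer a k) / (\<Prod>b\<leftarrow>B. pochhammer b k))"

text \<open>The two shifts 0 and 1 are exactly what survives the passage to sections.\<close>

definition shift_rel :: "rat \<Rightarrow> rat \<Rightarrow> bool" where
  "shift_rel a0 a \<longleftrightarrow> a = a0 \<or> a = a0 + 1"

context residue_char
begin

lemma p_mult_less: "int p * a < int p * b \<Longrightarrow> a < b"
  using p_gt_1 by (simp add: mult_less_cancel_left)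

lemma p_dvd_if_Zloc:
  assumes "of_int m / of_nat p \<in> Zloc p"
  shows "int p dvd m"
proof -
  obtain a b where ab: "\<not> int p dvd b" "b \<noteq> 0" "(of_int m / of_nat p :: rat) = of_int a / of_int b"
    using assms by (rule ZlocE)
  then have "(of_int (m * b) :: rat) = of_int (a * int p)"
    using p_gt_1 by (simp add: field_simps)
  then have "m * b = a * int p" by (simp only: of_int_eq_iff)
  then have "int p dvd m * b" by simp
  with ab prime_int_p show ?thesis by (simp add: prime_dvd_mult_iff)
qed

text \<open>
  Dwork's map sends \<open>x\<close> to the only \<open>y\<close> such that \<open>p y - x\<close> is one of \<open>0, \<dots>, p - 1\<close>.
\<close>

definition dwork :: "rat \<Rightarrow> rat" where
  "dwork x = (x + of_nat (LEAST i. (x + of_nat i) / of_nat p \<in> Zloc p)) / of_nat p"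

lemma dworkE:
  assumes "x \<in> Zloc p"
  obtains i where "i < p" "of_nat p * dwork x = x + of_nat i" "dwork x \<in> Zloc p"
proof -
  obtain a b where ab: "\<not> int p dvd b" "b \<noteq> 0" "x = of_int a / of_int b" using assms by (rule ZlocE)
  have "gcd b (int p) = 1"
    using ab(1) prime_int_p by (metis gcd.commute prime_imp_coprime coprime_iff_gcd_eq_1)
  then obtain u v where uv: "u * b + v * int p = 1" by (metis bezout_int)
  \<comment> \<open>\<open>u\<close> inverts \<open>b\<close> modulo p, so this \<open>i\<close>
    makes a + i b divisible by p.\<close>
  define i where "i = nat ((- a * u) mod int p)"
  have i: "int i = (- a * u) mod int p" "i < p"
    using p_gt_1 by (auto simp: i_def nat_less_iff)
  have "(a + int i * b) mod int p = (a + (- a * u) * b) mod int p"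
    unfolding i by (metis mod_add_right_eq mod_mult_left_eq)
  also have "a + (- a * u) * b = a * (v * int p)"
    using uv by (metis add_diff_cancel_left' diff_minus_eq_add minus_mult_left mult.assoc mult.right_neutral
        right_diff_distrib add.commute uminus_add_conv_diff)
  finally have "int p dvd a + int i * b" by (simp add: mod_eq_0_iff_dvd)
  then obtain t where t: "a + int i * b = int p * t" ..
  have "x + of_nat i = of_int (a + int i * b) / of_int b"
    using ab(2) by (simp add: ab(3) add_divide_distrib)
  also have "\<dots> / of_nat p = of_int t / of_int b"
    unfolding t using p_gt_1 by simp
  finally have i_Z: "(x + of_nat i) / of_nat p \<in> Zloc p" using ab(1) by (blast intro: ZlocI)
  define j where "j = (LEAST i. (x + of_nat i) / of_nat p \<in> Zloc p)"
  have "(x + of_nat j) / of_nat p \<in> Zloc p" unfolding j_def by (rule LeastI[of _ i]) (rule i_Z)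
  moreover have "j \<le> i" unfolding j_def by (rule Least_le) (rule i_Z)
  ultimately show ?thesis using that[of j] p_gt_1 i(2) by (simp add: dwork_def flip: j_def)
qed

lemma dwork_Zloc: "x \<in> Zloc p \<Longrightarrow> dwork x \<in> Zloc p"
  by (erule dworkE)

text \<open>The difference y - \<open>dwork x\<close> equals (i - j) / p and lies in the
  localization at p, so it is an integer k. Bounds on i then determine k in each
  application.\<close>

lemma dwork_difference:
  assumes "x \<in> Zloc p" "y \<in> Zloc p" "of_nat p * y = x + of_int i"
  obtains j k where "j < p" "y = dwork x + of_int k" "int p * k = i - int j"
proof -
  obtain j where j: "j < p" "of_nat p * dwork x = x + of_nat j" "dwork x \<in> Zloc p"
    using assms(1) by (rule dworkE)
  have diff: "y - dwork x = of_int (i - int j) / of_nat p"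
    using assms(3) j(2) p_gt_1 by (simp add: field_simps)
  moreover have "y - dwork x \<in> Zloc p" using assms(2) j(3) by (rule Zloc_diff)
  ultimately have "int p dvd i - int j" by (metis p_dvd_if_Zloc)
  then obtain k where k: "i - int j = int p * k" ..
  have "y - dwork x = of_int k" using diff p_gt_1 unfolding k by simp
  then show ?thesis using that[of j k] j(1) k by (simp add: algebra_simps)
qed

lemma dwork_unique:
  assumes "x \<in> Zloc p" "y \<in> Zloc p" "of_nat p * y = x + of_int i" "0 \<le> i" "i < int p"
  shows "dwork x = y"
proof -
  obtain j k where k: "j < p" "y = dwork x + of_int k" "int p * k = i - int j"
    using assms(1-3) by (rule dwork_difference)
  have "int p * k < int p * 1" "int p * (-1) < int p * k"
    using k(1,3) assms(4,5) by linarith+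
  then have "k < 1" "-1 < k" by (blast dest: p_mult_less)+
  then show ?thesis using k(2) by simp
qed

lemma dwork_add_multiple:
  assumes "x \<in> Zloc p"
  shows "dwork (x + of_nat (p * m)) = dwork x + of_nat m"
proof -
  obtain j where j: "j < p" "of_nat p * dwork x = x + of_nat j" "dwork x \<in> Zloc p"
    using assms by (rule dworkE)
  show ?thesis
    by (rule dwork_unique[where i = "int j"])
      (use j assms in \<open>auto simp: Zloc_add algebra_simps simp del: of_nat_mult\<close>, simp add: algebra_simps)
qed

text \<open>Here p \<open>dwork (y + r)\<close> = x + e + r + j with e \<le> 1 and r, j < p, so the
  offset from x is at least 0 and at most 2 p - 1. Hence \<open>dwork (y + r)\<close> exceeds
  \<open>dwork x\<close> by 0 or 1.\<close>

lemma dwork_shift: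
  assumes "x \<in> Zloc p" "shift_rel x y" "r < p"
  shows "shift_rel (dwork x) (dwork (y + of_nat r))"
proof -
  have y: "y \<in> Zloc p" using assms(1,2) by (auto simp: shift_rel_def intro: Zloc_add)
  then have yr: "y + of_nat r \<in> Zloc p" by (simp add: Zloc_add)
  obtain e where e: "y = x + of_nat e" "e \<le> 1"
    using assms(2) by (auto simp: shift_rel_def intro: that[of 0] that[of 1])
  obtain j where j: "j < p" "of_nat p * dwork (y + of_nat r) = y + of_nat r + of_nat j"
    "dwork (y + of_nat r) \<in> Zloc p"
    using yr by (rule dworkE)
  have eq: "of_nat p * dwork (y + of_nat r) = x + of_int (int (e + r + j))"
    using j(2) e(1) by (simp add: algebra_simps)
  obtain i k where k: "i < p" "dwork (y + of_nat r) = dwork x + of_int k"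
    "int p * k = int (e + r + j) - int i"
    using assms(1) j(3) eq by (rule dwork_difference)
  have "int p * k < int p * 2" "int p * (-1) < int p * k"
    using k(1,3) e(2) j(1) assms(3) by linarith+
  then have "k < 2" "-1 < k" by (blast dest: p_mult_less)+
  then have "k = 0 \<or> k = 1" by linarith
  with k(2) show ?thesis by (auto simp: shift_rel_def)
qed

text \<open>The lower parameter that stands for the factorial is thus the same in all
  sections.\<close>

lemma dwork_1_add:
  assumes "r < p"
  shows "dwork (1 + of_nat r) = 1"
proof (rule dwork_unique)
  show "of_nat p * 1 = 1 + of_nat r + (of_int (int p - 1 - int r) :: rat)" by simp
qed (use assms in \<open>auto simp: Zloc_add\<close>)

section \<open>Pochhammer symbols along blocks of length p\<close>

definition nonzero_residues_prod :: 'k where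
  "nonzero_residues_prod = (\<Prod>j\<in>{1..<p}. of_nat j)"

lemma nonzero_residues_prod_nonzero: "nonzero_residues_prod \<noteq> 0"
proof -
  have "(of_nat j :: 'k) \<noteq> 0" if "j \<in> {1..<p}" for j
    using that by (auto simp: of_nat_eq_0_iff_char_dvd CHAR_k dest: dvd_imp_le)
  then show ?thesis by (simp add: nonzero_residues_prod_def)
qed

lemma of_int_mod_p: "(of_int (x mod int p) :: 'k) = of_int x"
proof -
  have "(of_int x :: 'k) = of_int (int p * (x div int p) + x mod int p)" by simp
  also have "\<dots> = of_int (int p) * of_int (x div int p) + of_int (x mod int p)"
    by (simp only: of_int_add of_int_mult)
  also have "of_int (int p) = (0 :: 'k)"
    using of_nat_CHAR[where ?'a = 'k] unfolding CHAR_k by simp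
  finally show ?thesis by simp
qed

text \<open>Subtracting i0 modulo p permutes the residues and sends i0 to 0, so what remains is (p -
  1)! modulo p.\<close>

lemma prod_translated_residues:
  assumes "i0 < p"
  shows "(\<Prod>i\<in>{..<p} - {i0}. (of_int (int i - int i0) :: 'k)) = nonzero_residues_prod"
  unfolding nonzero_residues_prod_def
proof (rule prod.reindex_bij_witness[of _ "\<lambda>j. nat ((int j + int i0) mod int p)"
      "\<lambda>i. nat ((int i - int i0) mod int p)"], goal_cases)
  case (1 i)
  have "((int i - int i0) mod int p + int i0) mod int p = int i"
    using 1 unfolding mod_add_left_eq by simp
  then show ?case using p_gt_1 by simp
next
  case (2 i)
  then have i: "i < p" "i \<noteq> i0" by auto
  have "(int i - int i0) mod int p \<noteq> 0"
  proof
    assume "(int i - int i0) mod int p = 0"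
    then have "int i mod int p = int i0 mod int p" by (simp add: mod_eq_dvd_iff mod_eq_0_iff_dvd)
    then show False using i assms by simp
  qed
  moreover have "(int i - int i0) mod int p \<ge> 0" "(int i - int i0) mod int p < int p"
    using p_gt_1 by simp_all
  ultimately show ?case by (simp add: nat_less_iff)
next
  case (3 j)
  have "((int j + int i0) mod int p - int i0) mod int p = int j"
    using 3 unfolding mod_diff_left_eq by simp
  then show ?case using p_gt_1 by simp
next
  case (4 j)
  then have j: "0 < j" "j < p" by auto
  have "(int j + int i0) mod int p \<noteq> int i0"
  proof
    assume "(int j + int i0) mod int p = int i0"
    then have "(int j + int i0) mod int p = int i0 mod int p" using assms by simp
    then have "int p dvd int j" by (simp add: mod_eq_dvd_iff)
    then show False using j by (auto dest: zdvd_imp_le)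
  qed
  moreover have "(int j + int i0) mod int p \<ge> 0" "(int j + int i0) mod int p < int p"
    using p_gt_1 by simp_all
  ultimately show ?case by (auto simp: nat_less_iff)
next
  case (5 i)
  have "(of_nat (nat ((int i - int i0) mod int p)) :: 'k) = of_int ((int i - int i0) mod int p)"
    using p_gt_1 by simp
  also have "\<dots> = of_int (int i - int i0)" by (rule of_int_mod_p)
  finally show ?case .
qed

text \<open>Among the p factors x + i, the one selected by Dwork's map equals p
  \<open>dwork x\<close>. It forces x to reduce to -i0, so the other factors reduce to the nonzero
  residues i - i0.\<close>

lemma pochhammer_block:
  assumes "x \<in> Zloc p"
  obtains u where "u \<in> Zloc p" "pochhammer x p = of_nat p * dwork x * u"
    "red u = nonzero_residues_prod"
proof -
  obtain i0 where i0: "i0 < p" "of_nat p * dwork x = x + of_nat i0" "dwork x \<in> Zloc p"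
    using assms by (rule dworkE)
  define u where "u = (\<Prod>i\<in>{..<p} - {i0}. x + of_nat i)"
  have "pochhammer x p = (\<Prod>i\<in>{..<p}. x + of_nat i)"
    by (simp add: pochhammer_prod atLeast0LessThan)
  also have "\<dots> = of_nat p * dwork x * u"
    using i0 by (simp add: u_def prod.remove[of "{..<p}" i0])
  finally have 1: "pochhammer x p = of_nat p * dwork x * u" .
  have xi: "x + of_nat i \<in> Zloc p" for i using assms by (simp add: Zloc_add)
  then have 2: "u \<in> Zloc p" by (simp add: u_def Zloc_prod)
  have "red (x + of_nat i0) = 0"
    using i0(3) CHAR_k of_nat_CHAR[where ?'a = 'k] by (simp add: red_mult flip: i0(2))
  then have "red x = - of_nat i0"
    using assms by (simp add: red_add eq_neg_iff_add_eq_0)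
  then have "red (x + of_nat i) = of_int (int i - int i0)" for i
    using assms by (simp add: red_add)
  then have "red u = nonzero_residues_prod"
    using xi i0(1) by (simp add: u_def red_prod prod_translated_residues del: of_int_diff)
  with 1 2 show ?thesis using that by blast
qed

text \<open>The symbol splits into m blocks of length p, and from one block to the next the value of
  Dwork's map grows by 1. The values taken out of the blocks form a Pochhammer symbol of length
  m.\<close>

lemma pochhammer_blocks:
  assumes "x \<in> Zloc p"
  shows "\<exists>u. u \<in> Zloc p \<and> pochhammer x (p * m) = of_nat p ^ m * pochhammer (dwork x) m * u \<and>
    red u = nonzero_residues_prod ^ m"
proof (induction m)
  case (Suc m)
  then obtain u where u: "u \<in> Zloc p"
    "pochhammer x (p * m) = of_nat p ^ m * pochhammer (dwork x) m * u"
    "red u = nonzero_residues_prod ^ m" by blast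
  obtain v where v: "v \<in> Zloc p"
    "pochhammer (x + of_nat (p * m)) p = of_nat p * dwork (x + of_nat (p * m)) * v"
    "red v = nonzero_residues_prod"
    by (rule pochhammer_block[of "x + of_nat (p * m)"])
      (use assms in \<open>auto simp: Zloc_add simp del: of_nat_mult\<close>)
  have "pochhammer x (p * Suc m) = pochhammer x (p * m) * pochhammer (x + of_nat (p * m)) p"
    by (simp add: pochhammer_product' add.commute del: of_nat_mult flip: pochhammer_product')
  also have "\<dots> = of_nat p ^ Suc m * pochhammer (dwork x) (Suc m) * (u * v)"
    unfolding u(2) v(2) dwork_add_multiple[OF assms] by (simp add: pochhammer_Suc)
  finally show ?case using u v
    by (intro exI[of _ "u * v"]) (simp add: Zloc_mult red_mult mult.commute)
qed simp

lemma prod_pochhammer_blocks: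
  assumes "set A \<subseteq> Zloc p"
  shows "\<exists>u. u \<in> Zloc p \<and>
    (\<Prod>a\<leftarrow>A. pochhammer (a + of_nat r) (p * m)) =
      of_nat p ^ (m * length A) * (\<Prod>a\<leftarrow>A. pochhammer (dwork (a + of_nat r)) m) * u \<and>
    red u = nonzero_residues_prod ^ (m * length A)"
  using assms
proof (induction A)
  case (Cons a A)
  then obtain u where u: "u \<in> Zloc p"
    "(\<Prod>a\<leftarrow>A. pochhammer (a + of_nat r) (p * m)) =
      of_nat p ^ (m * length A) * (\<Prod>a\<leftarrow>A. pochhammer (dwork (a + of_nat r)) m) * u"
    "red u = nonzero_residues_prod ^ (m * length A)" by auto
  have "a + of_nat r \<in> Zloc p" using Cons.prems by (simp add: Zloc_add)
  from pochhammer_blocks[OF this] obtain v where v: "v \<in> Zloc p"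
    "pochhammer (a + of_nat r) (p * m) = of_nat p ^ m * pochhammer (dwork (a + of_nat r)) m * v"
    "red v = nonzero_residues_prod ^ m" by blast
  show ?case using u v
    by (intro exI[of _ "v * u"]) (simp add: Zloc_mult red_mult power_add)
qed simp

section \<open>Sections of hypergeometric series\<close>

lemma pochhammer_add_list:
  fixes A :: "rat list"
  shows "(\<Prod>a\<leftarrow>A. pochhammer a (r + l)) =
    (\<Prod>a\<leftarrow>A. pochhammer a r) * (\<Prod>a\<leftarrow>A. pochhammer (a + of_nat r) l)"
  by (induction A) (simp_all add: pochhammer_product')

text \<open>There are as many upper as lower parameters, so the powers of p and of (p - 1)! coming
  from the blocks cancel. The coefficient of index r + p m is that of h at m times u / v, which
  reduces to 1. As u / v is a unit at p, integrality passes to h even if single factors of its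
  coefficients are divisible by p.\<close>

lemma hyp_section:
  fixes r :: nat
  assumes AB: "set A \<subseteq> Zloc p" "set B \<subseteq> Zloc p" "length A = length B"
    and int: "integral (hyp A B c)"
  defines "h \<equiv> hyp (map (\<lambda>a. dwork (a + of_nat r)) A) (map (\<lambda>b. dwork (b + of_nat r)) B)
      (fps_nth (hyp A B c) r)"
  shows "integral h \<and> (\<forall>m. fps_nth (redf h) m = fps_nth (redf (hyp A B c)) (r + p * m))"
proof -
  have "fps_nth h m \<in> Zloc p \<and> red (fps_nth h m) = red (fps_nth (hyp A B c) (r + p * m))" for m
  proof -
    let ?N = "m * length B"
    obtain u where u: "u \<in> Zloc p"
      "(\<Prod>a\<leftarrow>A. pochhammer (a + of_nat r) (p * m)) =
        of_nat p ^ ?N * (\<Prod>a\<leftarrow>A. pochhammer (dwork (a + of_nat r)) m) * u"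
      "red u = nonzero_residues_prod ^ ?N"
      using prod_pochhammer_blocks[OF AB(1), of r m] AB(3) by auto
    obtain v where v: "v \<in> Zloc p"
      "(\<Prod>b\<leftarrow>B. pochhammer (b + of_nat r) (p * m)) =
        of_nat p ^ ?N * (\<Prod>b\<leftarrow>B. pochhammer (dwork (b + of_nat r)) m) * v"
      "red v = nonzero_residues_prod ^ ?N"
      using prod_pochhammer_blocks[OF AB(2), of r m] by auto
    have uv0: "red u \<noteq> 0" "red v \<noteq> 0" "u \<noteq> 0" "v \<noteq> 0"
      using u v nonzero_residues_prod_nonzero by auto
    have h: "fps_nth h m = fps_nth (hyp A B c) r *
      (\<Prod>a\<leftarrow>A. pochhammer (dwork (a + of_nat r)) m) / (\<Prod>b\<leftarrow>B. pochhammer (dwork (b + of_nat r)) m)"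
      by (simp add: h_def hyp_def o_def)
    have "fps_nth (hyp A B c) (r + p * m) = fps_nth (hyp A B c) r *
      (\<Prod>a\<leftarrow>A. pochhammer (a + of_nat r) (p * m)) / (\<Prod>b\<leftarrow>B. pochhammer (b + of_nat r) (p * m))"
      by (simp add: hyp_def pochhammer_add_list)
    also have "\<dots> = fps_nth h m * (u / v)"
      unfolding u(2) v(2) h using p_gt_1 by simp
    finally have eq: "fps_nth (hyp A B c) (r + p * m) = fps_nth h m * (u / v)" .
    have uinv: "inverse u \<in> Zloc p" "red (inverse u) = inverse (red u)"
      using Zloc_inverse_red u(1) uv0 by blast+
    have "fps_nth h m = fps_nth (hyp A B c) (r + p * m) * (v * inverse u)"
      using eq uv0 by (simp add: field_simps)
    moreover have "red (v * inverse u) = 1"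
      using uv0 u v uinv by (simp add: red_mult)
    ultimately show ?thesis
      using int v(1) uinv(1) by (simp add: integral_def Zloc_mult red_mult)
  qed
  then show ?thesis by (simp add: integral_def)
qed

text \<open>For suitable \<open>A0\<close> and \<open>B0\<close> the reductions of these series span
  the space W. The factor c is arbitrary as long as the series stays integral at p, and the lower
  parameter 1 for the factorial is never shifted.\<close>

definition hyp_class :: "rat list \<Rightarrow> rat list \<Rightarrow> rat fps set" where
  "hyp_class A0 B0 = {hyp A (B @ [1]) c | A B c.
     list_all2 shift_rel A0 A \<and> list_all2 shift_rel B0 B \<and> integral (hyp A (B @ [1]) c)}"

lemma list_all2_shift_Zloc:
  "list_all2 shift_rel A0 A \<Longrightarrow> set A0 \<subseteq> Zloc p \<Longrightarrow> set A \<subseteq> Zloc p"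
  by (induction rule: list_all2_induct) (auto simp: shift_rel_def Zloc_add)

lemma list_all2_shift_dwork:
  "list_all2 shift_rel A0 A \<Longrightarrow> set A0 \<subseteq> Zloc p \<Longrightarrow> r < p \<Longrightarrow>
    list_all2 shift_rel (map dwork A0) (map (\<lambda>a. dwork (a + of_nat r)) A)"
  by (induction rule: list_all2_induct) (auto simp: dwork_shift)

text \<open>The section at r has parameters \<open>dwork (a + r)\<close>, which differ from those of
  the reference lists under \<open>dwork\<close> by 0 or 1. All p sections therefore fall into one
  and the same class.\<close>

lemma hyp_class_sections:
  assumes h: "h \<in> hyp_class A0 B0" and Z: "set A0 \<subseteq> Zloc p" "set B0 \<subseteq> Zloc p"
    and len: "length A0 = Suc (length B0)"
  obtains g where "\<And>r. r < p \<Longrightarrow> g r \<in> hyp_class (map dwork A0) (map dwork B0)"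
    "redf h = (\<Sum>r<p. fps_X ^ r * redf (g r) ^ p)"
proof -
  obtain A B c where h_eq: "h = hyp A (B @ [1]) c" and A: "list_all2 shift_rel A0 A"
    and B: "list_all2 shift_rel B0 B" and int: "integral (hyp A (B @ [1]) c)"
    using h by (auto simp: hyp_class_def)
  define g where "g r = hyp (map (\<lambda>a. dwork (a + of_nat r)) A)
    (map (\<lambda>b. dwork (b + of_nat r)) (B @ [1])) (fps_nth h r)" for r
  have "set A \<subseteq> Zloc p" "set (B @ [1]) \<subseteq> Zloc p" "length A = length (B @ [1])"
    using list_all2_shift_Zloc[OF A Z(1)] list_all2_shift_Zloc[OF B Z(2)] len
      list_all2_lengthD[OF A] list_all2_lengthD[OF B] by auto
  note * = hyp_section[OF this int]
  have g: "integral (g r)" "fps_nth (redf (g r)) m = fps_nth (redf h) (r + p * m)" for r m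
    using *[of r] by (auto simp: g_def h_eq simp del: redf_nth)
  have "g r \<in> hyp_class (map dwork A0) (map dwork B0)" if r: "r < p" for r
  proof -
    have g_eq: "g r = hyp (map (\<lambda>a. dwork (a + of_nat r)) A)
        (map (\<lambda>b. dwork (b + of_nat r)) B @ [1]) (fps_nth h r)"
      using r by (simp add: g_def dwork_1_add)
    then show ?thesis
      using list_all2_shift_dwork[OF A Z(1) r] list_all2_shift_dwork[OF B Z(2) r] g(1)[of r]
      unfolding hyp_class_def by auto
  qed
  moreover have "redf h = (\<Sum>r<p. fps_X ^ r * redf (g r) ^ p)"
    by (rule fps_section_decomposition) (simp, rule g(2))
  ultimately show ?thesis using that by blast
qed

end

section \<open>Dimensions do not increase under reduction\<close>

lemma finite_rat_common_denominator:
  "finite (A :: rat set) \<Longrightarrow> \<exists>N>0. \<forall>a\<in>A. of_nat N * a \<in> \<int>"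
proof (induction rule: finite_induct)
  case (insert x A)
  then obtain N :: nat where N: "N > 0" "\<forall>a\<in>A. of_nat N * a \<in> \<int>" by blast
  obtain u v where uv: "quotient_of x = (u, v)" by (cases "quotient_of x")
  then have v: "v > 0" "x = of_int u / of_int v"
    using quotient_of_denom_pos quotient_of_div by blast+
  have "of_nat (nat v * N) * a \<in> \<int>" if "a \<in> insert x A" for a
  proof (cases "a = x")
    case True
    have "of_nat (nat v * N) * x = of_int (int N * u)" using v by simp
    then show ?thesis using True by (metis Ints_of_int)
  next
    case False
    then have "of_int v * (of_nat N * a) \<in> \<int>" using N that by simp
    then show ?thesis using v by (simp add: mult.assoc)
  qed
  then show ?case using N(1) v(1) by (intro exI[of _ "nat v * N"]) auto
qed auto

lemma smult_eq_of_int_poly: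
  fixes c :: "rat poly"
  assumes "\<And>k. x * Polynomial.coeff c k \<in> \<int>"
  obtains C :: "int poly" where "map_poly of_int C = Polynomial.smult x c"
proof
  show "map_poly of_int (map_poly floor (Polynomial.smult x c)) = Polynomial.smult x c"
    using assms by (intro poly_eqI) (auto simp: coeff_map_poly elim!: Ints_cases)
qed

context residue_char
begin

text \<open>As long as all its coefficients vanish modulo p, the relation is divided by p. The sum
  of the absolute values of the coefficients decreases, so this ends with a relation that survives
  reduction.\<close>

lemma primitive_relation:
  fixes C :: "rat fps \<Rightarrow> int poly"
  assumes "finite S" "(\<Sum>s\<in>S. fps_of_poly (map_poly of_int (C s)) * s) = 0" "\<exists>s\<in>S. C s \<noteq> 0"
  shows "\<exists>C. (\<Sum>s\<in>S. fps_of_poly (map_poly of_int (C s)) * s) = 0 \<and>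
    (\<exists>s\<in>S. map_poly of_int (C s) \<noteq> (0 :: 'k poly))"
  using assms(2,3)
proof (induction "\<Sum>s\<in>S. \<Sum>k\<le>degree (C s). nat \<bar>Polynomial.coeff (C s) k\<bar>" arbitrary: C rule: less_induct)
  case less
  let ?m = "\<lambda>C. \<Sum>s\<in>S. \<Sum>k\<le>degree (C s). nat \<bar>Polynomial.coeff (C s :: int poly) k\<bar>"
  show ?case
  proof (cases "\<exists>s\<in>S. map_poly of_int (C s) \<noteq> (0 :: 'k poly)")
    case True
    show ?thesis by (rule exI[of _ C]) (rule conjI[OF less.prems(1) True])
  next
    case False
    then have zero: "\<forall>s\<in>S. map_poly of_int (C s) = (0 :: 'k poly)" by simp
    have "\<exists>D. C s = Polynomial.smult (int p) D" if "s \<in> S" for s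
    proof -
      have "Polynomial.coeff (map_poly of_int (C s) :: 'k poly) k = 0" for k
        using zero that by simp
      then have "(of_int (Polynomial.coeff (C s) k) :: 'k) = 0" for k
        by (simp add: coeff_map_poly)
      then have "\<forall>k. int p dvd Polynomial.coeff (C s) k" by (simp add: of_int_k_eq_0_iff)
      then have "[:int p:] dvd C s" by (simp add: const_poly_dvd_iff)
      then show ?thesis by (auto elim!: dvdE)
    qed
    then obtain D where D: "\<And>s. s \<in> S \<Longrightarrow> C s = Polynomial.smult (int p) (D s)" by metis
    have "(\<Sum>s\<in>S. fps_of_poly (map_poly of_int (C s)) * s) =
        fps_const (of_nat p) * (\<Sum>s\<in>S. fps_of_poly (map_poly of_int (D s)) * s)"
      unfolding sum_distrib_left
    proof (intro sum.cong refl)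
      fix s assume "s \<in> S"
      have "map_poly of_int (C s) = Polynomial.smult (of_nat p) (map_poly of_int (D s) :: rat poly)"
        using D[OF \<open>s \<in> S\<close>] by (intro poly_eqI) (simp add: coeff_map_poly)
      then show "fps_of_poly (map_poly of_int (C s)) * s =
          fps_const (of_nat p) * (fps_of_poly (map_poly of_int (D s)) * s)"
        by (simp add: fps_of_poly_smult mult.assoc)
    qed
    then have rel: "(\<Sum>s\<in>S. fps_of_poly (map_poly of_int (D s)) * s) = 0"
      using less.prems(1) p_gt_1 by simp
    obtain s0 where s0: "s0 \<in> S" "D s0 \<noteq> 0"
      using less.prems(2) D by (metis smult_0_right)
    have "?m C = p * ?m D"
      unfolding sum_distrib_left
      using D p_gt_1 by (intro sum.cong) (simp_all add: abs_mult nat_mult_distrib sum_distrib_left)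
    moreover have "?m D > 0"
    proof -
      have "0 < nat \<bar>Polynomial.coeff (D s0) (degree (D s0))\<bar>" using s0 by simp
      also have "\<dots> \<le> (\<Sum>k\<le>degree (D s0). nat \<bar>Polynomial.coeff (D s0) k\<bar>)"
        by (rule member_le_sum) auto
      also have "\<dots> \<le> ?m D"
        using s0(1) assms(1) by (intro member_le_sum) auto
      finally show ?thesis .
    qed
    ultimately have "?m D < ?m C" using p_gt_1 by simp
    then show ?thesis by (rule less.hyps[OF _ rel]) (use s0 in blast)
  qed
qed

text \<open>Denominators are cleared twice, first of the rational functions and then of the rational
  coefficients of the polynomials; the primitive form of the relation has a nontrivial reduction.
  Injectivity on S prevents two terms from merging and their coefficients from cancelling.\<close>

lemma redf_dependent:
  assumes "finite S" "\<And>s. s \<in> S \<Longrightarrow> integral s" "inj_on redf S"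
    and "ratfun.dependent (fps_to_fls ` S)"
  shows "ratfun.dependent (fps_to_fls ` redf ` S)"
proof -
  obtain c where c: "(\<Sum>s\<in>S. fps_of_poly (c s) * s) = 0" "\<exists>s\<in>S. c s \<noteq> 0"
    using assms(1,4) by (rule ratfun_dependent_polyE)
  obtain N where N: "N > 0" "\<forall>a\<in>(\<Union>s\<in>S. set (coeffs (c s))). of_nat N * a \<in> \<int>"
    using finite_rat_common_denominator[of "\<Union>s\<in>S. set (coeffs (c s))"] assms(1) by auto
  have "\<exists>C :: int poly. map_poly of_int C = Polynomial.smult (of_nat N) (c s)" if "s \<in> S" for s
  proof -
    have "of_nat N * Polynomial.coeff (c s) k \<in> \<int>" for k
    proof (cases "Polynomial.coeff (c s) k = 0")
      case False
      then have "Polynomial.coeff (c s) k \<in> set (coeffs (c s))"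
        by (metis coeff_in_coeffs le_degree degree_0 coeff_0)
      then show ?thesis using N that by blast
    qed simp
    then show ?thesis using smult_eq_of_int_poly by metis
  qed
  then obtain C0 where C0: "\<And>s. s \<in> S \<Longrightarrow> map_poly of_int (C0 s) = Polynomial.smult (of_nat N) (c s)"
    by metis
  have "(\<Sum>s\<in>S. fps_of_poly (map_poly of_int (C0 s)) * s) =
      fps_const (of_nat N) * (\<Sum>s\<in>S. fps_of_poly (c s) * s)"
    unfolding sum_distrib_left
    by (intro sum.cong refl) (simp add: C0 fps_of_poly_smult mult.assoc)
  then have rel: "(\<Sum>s\<in>S. fps_of_poly (map_poly of_int (C0 s)) * s) = 0" using c(1) by simp
  have nonzero: "\<exists>s\<in>S. C0 s \<noteq> 0"
    using c(2) C0 N(1) by (metis map_poly_0 of_nat_0_eq_iff not_gr_zero smult_eq_0_iff)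
  obtain C where C: "(\<Sum>s\<in>S. fps_of_poly (map_poly of_int (C s)) * s) = 0"
    "\<exists>s\<in>S. map_poly of_int (C s) \<noteq> (0 :: 'k poly)"
    using primitive_relation[OF assms(1) rel nonzero] by (elim exE conjE)
  define c' where "c' t = (map_poly of_int (C (the_inv_into S redf t)) :: 'k poly)" for t
  have c': "c' (redf s) = map_poly of_int (C s)" if "s \<in> S" for s
    using that assms(3) by (simp add: c'_def the_inv_into_f_f)
  have "(\<Sum>t\<in>redf ` S. fps_of_poly (c' t) * t) = (\<Sum>s\<in>S. redf (fps_of_poly (map_poly of_int (C s)) * s))"
    using assms(2,3) by (simp add: sum.reindex c' redf_mult redf_of_int_poly)
  also have "\<dots> = redf (\<Sum>s\<in>S. fps_of_poly (map_poly of_int (C s)) * s)"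
    using assms(2) by (simp add: redf_sum integral_mult redf_of_int_poly)
  also have "\<dots> = 0" unfolding C(1) by (simp add: fps_eq_iff)
  finally show ?thesis
    using assms(1) C(2) c' by (intro ratfun_dependentI[where c = c']) auto
qed

text \<open>Otherwise n + 1 independent reductions could be lifted to n + 1 series of H. These are
  dependent in characteristic 0, and the dependence passes to the reductions.\<close>

lemma redf_span_dim:
  assumes "\<And>h. h \<in> H \<Longrightarrow> integral h"
    and "finite V" "card V \<le> n" "fps_to_fls ` H \<subseteq> ratfun.span V"
  obtains B :: "'k fls set" where "finite B" "card B \<le> n" "fps_to_fls ` redf ` H \<subseteq> ratfun.span B"
proof -
  obtain B where B: "B \<subseteq> fps_to_fls ` redf ` H" "ratfun.independent B"
    "fps_to_fls ` redf ` H \<subseteq> ratfun.span B"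
    by (rule ratfun.maximal_independent_subset)
  have "finite B \<and> card B \<le> n"
  proof (rule ccontr)
    assume "\<not> ?thesis"
    then obtain B' where B': "B' \<subseteq> B" "finite B'" "card B' = Suc n"
      by (metis infinite_arbitrarily_large not_less_eq_eq obtain_subset_with_card_n)
    then have "B' \<subseteq> (fps_to_fls \<circ> redf) ` H" using B(1) by (auto simp: image_comp)
    then obtain S where S: "S \<subseteq> H" "inj_on (fps_to_fls \<circ> redf) S" "B' = (fps_to_fls \<circ> redf) ` S"
      by (metis subset_image_inj)
    have finS: "finite S" "card S = Suc n"
      using B'(2,3) S(2) unfolding S(3) by (metis finite_image_iff, metis card_image)
    have "ratfun.dependent (fps_to_fls ` S)"
    proof (rule ccontr)
      assume "\<not> ?thesis"
      then have "card (fps_to_fls ` S) \<le> card V"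
        using ratfun.independent_span_bound[of V "fps_to_fls ` S"] assms(2,4) S(1) by blast
      moreover have "card (fps_to_fls ` S) = card S" by (rule card_image) (auto simp: inj_on_def)
      ultimately show False using finS assms(3) by simp
    qed
    then have "ratfun.dependent (fps_to_fls ` redf ` S)"
      using finS S assms(1) by (intro redf_dependent) (auto intro: inj_on_imageI2)
    then have "ratfun.dependent B'" by (simp add: S(3) image_comp)
    then show False using B(2) B'(1) ratfun.dependent_mono by blast
  qed
  then show ?thesis using that B(3) by blast
qed

end

section \<open>Contiguous hypergeometric series span a space of small dimension\<close>

text \<open>With \<theta> = x d/dx and G the generating function of g, the series
  \<open>op P\<close> is P(\<theta>) G, and the recurrence is the differential equation S(\<theta>)
  G = x R(\<theta>) G. As S and R are monic of the same degree n, its leading coefficient is 1 - x,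
  which is nonzero. All P(\<theta>) G therefore reduce to combinations of \<theta>^j G with j <
  n.\<close>

lemma fps_poly_recurrence_span:
  fixes g :: "nat \<Rightarrow> rat" and S R :: "rat poly"
  assumes S: "lead_coeff S = 1" "degree S = n" and R: "lead_coeff R = 1" "degree R = n" and "n > 0"
    and rec: "\<And>m. poly S (of_nat (Suc m)) * g (Suc m) = poly R (of_nat m) * g m"
    and init: "poly S 0 = 0"
  shows "\<exists>V. finite V \<and> card V \<le> n \<and>
    (\<forall>P. fps_to_fls (Abs_fps (\<lambda>m. poly P (of_nat m) * g m)) \<in> ratfun.span V)"
proof -
  define op where "op P = Abs_fps (\<lambda>m. poly P (of_nat m) * g m)" for P :: "rat poly"
  have op_add: "op (P + Q) = op P + op Q" for P Q
    by (simp add: op_def fps_eq_iff algebra_simps)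
  have op_smult: "op (Polynomial.smult c P) = fps_of_poly [:c:] * op P" for c P
    by (simp add: op_def fps_eq_iff fps_of_poly_const mult.assoc)
  \<comment> \<open>The commutation rule P(\<theta>) x = x P(\<theta> + 1), read on coefficients.
    The constant term vanishes because S(0) = 0.\<close>
  have op_S: "op (P * S) = fps_X * op (pcompose P [:1, 1:] * R)" for P
  proof (rule fps_ext)
    fix m
    show "fps_nth (op (P * S)) m = fps_nth (fps_X * op (pcompose P [:1, 1:] * R)) m"
      using rec init by (cases m) (simp_all add: op_def poly_pcompose mult.assoc)
  qed
  define V where "V = (\<lambda>j. fps_to_fls (op (Polynomial.monom 1 j))) ` {..<n}"
  have "degree P < N \<Longrightarrow> fps_to_fls (op P) \<in> ratfun.span V" for N P
  proof (induction N arbitrary: P)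
    case (Suc N)
    show ?case
    proof (cases "N < n")
      case True
      have op_0: "op 0 = 0" by (simp add: op_def fps_eq_iff)
      have op_sum: "op (sum f I) = (\<Sum>i\<in>I. op (f i))" for f and I :: "nat set"
        by (induction I rule: infinite_finite_induct) (simp_all add: op_add op_0)
      have "op P = op (\<Sum>i\<le>degree P. Polynomial.smult (Polynomial.coeff P i) (Polynomial.monom 1 i))"
        using poly_as_sum_of_monoms[of P] by (simp add: smult_monom)
      then have "fps_to_fls (op P) = (\<Sum>i\<le>degree P.
          fps_to_fls (fps_of_poly [:Polynomial.coeff P i:]) * fps_to_fls (op (Polynomial.monom 1 i)))"
        by (simp add: op_sum op_smult fps_to_fls_sum fls_times_fps_to_fls)
      also have "\<dots> \<in> ratfun.span V"
        by (intro ratfun.span_sum ratfun_span_poly ratfun.span_base)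
          (use True Suc.prems in \<open>auto simp: V_def\<close>)
      finally show ?thesis .
    next
      case False
      have lower: "fps_to_fls (op Q) \<in> ratfun.span V" if "\<And>k. k \<ge> N \<Longrightarrow> Polynomial.coeff Q k = 0" for Q
        using that False \<open>n > 0\<close> by (intro Suc.IH degree_lessI) auto
      \<comment> \<open>M raises the degree of S and R to N. Both T and T' are then monic of degree
        N, so T' - T has smaller degree and is covered by the induction.\<close>
      define M where "M = Polynomial.monom (1 :: rat) (N - n)"
      define T where "T = M * S"
      define T' where "T' = pcompose M [:1, 1:] * R"
      have M: "M \<noteq> 0" "degree M = N - n" "lead_coeff M = 1"
        by (simp_all add: M_def degree_monom_eq)
      have M': "lead_coeff (pcompose M [:1, 1:]) = 1"
        using M(3) by (subst lead_coeff_comp) simp_all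
      have M'': "degree (pcompose M [:1, 1:]) = N - n"
        using M(2) by (simp add: degree_pcompose)
      have "lead_coeff T = 1" "lead_coeff T' = 1"
        by (simp_all only: T_def T'_def lead_coeff_mult M(3) M' S(1) R(1) mult_1)
      moreover have "M * S \<noteq> 0" "pcompose M [:1, 1:] * R \<noteq> 0"
        using calculation by (auto simp: T_def T'_def)
      then have deg: "degree T = N" "degree T' = N"
        using S(2) R(2) M(2) M'' False by (simp_all add: T_def T'_def degree_mult_eq)
      ultimately have T: "degree T = N" "Polynomial.coeff T N = 1"
        and T': "degree T' = N" "Polynomial.coeff T' N = 1" by simp_all
      have zero: "Polynomial.coeff Q k = 0" if "degree Q \<le> N" "k > N" for Q :: "rat poly" and k
        using that by (simp add: coeff_eq_0)
      have opT': "fps_to_fls (op (T' - T)) \<in> ratfun.span V"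
      proof (rule lower)
        fix k assume "k \<ge> N"
        then show "Polynomial.coeff (T' - T) k = 0"
          using T T' zero[of T k] zero[of T' k] by (cases "k = N") auto
      qed
      have "op T = fps_X * op (T + (T' - T))" using op_S[of M] by (simp add: T_def T'_def)
      then have eq: "op T = fps_X * (op T + op (T' - T))" unfolding op_add .
      have lin: "fps_of_poly [:1, -1:] = (1 - fps_X :: rat fps)"
        by (rule fps_ext) (auto simp: coeff_pCons split: nat.splits)
      have X: "fps_of_poly [:0, 1:] = (fps_X :: rat fps)"
        by (simp add: fps_of_poly_pCons)
      \<comment> \<open>From \<open>op T\<close> = x \<open>op T'\<close> and T' = T + (T' - T): the
        top terms combine to (1 - x) \<open>op T\<close>, and 1 - x can be cancelled over the
        rational functions.\<close>
      have "fps_of_poly [:1, -1:] * op T = fps_of_poly [:0, 1:] * op (T' - T)"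
        using eq unfolding lin X by (simp add: algebra_simps)
      then have "fps_to_fls (fps_of_poly [:1, -1:]) * fps_to_fls (op T) =
          fps_to_fls (fps_of_poly [:0, 1:]) * fps_to_fls (op (T' - T))"
        by (metis fls_times_fps_to_fls)
      with opT' have "fps_to_fls (fps_of_poly [:1, -1:]) * fps_to_fls (op T) \<in> ratfun.span V"
        by (metis ratfun_span_poly)
      then have opT: "fps_to_fls (op T) \<in> ratfun.span V"
        by (rule ratfun_span_poly_cancel) simp
      define c where "c = Polynomial.coeff P N"
      have "fps_to_fls (op (P - Polynomial.smult c T)) \<in> ratfun.span V"
      proof (rule lower)
        fix k assume "k \<ge> N"
        then show "Polynomial.coeff (P - Polynomial.smult c T) k = 0"
          using T Suc.prems zero[of T k] zero[of P k] by (cases "k = N") (auto simp: c_def)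
      qed
      moreover have "fps_to_fls (fps_of_poly [:c:]) * fps_to_fls (op T) \<in> ratfun.span V"
        using opT by (rule ratfun_span_poly)
      ultimately have "fps_to_fls (op (P - Polynomial.smult c T)) +
          fps_to_fls (fps_of_poly [:c:]) * fps_to_fls (op T) \<in> ratfun.span V"
        by (rule ratfun.span_add)
      also have "fps_to_fls (op (P - Polynomial.smult c T)) +
          fps_to_fls (fps_of_poly [:c:]) * fps_to_fls (op T) = fps_to_fls (op P)"
        using op_add[of "P - Polynomial.smult c T" "Polynomial.smult c T"]
        by (simp add: op_smult fls_times_fps_to_fls)
      finally show ?thesis .
    qed
  qed simp
  moreover have "finite V" "card V \<le> n"
    unfolding V_def using card_image_le[of "{..<n}"] by auto
  ultimately show ?thesis unfolding op_def by blast
qed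

text \<open>The quotient of the symbols for a + 1 and a is 1 + m / a, a polynomial in the index m;
  positivity makes a nonzero.\<close>

lemma prod_list_pochhammer_shift:
  assumes "list_all2 shift_rel A0 A" "\<forall>a\<in>set A0. a > 0"
  shows "\<exists>P. \<forall>m. (\<Prod>a\<leftarrow>A. pochhammer a m) = poly P (of_nat m) * (\<Prod>a\<leftarrow>A0. pochhammer a m)"
  using assms
proof (induction rule: list_all2_induct)
  case Nil
  show ?case by (rule exI[of _ 1]) simp
next
  case (Cons a0 A0 a A)
  then obtain P where P: "\<And>m. (\<Prod>a\<leftarrow>A. pochhammer a m) = poly P (of_nat m) * (\<Prod>a\<leftarrow>A0. pochhammer a m)"
    by auto
  have "\<exists>Q. \<forall>m. pochhammer a m = poly Q (of_nat m) * pochhammer a0 m"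
  proof (cases "a = a0")
    case True
    then show ?thesis by (intro exI[of _ 1]) simp
  next
    case False
    then have a: "a = a0 + 1" using Cons.hyps by (simp add: shift_rel_def)
    have "pochhammer (a0 + 1) m = poly [:1, 1 / a0:] (of_nat m) * pochhammer a0 m" for m
    proof -
      have "a0 * pochhammer (a0 + 1) m = (a0 + of_nat m) * pochhammer a0 m"
        using pochhammer_rec[of a0 m] pochhammer_rec'[of a0 m] by simp
      moreover have "a0 \<noteq> 0" using Cons.prems by auto
      ultimately have "pochhammer (a0 + 1) m = (a0 + of_nat m) * pochhammer a0 m / a0"
        by (simp add: eq_divide_eq mult.commute)
      with \<open>a0 \<noteq> 0\<close> show ?thesis by (simp add: distrib_right add_divide_distrib)
    qed
    then show ?thesis using a by blast
  qed
  then obtain Q where "\<And>m. pochhammer a m = poly Q (of_nat m) * pochhammer a0 m" by blast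
  with P show ?case by (intro exI[of _ "Q * P"]) simp
qed

text \<open>In the denominator the reference parameter has to be b + 1. The reciprocal symbol for b
  is 1 + m / b times the one for b + 1, whereas the converse passage would divide by this
  polynomial.\<close>

lemma prod_list_inverse_pochhammer_shift:
  assumes "list_all2 shift_rel B0 B" "\<forall>b\<in>set B0. b > 0"
  shows "\<exists>P. \<forall>m. 1 / (\<Prod>b\<leftarrow>B. pochhammer b m) =
    poly P (of_nat m) / (\<Prod>b\<leftarrow>B0. pochhammer (b + 1) m)"
  using assms
proof (induction rule: list_all2_induct)
  case Nil
  show ?case by (rule exI[of _ 1]) simp
next
  case (Cons b0 B0 b B)
  then obtain P where P: "\<And>m. 1 / (\<Prod>b\<leftarrow>B. pochhammer b m) =
      poly P (of_nat m) / (\<Prod>b\<leftarrow>B0. pochhammer (b + 1) m)"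
    by auto
  have "\<exists>Q. \<forall>m. 1 / pochhammer b m = poly Q (of_nat m) / pochhammer (b0 + 1) m"
  proof (cases "b = b0")
    case False
    then show ?thesis using Cons.hyps by (intro exI[of _ 1]) (simp add: shift_rel_def)
  next
    case True
    have "1 / pochhammer b0 m = poly [:1, 1 / b0:] (of_nat m) / pochhammer (b0 + 1) m" for m
    proof -
      have b0: "b0 > 0" using Cons.prems by simp
      have "b0 * pochhammer (b0 + 1) m = (b0 + of_nat m) * pochhammer b0 m"
        using pochhammer_rec[of b0 m] pochhammer_rec'[of b0 m] by simp
      moreover have "pochhammer b0 m > 0" "b0 + of_nat m > 0"
        using b0 by (simp_all add: pochhammer_pos add_pos_nonneg)
      ultimately have "1 / pochhammer b0 m = (b0 + of_nat m) / (b0 * pochhammer (b0 + 1) m)"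
        by simp
      then show ?thesis using b0 by (simp add: add_divide_distrib)
    qed
    then show ?thesis using True by blast
  qed
  then obtain Q where "\<And>m. 1 / pochhammer b m = poly Q (of_nat m) / pochhammer (b0 + 1) m" by blast
  then have "1 / (\<Prod>b\<leftarrow>b # B. pochhammer b m) =
      poly (Q * P) (of_nat m) / (\<Prod>b\<leftarrow>b0 # B0. pochhammer (b + 1) m)" for m
    using P[of m] by (simp add: divide_inverse mult.commute mult.left_commute mult.assoc)
  then show ?case by blast
qed

lemma monic_prod_linear:
  fixes f :: "'b \<Rightarrow> 'a::idom"
  shows "lead_coeff (\<Prod>x\<leftarrow>xs. [:f x, 1:]) = 1 \<and> degree (\<Prod>x\<leftarrow>xs. [:f x, 1:]) = length xs"
proof (induction xs)
  case (Cons x xs)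
  let ?P = "\<Prod>x\<leftarrow>xs. [:f x, 1:]"
  have "lead_coeff ([:f x, 1:] * ?P) = 1"
    by (simp only: lead_coeff_mult Cons.IH[THEN conjunct1]) simp
  moreover have "degree ([:f x, 1:] * ?P) = Suc (length xs)"
    using Cons by (subst degree_mult_eq) auto
  ultimately show ?case by (simp del: mult_pCons_left)
qed simp

lemma poly_prod_linear:
  fixes y :: "'a::comm_ring_1"
  shows "poly (\<Prod>x\<leftarrow>xs. [:f x, 1:]) y = (\<Prod>x\<leftarrow>xs. f x + y)"
  by (induction xs) (simp_all add: distrib_right)

lemma prod_list_mult: "(\<Prod>x\<leftarrow>xs. f x * g x) = (\<Prod>x\<leftarrow>xs. f x) * (\<Prod>x\<leftarrow>xs. g x :: 'a::comm_monoid_mult)"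
  by (induction xs) (simp_all add: ac_simps)

context residue_char
begin

text \<open>All members arise by polynomials in \<theta> = x d/dx from one series, with the upper
  parameters a and the lower parameters b + 1 and 1. Its coefficients satisfy a first-order
  recurrence.\<close>

lemma hyp_class_span:
  assumes len: "length A0 = Suc (length B0)" and pos: "\<forall>a\<in>set A0. a > 0" "\<forall>b\<in>set B0. b > 0"
  shows "\<exists>V. finite V \<and> card V \<le> length A0 \<and> fps_to_fls ` hyp_class A0 B0 \<subseteq> ratfun.span V"
proof -
  define Bs where "Bs = map (\<lambda>b. b + 1) B0 @ [1]"
  define g where "g m = (\<Prod>a\<leftarrow>A0. pochhammer a m) / (\<Prod>b\<leftarrow>Bs. pochhammer b m)" for m
  \<comment> \<open>The recurrence evaluates S at m + 1, hence the root 1 - b. The last entry 1 of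
    \<open>Bs\<close> provides the root 0.\<close>
  define S where "S = (\<Prod>b\<leftarrow>Bs. [:b - 1, 1:])"
  define R where "R = (\<Prod>a\<leftarrow>A0. [:a, 1:])"
  have "\<exists>V. finite V \<and> card V \<le> length A0 \<and>
    (\<forall>P. fps_to_fls (Abs_fps (\<lambda>m. poly P (of_nat m) * g m)) \<in> ratfun.span V)"
  proof (rule fps_poly_recurrence_span)
    have "length Bs = length A0" using len by (simp add: Bs_def)
    then show "degree S = length A0" "degree R = length A0"
      using monic_prod_linear[of "\<lambda>b. b - 1" Bs] monic_prod_linear[of "\<lambda>a. a" A0]
      unfolding S_def R_def by simp_all
    show "lead_coeff S = 1" "lead_coeff R = 1"
      unfolding S_def R_def by (rule monic_prod_linear[THEN conjunct1])+
    show "length A0 > 0" using len by simp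
    show "poly S 0 = 0" by (simp add: S_def Bs_def)
    fix m
    have Bpos: "\<forall>b\<in>set Bs. b > 0" using pos by (auto simp: Bs_def)
    then have nz: "(\<Prod>b\<leftarrow>Bs. pochhammer b m) \<noteq> 0" "(\<Prod>b\<leftarrow>Bs. b + of_nat m) \<noteq> 0"
      by (auto simp: prod_list_zero_iff pochhammer_pos dest!: bspec intro: less_imp_neq)
         (metis add_pos_nonneg less_irrefl of_nat_0_le_iff pochhammer_pos)+
    have "poly S (of_nat (Suc m)) = (\<Prod>b\<leftarrow>Bs. b + of_nat m)"
      by (simp add: S_def poly_prod_linear o_def algebra_simps)
    moreover have "poly R (of_nat m) = (\<Prod>a\<leftarrow>A0. a + of_nat m)"
      by (simp add: R_def poly_prod_linear)
    ultimately show "poly S (of_nat (Suc m)) * g (Suc m) = poly R (of_nat m) * g m"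
      using nz by (simp add: g_def pochhammer_Suc prod_list_mult)
  qed
  then obtain V where V: "finite V" "card V \<le> length A0"
    "\<And>P. fps_to_fls (Abs_fps (\<lambda>m. poly P (of_nat m) * g m)) \<in> ratfun.span V" by blast
  have "fps_to_fls h \<in> ratfun.span V" if h: "h \<in> hyp_class A0 B0" for h
  proof -
    obtain A B c where h_eq: "h = hyp A (B @ [1]) c" and A: "list_all2 shift_rel A0 A"
      and B: "list_all2 shift_rel B0 B"
      using h by (auto simp: hyp_class_def)
    obtain P where P: "\<And>m. (\<Prod>a\<leftarrow>A. pochhammer a m) = poly P (of_nat m) * (\<Prod>a\<leftarrow>A0. pochhammer a m)"
      using prod_list_pochhammer_shift[OF A pos(1)] by blast
    obtain Q where Q: "\<And>m. 1 / (\<Prod>b\<leftarrow>B. pochhammer b m) =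
        poly Q (of_nat m) / (\<Prod>b\<leftarrow>B0. pochhammer (b + 1) m)"
      using prod_list_inverse_pochhammer_shift[OF B pos(2)] by blast
    have "h = Abs_fps (\<lambda>m. poly (Polynomial.smult c (P * Q)) (of_nat m) * g m)"
    proof (rule fps_ext)
      fix m
      have "fps_nth h m = c * (\<Prod>a\<leftarrow>A. pochhammer a m) * (1 / (\<Prod>b\<leftarrow>B. pochhammer b m)) / pochhammer 1 m"
        by (simp add: h_eq hyp_def)
      also have "\<dots> = poly (Polynomial.smult c (P * Q)) (of_nat m) * g m"
        unfolding P Q by (simp add: g_def Bs_def o_def)
      finally show "fps_nth h m = fps_nth (Abs_fps (\<lambda>m. poly (Polynomial.smult c (P * Q)) (of_nat m) * g m)) m"
        by simp
    qed
    then show ?thesis using V(3) by metis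
  qed
  then show ?thesis using V by blast
qed

end

section \<open>A linear relation between the Frobenius powers\<close>

lemma mset_eq_imp_prod_list_eq:
  assumes "mset xs = mset ys"
  shows "(\<Prod>x\<leftarrow>xs. f x) = (\<Prod>x\<leftarrow>ys. f x :: 'a::comm_monoid_mult)"
  using assms by (metis mset_map prod_mset_prod_list)

lemma hyp_cong_mset: "mset A = mset A' \<Longrightarrow> mset B = mset B' \<Longrightarrow> hyp A B c = hyp A' B' c"
  unfolding hyp_def by (intro arg_cong[of _ _ Abs_fps] ext) (metis mset_eq_imp_prod_list_eq)

text \<open>The representative modulo the integers in (0, 1]. It replaces \<open>frac\<close>
  because parameters have to stay positive, so that an integer is represented by 1.\<close>

definition frac1 :: "rat \<Rightarrow> rat" where
  "frac1 x = x - of_int \<lceil>x\<rceil> + 1"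

lemma frac1_bounds: "0 < frac1 x" "frac1 x \<le> 1"
  unfolding frac1_def by linarith+

lemma frac1_eq: "0 < x \<Longrightarrow> x \<le> 1 \<Longrightarrow> frac1 x = x"
  unfolding frac1_def by (simp add: ceiling_unique)

lemma frac1_add_of_int: "frac1 (x + of_int i) = frac1 x"
  unfolding frac1_def by simp

lemma frac1_conv_frac: "frac1 x = (if frac x = 0 then 1 else frac x)"
proof -
  have "frac1 x = frac1 (frac x)"
    using frac1_add_of_int[of "frac x" "\<lfloor>x\<rfloor>"] by (simp add: frac_def)
  also have "\<dots> = (if frac x = 0 then 1 else frac x)"
  proof (cases "frac x = 0")
    case True
    then show ?thesis by (simp add: frac1_def)
  next
    case False
    then have "0 < frac x" by (metis frac_ge_0 less_eq_rat_def)
    then show ?thesis using False frac_lt_1[of x] by (simp add: frac1_eq)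
  qed
  finally show ?thesis .
qed

lemma image_frac1_residues:
  "image_mset frac1 (mset xs) = image_mset (\<lambda>y. if y = 0 then 1 else y) (residues_mod_Ints xs)"
  unfolding residues_mod_Ints_def image_mset.compositionality o_def
  by (rule image_mset_cong) (rule frac1_conv_frac)

context residue_char
begin

text \<open>Dwork's map restores the parameters only up to their order.\<close>

lemma hyp_class_cong_mset:
  assumes "mset A0 = mset A0'" "mset B0 = mset B0'"
  shows "hyp_class A0 B0 = hyp_class A0' B0'"
proof -
  have "hyp_class A0 B0 \<subseteq> hyp_class A0' B0'" if eq: "mset A0 = mset A0'" "mset B0 = mset B0'" for A0 B0 A0' B0'
  proof
    fix h assume "h \<in> hyp_class A0 B0"
    then obtain A B c where h: "h = hyp A (B @ [1]) c" "list_all2 shift_rel A0 A"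
      "list_all2 shift_rel B0 B" "integral h"
      by (auto simp: hyp_class_def)
    obtain A' where A': "list_all2 shift_rel A0' A'" "mset A' = mset A"
      using list_all2_reorder_left_invariance[OF h(2) sym[OF eq(1)]] by blast
    obtain B' where B': "list_all2 shift_rel B0' B'" "mset B' = mset B"
      using list_all2_reorder_left_invariance[OF h(3) sym[OF eq(2)]] by blast
    have "h = hyp A' (B' @ [1]) c"
      unfolding h(1) using A' B' by (intro hyp_cong_mset) simp_all
    with A' B' h(4) show "h \<in> hyp_class A0' B0'" unfolding hyp_class_def by blast
  qed
  from this[OF assms] this[OF sym[OF assms(1)] sym[OF assms(2)]] show ?thesis by blast
qed

section \<open>Frobenius powers of spans\<close>

lemma frobenius_fls_add: "(x + y :: 'k fls) ^ (p ^ e) = x ^ (p ^ e) + y ^ (p ^ e)"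
  by (rule freshmans_dream'[where n = e]) (use prime_p CHAR_k in simp_all)

lemma frobenius_fls_sum: "(\<Sum>i\<in>I. g i :: 'k fls) ^ (p ^ e) = (\<Sum>i\<in>I. g i ^ (p ^ e))"
  by (rule freshmans_dream_sum'[where n = e]) (use prime_p CHAR_k in simp_all)

text \<open>The elements whose power lies in the given span form a subspace: powers with exponent
  p^e are additive, and a scalar r turns into the scalar r^(p^e).\<close>

lemma frobenius_span:
  fixes v :: "'k fls"
  assumes "v \<in> ratfun.span U"
  shows "v ^ (p ^ e) \<in> ratfun.span ((\<lambda>x. x ^ (p ^ e)) ` U)"
proof -
  let ?S = "ratfun.span ((\<lambda>x. x ^ (p ^ e)) ` U)"
  have "p ^ e > 0" using p_gt_1 by simp
  have "ratfun.subspace {v. v ^ (p ^ e) \<in> ?S}"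
    unfolding ratfun.subspace_def
  proof (intro conjI ballI allI)
    show "0 \<in> {v. v ^ (p ^ e) \<in> ?S}" using \<open>p ^ e > 0\<close> by (simp only: mem_Collect_eq zero_power ratfun.span_zero)
  next
    fix x y :: "'k fls" assume "x \<in> {v. v ^ (p ^ e) \<in> ?S}" "y \<in> {v. v ^ (p ^ e) \<in> ?S}"
    then show "x + y \<in> {v. v ^ (p ^ e) \<in> ?S}" by (simp add: frobenius_fls_add ratfun.span_add)
  next
    fix r and x :: "'k fls" assume "x \<in> {v. v ^ (p ^ e) \<in> ?S}"
    then have "fls_of_ratfun (r ^ (p ^ e)) * x ^ (p ^ e) \<in> ?S" by (intro ratfun.span_scale) simp
    then show "fls_of_ratfun r * x \<in> {v. v ^ (p ^ e) \<in> ?S}"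
      by (simp add: power_mult_distrib fls_of_ratfun_power)
  qed
  moreover have "U \<subseteq> {v. v ^ (p ^ e) \<in> ?S}" by (auto intro: ratfun.span_base)
  ultimately have "ratfun.span U \<subseteq> {v. v ^ (p ^ e) \<in> ?S}" by (intro ratfun.span_minimal)
  with assms show ?thesis by blast
qed

lemma ratfun_span_trans: "x \<in> ratfun.span U \<Longrightarrow> U \<subseteq> ratfun.span Y \<Longrightarrow> x \<in> ratfun.span Y"
  for x :: "'k fls"
  using ratfun.span_minimal[OF _ ratfun.subspace_span] by blast

lemma dwork_iterate_Zloc: "x \<in> Zloc p \<Longrightarrow> (dwork ^^ s) x \<in> Zloc p"
  by (induction s) (simp_all add: dwork_Zloc)

text \<open>Raising the decomposition into sections to the power p^s turns its factors x^r into the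
  scalars x^(r p^s), and the p-th powers into powers with exponent p^(s+1).\<close>

lemma hyp_class_iterate:
  assumes Z: "set A0 \<subseteq> Zloc p" "set B0 \<subseteq> Zloc p" and len: "length A0 = Suc (length B0)"
    and h: "h \<in> hyp_class A0 B0"
  shows "fps_to_fls (redf h) \<in> ratfun.span ((\<lambda>g. fps_to_fls (redf g) ^ (p ^ s)) `
    hyp_class (map (dwork ^^ s) A0) (map (dwork ^^ s) B0))"
proof (induction s)
  case 0
  show ?case using h by (auto intro!: ratfun.span_base)
next
  case (Suc s)
  let ?C = "\<lambda>s. hyp_class (map (dwork ^^ s) A0) (map (dwork ^^ s) B0)"
  have "fps_to_fls (redf h') ^ (p ^ s) \<in> ratfun.span ((\<lambda>g. fps_to_fls (redf g) ^ (p ^ Suc s)) ` ?C (Suc s))"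
    if h': "h' \<in> ?C s" for h'
  proof -
    have Z': "set (map (dwork ^^ s) A0) \<subseteq> Zloc p" "set (map (dwork ^^ s) B0) \<subseteq> Zloc p"
      and len': "length (map (dwork ^^ s) A0) = Suc (length (map (dwork ^^ s) B0))"
      using Z len by (auto intro!: dwork_iterate_Zloc)
    obtain g where g: "\<And>r. r < p \<Longrightarrow> g r \<in> hyp_class (map dwork (map (dwork ^^ s) A0)) (map dwork (map (dwork ^^ s) B0))"
      "redf h' = (\<Sum>r<p. fps_X ^ r * redf (g r) ^ p)"
      by (rule hyp_class_sections[OF h' Z' len']) blast
    have gC: "g r \<in> ?C (Suc s)" if "r < p" for r using g(1)[OF that] by (simp add: o_def)
    have "fps_to_fls (redf h') ^ (p ^ s) = (\<Sum>r<p. fps_to_fls (fps_of_poly (Polynomial.monom 1 (r * p ^ s))) *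
        fps_to_fls (redf (g r)) ^ (p ^ Suc s))"
      by (simp add: g(2) fps_to_fls_sum frobenius_fls_sum fls_times_fps_to_fls power_mult_distrib
          fps_to_fls_power fps_of_poly_monom power_mult del: fls_times_fps_to_fls[symmetric])
    also have "\<dots> \<in> ratfun.span ((\<lambda>g. fps_to_fls (redf g) ^ (p ^ Suc s)) ` ?C (Suc s))"
      using gC by (intro ratfun.span_sum ratfun_span_poly ratfun.span_base) auto
    finally show ?thesis .
  qed
  then show ?case by (intro ratfun_span_trans[OF Suc] image_subsetI)
qed

text \<open>The exponents are balanced so that all powers of f meet: f is expressed through powers
  of W with exponent q^(n-i+1) and then raised to the power q^i. The powers of the spanning set B
  are still at most n elements, too few for n + 1 independent ones.\<close>

lemma frobenius_relation:
  fixes W :: "'k fls set"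
  assumes q: "q = p ^ s" and B: "finite B" "card B \<le> n" "W \<subseteq> ratfun.span B"
    and W: "W \<subseteq> ratfun.span ((\<lambda>w. w ^ q) ` W)" and f: "f \<in> ratfun.span ((\<lambda>w. w ^ q) ` W)"
  obtains c where "(\<Sum>i\<le>n. fls_of_ratfun (c i) * f ^ (q ^ i)) = 0" "\<exists>i\<le>n. c i \<noteq> 0"
proof -
  have frob: "v ^ (q ^ e) \<in> ratfun.span ((\<lambda>x. x ^ (q ^ e)) ` U)" if "v \<in> ratfun.span U" for v :: "'k fls" and U e
    using frobenius_span[OF that, of "s * e"] by (simp add: q power_mult)
  have W_pow: "W \<subseteq> ratfun.span ((\<lambda>w. w ^ (q ^ e)) ` W)" for e
  proof (induction e)
    case 0
    show ?case by (auto intro: ratfun.span_base)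
  next
    case (Suc e)
    have step: "(\<lambda>w. w ^ (q ^ e)) ` W \<subseteq> ratfun.span ((\<lambda>w. w ^ (q ^ Suc e)) ` W)"
    proof
      fix y assume "y \<in> (\<lambda>w. w ^ (q ^ e)) ` W"
      then obtain w where "y = w ^ (q ^ e)" "w \<in> ratfun.span ((\<lambda>w. w ^ q) ` W)" using W by blast
      then show "y \<in> ratfun.span ((\<lambda>w. w ^ (q ^ Suc e)) ` W)"
        using frob[of w "(\<lambda>w. w ^ q) ` W" e] by (simp add: image_image mult.commute flip: power_mult)
    qed
    show ?case
    proof
      fix w assume "w \<in> W"
      then have "w \<in> ratfun.span ((\<lambda>w. w ^ (q ^ e)) ` W)" using Suc by blast
      then show "w \<in> ratfun.span ((\<lambda>w. w ^ (q ^ Suc e)) ` W)" using step by (rule ratfun_span_trans)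
    qed
  qed
  have f_pow: "f ^ (q ^ i) \<in> ratfun.span ((\<lambda>x. x ^ (q ^ Suc n)) ` B)" if "i \<le> n" for i
  proof -
    have "(\<lambda>w. w ^ q) ` W \<subseteq> ratfun.span ((\<lambda>w. w ^ (q ^ Suc (n - i))) ` W)"
    proof
      fix y assume "y \<in> (\<lambda>w. w ^ q) ` W"
      then obtain w where "y = w ^ q" "w \<in> W" by blast
      then have w: "y = w ^ (q ^ 1)" "w \<in> ratfun.span ((\<lambda>w. w ^ (q ^ (n - i))) ` W)"
        using W_pow by (simp, blast)
      show "y \<in> ratfun.span ((\<lambda>w. w ^ (q ^ Suc (n - i))) ` W)"
        using frob[OF w(2), of 1] w(1) by (simp add: image_image mult.commute flip: power_mult)
    qed
    then have "f \<in> ratfun.span ((\<lambda>w. w ^ (q ^ Suc (n - i))) ` W)"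
      using f by (rule ratfun_span_trans[rotated])
    from frob[OF this, of i] have "f ^ (q ^ i) \<in> ratfun.span ((\<lambda>w. w ^ (q ^ Suc n)) ` W)"
      using that by (simp add: image_image flip: power_mult power_add power_Suc)
    moreover have "(\<lambda>w. w ^ (q ^ Suc n)) ` W \<subseteq> ratfun.span ((\<lambda>x. x ^ (q ^ Suc n)) ` B)"
      using B(3) frob by (auto simp del: power_Suc)
    ultimately show ?thesis by (rule ratfun_span_trans)
  qed
  have "card ((\<lambda>x. x ^ (q ^ Suc n)) ` B) \<le> n"
    using B(1,2) card_image_le le_trans by blast
  then show ?thesis
    using ratfun_family_dependent[of "(\<lambda>x. x ^ (q ^ Suc n)) ` B" n "\<lambda>i. f ^ (q ^ i)"] B(1) f_pow that
    by blast
qed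

text \<open>On representatives in (0, 1], Dwork's map inverts multiplication by p. The integer p
  \<open>frac1 x\<close> - \<open>frac1 (p x)\<close> lies strictly between -1 and p by the bounds
  on both representatives, which is the range required of the offset.\<close>

lemma dwork_frac1:
  assumes "x \<in> Zloc p"
  shows "dwork (frac1 (of_nat p * x)) = frac1 x"
proof (rule dwork_unique)
  let ?i = "int p * (1 - \<lceil>x\<rceil>) + \<lceil>of_nat p * x\<rceil> - 1"
  have Z: "frac1 y \<in> Zloc p" if "y \<in> Zloc p" for y
    unfolding frac1_def using that by (intro Zloc_add Zloc_diff) simp_all
  show "frac1 (of_nat p * x) \<in> Zloc p" "frac1 x \<in> Zloc p"
    using assms by (simp_all add: Z Zloc_mult)
  show eq: "of_nat p * frac1 x = frac1 (of_nat p * x) + of_int ?i"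
    by (simp add: frac1_def algebra_simps)
  have "of_nat p * frac1 x \<le> of_nat p * 1" "0 < of_nat p * frac1 x"
    using p_gt_1 frac1_bounds[of x] by (auto intro: mult_left_mono)
  then have "(of_int ?i :: rat) < of_int (int p)" "(of_int (-1) :: rat) < of_int ?i"
    using eq frac1_bounds[of "of_nat p * x"] by auto
  then have "?i < int p" "-1 < ?i" by (simp_all only: of_int_less_iff)
  then show "0 \<le> ?i" "?i < int p" by linarith+
qed

lemma dwork_iterate_frac1:
  assumes "x \<in> Zloc p"
  shows "(dwork ^^ s) (frac1 (of_nat (p ^ s) * x)) = frac1 x"
  using assms
proof (induction s arbitrary: x)
  case (Suc s)
  have "of_nat (p ^ s) * x \<in> Zloc p" using Suc.prems Zloc_of_nat by (rule Zloc_mult[rotated])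
  then have "dwork (frac1 (of_nat (p ^ Suc s) * x)) = frac1 (of_nat (p ^ s) * x)"
    using dwork_frac1 by (simp add: mult.assoc)
  then show ?case using Suc by (simp add: funpow_swap1)
qed simp

text \<open>As p \<open>dwork x\<close> is congruent to x and \<open>dwork x\<close> lies in (0, 1],
  it depends only on x modulo the integers. Since multiplication by p^s permutes the classes of the
  x, it permutes those of the \<open>dwork x\<close> as well, and s steps of Dwork's map undo this
  multiplication.\<close>

lemma dwork_iterate_mset:
  assumes Z: "set xs \<subseteq> Zloc p" and bounds: "\<forall>x\<in>set xs. 0 < dwork x \<and> dwork x \<le> 1"
    and res: "residues_mod_Ints (map ((*) (of_nat (p ^ s))) xs) = residues_mod_Ints xs"
  shows "mset (map (dwork ^^ s) (map dwork xs)) = mset (map dwork xs)"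
proof -
  have frac1_p: "frac1 (of_nat (m * p) * dwork x) = frac1 (of_nat m * x)" if x: "x \<in> set xs" for x m
  proof -
    obtain i where "of_nat p * dwork x = x + of_nat i" using x Z dworkE by blast
    then have "of_nat (m * p) * dwork x = of_nat m * x + of_int (int (m * i))"
      by (simp add: mult.assoc distrib_left)
    then show ?thesis by (simp only: frac1_add_of_int)
  qed
  have dw: "dwork (frac1 x) = dwork x" if x: "x \<in> set xs" for x
    using frac1_p[OF x, of 1] dwork_frac1[of "dwork x"] x Z bounds
    by (auto simp: frac1_eq dwork_Zloc)
  have "mset (map dwork xs) = image_mset dwork (image_mset frac1 (mset xs))"
    unfolding mset_map image_mset.compositionality o_def using dw by (intro image_mset_cong) simp
  also have "image_mset frac1 (mset xs) = image_mset frac1 (mset (map ((*) (of_nat (p ^ s))) xs))"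
    unfolding image_frac1_residues res ..
  also have "image_mset dwork \<dots> = image_mset (\<lambda>x. frac1 (of_nat (p ^ s) * dwork x)) (mset xs)"
    unfolding mset_map image_mset.compositionality o_def
  proof (rule image_mset_cong)
    fix x assume "x \<in># mset xs"
    then have x: "x \<in> set xs" by simp
    have "dwork (frac1 (of_nat (p ^ s) * x)) = dwork (frac1 (of_nat p * (of_nat (p ^ s) * dwork x)))"
      using frac1_p[OF x, of "p ^ s"] by (simp add: ac_simps)
    also have "\<dots> = frac1 (of_nat (p ^ s) * dwork x)"
      using x Z by (intro dwork_frac1 Zloc_mult dwork_Zloc Zloc_of_nat) auto
    finally show "dwork (frac1 (of_nat (p ^ s) * x)) = frac1 (of_nat (p ^ s) * dwork x)" .
  qed
  finally have eq: "mset (map dwork xs) = image_mset (\<lambda>x. frac1 (of_nat (p ^ s) * dwork x)) (mset xs)" .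
  have "mset (map (dwork ^^ s) (map dwork xs)) = image_mset (dwork ^^ s) (mset (map dwork xs))" by (simp only: mset_map)
  also have "\<dots> = image_mset (\<lambda>x. frac1 (dwork x)) (mset xs)"
    unfolding eq image_mset.compositionality o_def
    using Z by (intro image_mset_cong dwork_iterate_frac1 dwork_Zloc) auto
  also have "\<dots> = mset (map dwork xs)"
    unfolding mset_map using bounds by (intro image_mset_cong) (simp add: frac1_eq)
  finally show ?thesis .
qed

text \<open>The origin of the bound on p. The number y = d \<open>dwork x\<close> is an integer, and
  p y = d x + d i. As |d x| < p / 2 and 0 \<le> i < p, it lies between 0 and d, and y = 0 would make
  x = -i a nonpositive integer.\<close>

lemma dwork_bounds:
  assumes d: "d > 0" "of_nat d * x \<in> \<int>" and big: "of_nat p > 2 * of_nat d * (\<bar>x\<bar> + 1)"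
    and x: "x \<notin> \<int>\<^sub>\<le>\<^sub>0" and Z: "x \<in> Zloc p"
  shows "0 < dwork x" "dwork x \<le> 1"
proof -
  obtain i where i: "i < p" "of_nat p * dwork x = x + of_nat i" "dwork x \<in> Zloc p"
    using Z by (rule dworkE)
  obtain z where z: "of_nat d * x = of_int z" using d(2) by (elim Ints_cases)
  have p0: "(0::rat) < of_nat p" using p_gt_1 by simp
  have d1: "(1::rat) \<le> of_nat d" using d(1) by simp
  have eq: "of_nat d * dwork x = of_int (z + int (d * i)) / of_nat p"
  proof -
    have "of_nat p * (of_nat d * dwork x) = of_nat d * x + of_nat d * of_nat i"
      using i(2) by (simp add: algebra_simps)
    then show ?thesis using z p0 by (simp add: eq_divide_eq mult.commute)
  qed
  moreover have "of_nat d * dwork x \<in> Zloc p" using i(3) by (intro Zloc_mult) simp_all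
  ultimately have "int p dvd z + int (d * i)" by (metis p_dvd_if_Zloc)
  then obtain y where y: "z + int (d * i) = int p * y" ..
  have y_eq: "of_nat d * dwork x = of_int y"
    unfolding eq y using p0 by simp
  have dx: "\<bar>2 * (of_nat d * x)\<bar> < of_nat p"
  proof -
    have "\<bar>2 * (of_nat d * x)\<bar> = 2 * of_nat d * \<bar>x\<bar>" by (simp add: abs_mult)
    also have "\<dots> \<le> 2 * of_nat d * (\<bar>x\<bar> + 1)" by (intro mult_left_mono) auto
    finally show ?thesis using big by linarith
  qed
  have py: "of_nat p * of_int y = of_nat d * x + of_nat d * (of_nat i :: rat)"
    using i(2) by (metis distrib_left mult.left_commute y_eq)
  have di: "of_nat d * (of_nat i :: rat) \<ge> 0" by simp
  have "y > -1"
  proof (rule ccontr)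
    assume "\<not> y > -1"
    then have "of_nat p * of_int y \<le> of_nat p * (-1 :: rat)"
      using p0 by (intro mult_left_mono) (auto simp flip: of_int_minus)
    then show False using py di dx by linarith
  qed
  moreover have "y \<noteq> 0"
  proof
    assume "y = 0"
    then have "dwork x = 0" using y_eq d(1) by simp
    then have "x = - of_nat i" using i(2) by simp
    then show False using x by (metis minus_of_nat_in_nonpos_Ints)
  qed
  ultimately have y_pos: "y > 0" by linarith
  then have "0 < of_nat d * dwork x" using y_eq by simp
  then show "0 < dwork x" using d1 by (simp add: zero_less_mult_iff)
  have "y \<le> int d"
  proof (rule ccontr)
    assume "\<not> y \<le> int d"
    then have "of_int (int d + 1) \<le> (of_int y :: rat)" by (simp only: of_int_le_iff)
    then have "of_nat p * (of_nat d + 1) \<le> of_nat p * (of_int y :: rat)"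
      using p0 by (intro mult_left_mono) auto
    moreover have "of_nat d * (of_nat i :: rat) \<le> of_nat d * of_nat p"
      using i(1) by (intro mult_left_mono) auto
    ultimately show False using py dx p0 by (simp add: algebra_simps)
  qed
  then have "(of_int y :: rat) \<le> of_int (int d)" by (simp only: of_int_le_iff)
  then have "of_nat d * dwork x \<le> of_nat d * 1" using y_eq by simp
  then show "dwork x \<le> 1" using d1 by (simp only: mult_le_cancel_left_pos)
qed

lemma dwork_unit_interval:
  assumes "x \<in> Zloc p" "0 < x" "x \<le> 1"
  shows "0 < dwork x \<and> dwork x \<le> 1"
proof -
  obtain i where i: "i < p" "of_nat p * dwork x = x + of_nat i" "dwork x \<in> Zloc p"
    using assms(1) by (rule dworkE)
  have p0: "(0::rat) < of_nat p" using p_gt_1 by simp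
  have "0 < of_nat p * dwork x" using i(2) assms(2) by (simp add: add_pos_nonneg)
  moreover have "of_nat p * dwork x \<le> of_nat p * 1"
  proof -
    have "of_nat (Suc i) \<le> (of_nat p :: rat)" using i(1) by (simp only: of_nat_le_iff Suc_le_eq)
    then show ?thesis using i(2) assms(3) by simp
  qed
  ultimately show ?thesis using p0 by (simp only: mult_le_cancel_left_pos zero_less_mult_iff) auto
qed

text \<open>The exponent \<open>Suc s\<close> ensures at least one step of Dwork's map, after which
  the parameters lie in (0, 1]. The lists \<alpha> and \<beta> may violate this, so f enters only
  through its iterated sections.\<close>

theorem hypergeometric_frobenius_relation:
  assumes len: "length \<alpha> = Suc (length \<beta>)"
    and d: "d > 0" "\<forall>x\<in>set \<alpha> \<union> set \<beta>. of_nat d * x \<in> \<int>"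
    and big: "\<forall>x\<in>set \<alpha> \<union> set \<beta>. of_nat p > 2 * of_nat d * (\<bar>x\<bar> + 1)"
    and nonpos: "set \<alpha> \<inter> \<int>\<^sub>\<le>\<^sub>0 = {}" "set \<beta> \<inter> \<int>\<^sub>\<le>\<^sub>0 = {}"
    and int: "integral (fps_hypergeo \<alpha> \<beta> 1)"
    and q: "q = p ^ Suc s"
    and res: "residues_mod_Ints (map ((*) (of_nat q)) \<alpha>) = residues_mod_Ints \<alpha>"
      "residues_mod_Ints (map ((*) (of_nat q)) \<beta>) = residues_mod_Ints \<beta>"
  obtains c where
    "(\<Sum>i\<le>length \<alpha>. fls_of_ratfun (c i) * fps_to_fls (redf (fps_hypergeo \<alpha> \<beta> 1)) ^ (q ^ i)) = 0"
    "\<exists>i\<le>length \<alpha>. c i \<noteq> 0"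
proof -
  have Z: "x \<in> Zloc p" if "x \<in> set \<alpha> \<union> set \<beta>" for x
  proof -
    obtain z where z: "of_nat d * x = of_int z" using d(2) \<open>x \<in> set \<alpha> \<union> set \<beta>\<close> by (meson Ints_cases)
    have "of_nat p > 2 * of_nat d * (\<bar>x\<bar> + 1)" using big that by blast
    moreover have "of_nat d * 1 \<le> 2 * of_nat d * (\<bar>x\<bar> + 1)"
      unfolding mult.assoc mult.left_commute[of 2] by (intro mult_left_mono) auto
    ultimately have "(of_nat d :: rat) < of_nat p" by linarith
    then have "d < p" by (simp only: of_nat_less_iff)
    then have "\<not> int p dvd int d" using d(1) by (auto dest: zdvd_imp_le)
    moreover have "x = of_int z / of_int (int d)" using z d(1) by (simp add: field_simps)
    ultimately show ?thesis by (rule ZlocI)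
  qed
  then have Z\<alpha>: "set \<alpha> \<subseteq> Zloc p" and Z\<beta>: "set \<beta> \<subseteq> Zloc p" by blast+
  have bounds: "0 < dwork x \<and> dwork x \<le> 1" if "x \<in> set \<alpha> \<union> set \<beta>" for x
    using dwork_bounds[of d x] d big nonpos Z that by blast
  have iter_bounds: "0 < (dwork ^^ Suc e) x \<and> (dwork ^^ Suc e) x \<le> 1" if "x \<in> set \<alpha> \<union> set \<beta>" for x e
  proof (induction e)
    case (Suc e)
    then show ?case
      using dwork_unit_interval[of "(dwork ^^ Suc e) x"] dwork_iterate_Zloc[OF Z[OF that], of "Suc e"]
      by (simp del: funpow.simps add: funpow.simps(2)[of "Suc e"])
  qed (use bounds that in simp)
  define A where "A = map (dwork ^^ Suc s) \<alpha>"
  define B where "B = map (dwork ^^ Suc s) \<beta>"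
  \<comment> \<open>The return is known after a single step, where the parameters first lie in (0,
    1]. Applying the remaining s steps to both sides moves it to the lists used for W.\<close>
  have stable: "mset (map (dwork ^^ Suc s) (map (dwork ^^ Suc s) xs)) = mset (map (dwork ^^ Suc s) xs)"
    if xs: "set xs \<subseteq> set \<alpha> \<union> set \<beta>" "residues_mod_Ints (map ((*) (of_nat q)) xs) = residues_mod_Ints xs" for xs
  proof -
    have "mset (map (dwork ^^ Suc s) (map dwork xs)) = mset (map dwork xs)"
      using xs Z bounds q by (intro dwork_iterate_mset) auto
    then have "image_mset (dwork ^^ s) (mset (map (dwork ^^ Suc s) (map dwork xs))) =
        image_mset (dwork ^^ s) (mset (map dwork xs))" by simp
    then show ?thesis
      by (simp add: image_mset.compositionality o_def funpow_swap1)
  qed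
  have AB: "set A \<subseteq> Zloc p" "set B \<subseteq> Zloc p" "length A = Suc (length B)"
    "\<forall>a\<in>set A. a > 0" "\<forall>b\<in>set B. b > 0"
    using Z\<alpha> Z\<beta> len iter_bounds[of _ s] dwork_iterate_Zloc[of _ "Suc s"]
    by (auto simp: A_def B_def simp del: funpow.simps)
  let ?W = "fps_to_fls ` redf ` hyp_class A B"
  have pow_image: "(\<lambda>g. fps_to_fls (redf g) ^ (p ^ Suc s)) ` hyp_class A B = (\<lambda>w. w ^ q) ` ?W"
    by (simp only: image_image q)
  obtain V where V: "finite V" "card V \<le> length A" "fps_to_fls ` hyp_class A B \<subseteq> ratfun.span V"
    using hyp_class_span[OF AB(3-5)] by blast
  obtain U where U: "finite U" "card U \<le> length A" "?W \<subseteq> ratfun.span U"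
    by (rule redf_span_dim[OF _ V]) (auto simp: hyp_class_def)
  have closed: "hyp_class (map (dwork ^^ Suc s) A) (map (dwork ^^ Suc s) B) = hyp_class A B"
    unfolding A_def B_def using stable res by (intro hyp_class_cong_mset) auto
  have W: "?W \<subseteq> ratfun.span ((\<lambda>w. w ^ q) ` ?W)"
    unfolding pow_image[symmetric] image_image
    using hyp_class_iterate[OF AB(1-3), of _ "Suc s"] unfolding closed q[symmetric] by (rule image_subsetI)
  let ?F = "fps_hypergeo \<alpha> \<beta> 1"
  \<comment> \<open>\<open>fps_hypergeo\<close> forms its products by \<open>foldl\<close>, and its
    factorial is the Pochhammer symbol of the added lower parameter 1.\<close>
  have "foldl (\<lambda>r a. r * pochhammer a k) x xs = x * (\<Prod>a\<leftarrow>xs. pochhammer a k)" for x :: rat and xs k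
    by (induction xs arbitrary: x) (simp_all add: mult.assoc)
  then have F: "?F = hyp \<alpha> (\<beta> @ [1]) 1"
    by (intro fps_ext) (simp add: hyp_def flip: pochhammer_fact)
  have "list_all2 shift_rel xs xs" for xs
    by (rule list_all2_refl) (simp add: shift_rel_def)
  then have "?F \<in> hyp_class \<alpha> \<beta>"
    using int unfolding F hyp_class_def by blast
  from hyp_class_iterate[OF Z\<alpha> Z\<beta> len this, of "Suc s"]
  have f: "fps_to_fls (redf ?F) \<in> ratfun.span ((\<lambda>w. w ^ q) ` ?W)"
    unfolding pow_image[symmetric] unfolding A_def B_def .
  have "length A = length \<alpha>" by (simp add: A_def)
  then show ?thesis using frobenius_relation[OF q U W f] that by auto
qed

end

section \<open>Fields generated inside a field type\<close>

lemma m_inv_type_algebra: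
  fixes x :: "'a::field"
  assumes "x \<noteq> 0"
  shows "m_inv ring_of_type_algebra x = inverse x"
proof -
  interpret cring "ring_of_type_algebra :: 'a ring" by (rule cring_from_type_algebra)
  show ?thesis
    by (rule comm_inv_char) (use assms in \<open>simp_all add: ring_of_type_algebra_def\<close>)
qed

lemma a_inv_type_algebra: "a_inv ring_of_type_algebra x = - (x :: 'a::field)"
proof -
  interpret cring "ring_of_type_algebra :: 'a ring" by (rule cring_from_type_algebra)
  show ?thesis
    by (rule minus_equality) (simp_all add: ring_of_type_algebra_def)
qed

abbreviation gen_field :: "'a::field set \<Rightarrow> 'a set" where
  "gen_field \<equiv> generate_field ring_of_type_algebra"

text \<open>Replaces the operations of the record by those of the type, so that inverses and
  negatives become accessible to the simplifier.\<close>

lemma gen_field_induct [consumes 1, case_names one incl uminus inverse add mult]: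
  assumes "x \<in> gen_field A"
    and "P 1" "\<And>x. x \<in> A \<Longrightarrow> P x"
    and "\<And>x. x \<in> gen_field A \<Longrightarrow> P x \<Longrightarrow> P (- x)"
    and "\<And>x. x \<in> gen_field A \<Longrightarrow> P x \<Longrightarrow> x \<noteq> 0 \<Longrightarrow> P (inverse x)"
    and "\<And>x y. x \<in> gen_field A \<Longrightarrow> P x \<Longrightarrow> y \<in> gen_field A \<Longrightarrow> P y \<Longrightarrow> P (x + y)"
    and "\<And>x y. x \<in> gen_field A \<Longrightarrow> P x \<Longrightarrow> y \<in> gen_field A \<Longrightarrow> P y \<Longrightarrow> P (x * y)"
  shows "P x"
  using assms(1)
proof (induction rule: generate_field.induct)
  case one
  then show ?case using assms(2) by (simp add: ring_of_type_algebra_def)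
next
  case (incl h)
  then show ?case using assms(3) by simp
next
  case (a_inv h)
  then show ?case using assms(4) by (simp add: a_inv_type_algebra)
next
  case (m_inv h)
  moreover from m_inv have "h \<noteq> 0" by (simp add: ring_of_type_algebra_def)
  ultimately show ?case using assms(5) by (simp add: m_inv_type_algebra)
next
  case (eng_add h1 h2)
  then show ?case using assms(6) by (simp add: ring_of_type_algebra_def)
next
  case (eng_mult h1 h2)
  then show ?case using assms(7) by (simp add: ring_of_type_algebra_def)
qed

lemma gen_field_incl: "x \<in> A \<Longrightarrow> x \<in> gen_field A"
  by (rule generate_field.incl)

lemma gen_field_1: "1 \<in> gen_field A"
  using generate_field.one[of ring_of_type_algebra A] by (simp add: ring_of_type_algebra_def)

lemma gen_field_add: "x \<in> gen_field A \<Longrightarrow> y \<in> gen_field A \<Longrightarrow> x + y \<in> gen_field A"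
  using generate_field.eng_add[of x ring_of_type_algebra A y] by (simp add: ring_of_type_algebra_def)

lemma gen_field_mult: "x \<in> gen_field A \<Longrightarrow> y \<in> gen_field A \<Longrightarrow> x * y \<in> gen_field A"
  using generate_field.eng_mult[of x ring_of_type_algebra A y] by (simp add: ring_of_type_algebra_def)

lemma gen_field_uminus: "x \<in> gen_field A \<Longrightarrow> - x \<in> gen_field A"
  using generate_field.a_inv[of x ring_of_type_algebra A] by (simp add: a_inv_type_algebra)

lemma gen_field_0: "0 \<in> gen_field A"
  using gen_field_add[OF gen_field_1 gen_field_uminus[OF gen_field_1]] by simp

lemma gen_field_inverse: "x \<in> gen_field A \<Longrightarrow> inverse x \<in> gen_field A"
  using generate_field.m_inv[of x ring_of_type_algebra A] gen_field_0[of A]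
  by (cases "x = 0") (simp_all add: m_inv_type_algebra, simp add: ring_of_type_algebra_def)

lemma gen_field_power: "x \<in> gen_field A \<Longrightarrow> x ^ n \<in> gen_field A"
  by (induction n) (simp_all add: gen_field_1 gen_field_mult)

locale type_field_aut =
  fixes L F :: "'a::field set" and \<sigma> :: "'a \<Rightarrow> 'a"
  assumes \<sigma>: "\<sigma> \<in> carrier (galois_group F L)"
begin

lemma bij: "bij_betw \<sigma> L L" and ext: "\<sigma> \<in> extensional L" and fixed: "z \<in> F \<Longrightarrow> \<sigma> z = z"
  using \<sigma> by (auto simp: galois_group_def Bij_def)

lemma closed: "x \<in> L \<Longrightarrow> \<sigma> x \<in> L"
  using bij by (auto simp: bij_betw_def)

lemma ring_hom: "\<sigma> \<in> Ring.ring_hom (subring_of_type L) (subring_of_type L)"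
  using \<sigma> by (auto simp: galois_group_def ring_iso_def)

lemma add: "x \<in> L \<Longrightarrow> y \<in> L \<Longrightarrow> \<sigma> (x + y) = \<sigma> x + \<sigma> y"
  using ring_hom_add[OF ring_hom] by (simp add: ring_of_type_algebra_def)

lemma mult: "x \<in> L \<Longrightarrow> y \<in> L \<Longrightarrow> \<sigma> (x * y) = \<sigma> x * \<sigma> y"
  using ring_hom_mult[OF ring_hom] by (simp add: ring_of_type_algebra_def)

lemma zero: "0 \<in> L \<Longrightarrow> \<sigma> 0 = 0"
  using add[of 0 0] by (metis add.right_neutral add_left_cancel)

lemma one: "\<sigma> 1 = 1"
  using ring_hom_one[OF ring_hom] by (simp add: ring_of_type_algebra_def)

end

lemma galois_group_carrierI:
  fixes \<sigma> :: "'a::field \<Rightarrow> 'a"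
  assumes "bij_betw \<sigma> L L" "\<sigma> \<in> extensional L" "\<And>z. z \<in> F \<Longrightarrow> \<sigma> z = z"
    and "\<And>x y. x \<in> L \<Longrightarrow> y \<in> L \<Longrightarrow> \<sigma> (x + y) = \<sigma> x + \<sigma> y"
    and "\<And>x y. x \<in> L \<Longrightarrow> y \<in> L \<Longrightarrow> \<sigma> (x * y) = \<sigma> x * \<sigma> y" and "\<sigma> 1 = 1"
  shows "\<sigma> \<in> carrier (galois_group F L)"
  using assms unfolding galois_group_def
  by (auto simp: Bij_def ring_iso_def bij_betw_def ring_of_type_algebra_def intro!: ring_hom_memI)

lemma galois_group_mult:
  assumes "\<sigma> \<in> carrier (galois_group F L)" "\<tau> \<in> carrier (galois_group F L)"
  shows "\<sigma> \<otimes>\<^bsub>galois_group F L\<^esub> \<tau> = compose L \<sigma> \<tau>"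
  using assms by (auto simp: galois_group_def BijGroup_def)

lemma galois_group_inverse:
  fixes L :: "'a::field set"
  assumes \<sigma>: "\<sigma> \<in> carrier (galois_group F L)" and L: "F \<subseteq> L" "1 \<in> L"
    "\<And>x y. x \<in> L \<Longrightarrow> y \<in> L \<Longrightarrow> x + y \<in> L" "\<And>x y. x \<in> L \<Longrightarrow> y \<in> L \<Longrightarrow> x * y \<in> L"
  obtains \<tau> where "\<tau> \<in> carrier (galois_group F L)" "\<And>x. x \<in> L \<Longrightarrow> \<sigma> (\<tau> x) = x" "\<And>x. x \<in> L \<Longrightarrow> \<tau> (\<sigma> x) = x"
proof -
  interpret type_field_aut L F \<sigma> by unfold_locales (rule \<sigma>)
  \<comment> \<open>Elements of \<open>Bij L\<close> are extensional, hence the restriction to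
    L.\<close>
  define \<tau> where "\<tau> = restrict (inv_into L \<sigma>) L"
  have \<tau>L: "\<tau> x \<in> L" if "x \<in> L" for x
    using that bij by (simp add: \<tau>_def bij_betw_def inv_into_into)
  have \<sigma>\<tau>: "\<sigma> (\<tau> x) = x" if "x \<in> L" for x
    using that bij by (simp add: \<tau>_def bij_betw_inv_into_right)
  have \<tau>\<sigma>: "\<tau> (\<sigma> x) = x" if "x \<in> L" for x
    using that bij closed by (simp add: \<tau>_def bij_betw_inv_into_left)
  have "\<tau> \<in> carrier (galois_group F L)"
  proof (rule galois_group_carrierI)
    show "bij_betw \<tau> L L"
      using \<tau>L closed \<sigma>\<tau> \<tau>\<sigma> by (intro bij_betw_byWitness[where f' = \<sigma>]) auto
    show "\<tau> \<in> extensional L" by (simp add: \<tau>_def)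
    show "\<tau> z = z" if "z \<in> F" for z using \<tau>\<sigma>[of z] fixed[OF that] L(1) that by auto
    show "\<tau> 1 = 1" using \<tau>\<sigma>[OF L(2)] one by simp
    show "\<tau> (x + y) = \<tau> x + \<tau> y" if "x \<in> L" "y \<in> L" for x y
      using \<tau>\<sigma>[of "\<tau> x + \<tau> y"] add[of "\<tau> x" "\<tau> y"] that \<tau>L \<sigma>\<tau> L(3) by simp
    show "\<tau> (x * y) = \<tau> x * \<tau> y" if "x \<in> L" "y \<in> L" for x y
      using \<tau>\<sigma>[of "\<tau> x * \<tau> y"] mult[of "\<tau> x" "\<tau> y"] that \<tau>L \<sigma>\<tau> L(4) by simp
  qed
  with that \<sigma>\<tau> \<tau>\<sigma> show ?thesis by blast
qed

text \<open>Two automorphisms agree on a subfield, so agreement on generators suffices. This yields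
  faithfulness of the action on the roots.\<close>

lemma galois_group_eqI:
  fixes A F :: "'a::field set"
  defines "L \<equiv> gen_field (F \<union> A)"
  assumes \<sigma>: "\<sigma> \<in> carrier (galois_group F L)" and \<tau>: "\<tau> \<in> carrier (galois_group F L)"
    and eq: "\<And>x. x \<in> A \<Longrightarrow> \<sigma> x = \<tau> x"
  shows "\<sigma> = \<tau>"
proof (rule extensionalityI)
  interpret s: type_field_aut L F \<sigma> by unfold_locales (rule \<sigma>)
  interpret t: type_field_aut L F \<tau> by unfold_locales (rule \<tau>)
  show "\<sigma> \<in> extensional L" "\<tau> \<in> extensional L" by (rule s.ext t.ext)+
  fix x assume "x \<in> L"
  then show "\<sigma> x = \<tau> x"
    unfolding L_def
  proof (induction rule: gen_field_induct)
    case (uminus x)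
    have *: "r (- x) = - r x" if "type_field_aut L F r" for r
    proof -
      interpret r: type_field_aut L F r by (rule that)
      have x: "x \<in> L" "- x \<in> L" using uminus(1) by (simp_all add: L_def gen_field_uminus)
      have "r 0 = 0" by (rule r.zero) (simp add: L_def gen_field_0)
      then have "r x + r (- x) = 0" using r.add[OF x] by simp
      then show ?thesis by (simp add: eq_neg_iff_add_eq_0 add.commute)
    qed
    show ?case using *[OF s.type_field_aut_axioms] *[OF t.type_field_aut_axioms] uminus(2) by simp
  next
    case (inverse x)
    have *: "r (inverse x) = inverse (r x)" if "type_field_aut L F r" for r
    proof -
      interpret r: type_field_aut L F r by (rule that)
      have x: "x \<in> L" "inverse x \<in> L" using inverse(1) by (simp_all add: L_def gen_field_inverse)
      then have "r x * r (inverse x) = 1" using r.mult[OF x] inverse(2) r.one by simp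
      then show ?thesis by (metis inverse_unique)
    qed
    show ?case using *[OF s.type_field_aut_axioms] *[OF t.type_field_aut_axioms] inverse(3) by simp
  next
    case (add x y)
    then show ?case using s.add t.add by (simp add: L_def)
  next
    case (mult x y)
    then show ?case using s.mult t.mult by (simp add: L_def)
  qed (use eq s.fixed t.fixed s.one t.one in auto)
qed

section \<open>Embedding the Galois group\<close>

locale field_embedding =
  fixes \<iota> :: "'f::field \<Rightarrow> 'o::field"
  assumes emb_add: "\<iota> (x + y) = \<iota> x + \<iota> y" and emb_mult: "\<iota> (x * y) = \<iota> x * \<iota> y"
    and emb_1: "\<iota> 1 = 1"
begin

lemma emb_0: "\<iota> 0 = 0"
  using emb_add[of 0 0] by (metis add.right_neutral add_left_cancel)

lemma emb_eq_0_iff: "\<iota> x = 0 \<longleftrightarrow> x = 0"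
  by (metis emb_0 emb_1 emb_mult mult_zero_left right_inverse zero_neq_one)

lemma emb_sum: "\<iota> (sum g A) = (\<Sum>i\<in>A. \<iota> (g i))"
  by (induction A rule: infinite_finite_induct) (simp_all add: emb_0 emb_add)

lemma emb_power: "\<iota> (x ^ n) = \<iota> x ^ n"
  by (induction n) (simp_all add: emb_1 emb_mult)

lemma map_poly_emb_add: "map_poly \<iota> (u + v) = map_poly \<iota> u + map_poly \<iota> v"
  by (rule poly_eqI) (simp add: coeff_map_poly emb_0 emb_add)

lemma map_poly_emb_mult: "map_poly \<iota> (u * v) = map_poly \<iota> u * map_poly \<iota> v"
  by (rule poly_eqI) (simp add: coeff_map_poly emb_0 coeff_mult emb_sum emb_mult)

lemma map_poly_emb_eq_0_iff: "map_poly \<iota> u = 0 \<longleftrightarrow> u = 0"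
  by (simp add: poly_eq_iff coeff_map_poly emb_0 emb_eq_0_iff)

lemma poly_map_poly_sum_monom:
  "poly (map_poly \<iota> (\<Sum>i\<in>A. Polynomial.monom (c i) (k i))) y = (\<Sum>i\<in>A. \<iota> (c i) * y ^ k i)"
proof -
  have "map_poly \<iota> (\<Sum>i\<in>A. Polynomial.monom (c i) (k i)) = (\<Sum>i\<in>A. Polynomial.monom (\<iota> (c i)) (k i))"
    by (rule poly_eqI) (simp add: coeff_map_poly emb_0 coeff_sum emb_sum if_distrib cong: if_cong)
  then show ?thesis by (simp add: poly_sum poly_monom)
qed

lemma minimal_polyE:
  assumes "Z \<noteq> 0" "poly (map_poly \<iota> Z) a = 0"
  obtains \<mu> where "\<mu> \<noteq> 0" "poly (map_poly \<iota> \<mu>) a = 0"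
    "\<And>u. poly (map_poly \<iota> u) a = 0 \<Longrightarrow> \<mu> dvd u"
proof -
  define N where "N = (LEAST k. \<exists>u. u \<noteq> 0 \<and> poly (map_poly \<iota> u) a = 0 \<and> degree u = k)"
  have ex: "\<exists>k u. u \<noteq> 0 \<and> poly (map_poly \<iota> u) a = 0 \<and> degree u = k"
    using assms by blast
  obtain \<mu> where \<mu>: "\<mu> \<noteq> 0" "poly (map_poly \<iota> \<mu>) a = 0" "degree \<mu> = N"
    using LeastI_ex[OF ex] unfolding N_def by blast
  have min: "N \<le> degree u" if "u \<noteq> 0" "poly (map_poly \<iota> u) a = 0" for u
    unfolding N_def by (rule Least_le) (use that in blast)
  have "\<mu> dvd u" if "poly (map_poly \<iota> u) a = 0" for u
  proof -
    have "poly (map_poly \<iota> (u div \<mu> * \<mu> + u mod \<mu>)) a = 0" using that by simp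
    then have "poly (map_poly \<iota> (u mod \<mu>)) a = 0"
      unfolding map_poly_emb_add map_poly_emb_mult using \<mu>(2) by simp
    then have "u mod \<mu> = 0"
      using min[of "u mod \<mu>"] degree_mod_less[OF \<mu>(1), of u] \<mu>(3) by linarith
    then show ?thesis by (simp add: mod_eq_0_iff_dvd)
  qed
  with \<mu>(1,2) that show ?thesis by blast
qed

text \<open>The irreducible m that links a and b is a multiple of the minimal polynomial \<mu>,
  hence equal to it up to a unit. So \<mu> vanishes at b, and \<mu> divides Z.\<close>

lemma conjugate_root:
  assumes "Z \<noteq> 0" "poly (map_poly \<iota> Z) a = 0" "b \<in> conjugates \<iota> a"
  shows "poly (map_poly \<iota> Z) b = 0"
proof -
  obtain \<mu> where \<mu>: "\<mu> \<noteq> 0" "poly (map_poly \<iota> \<mu>) a = 0"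
    and dvd: "\<And>u. poly (map_poly \<iota> u) a = 0 \<Longrightarrow> \<mu> dvd u"
    using assms(1,2) by (rule minimal_polyE) blast
  obtain m where m: "Factorial_Ring.irreducible m" "poly (map_poly \<iota> m) a = 0" "poly (map_poly \<iota> m) b = 0"
    using assms(3) by (auto simp: conjugates_def)
  obtain v where v: "m = \<mu> * v" using dvd[OF m(2)] by (elim dvdE)
  have const: "poly (map_poly \<iota> u) y \<noteq> 0" if unit: "is_unit u" for u y
  proof -
    obtain w where "1 = u * w" using unit by (elim dvdE)
    then have "poly (map_poly \<iota> 1) y = poly (map_poly \<iota> u) y * poly (map_poly \<iota> w) y"
      by (metis map_poly_emb_mult poly_mult)
    moreover have "poly (map_poly \<iota> 1) y = 1" by (simp add: emb_1 map_poly_1')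
    ultimately show ?thesis by auto
  qed
  have "is_unit v"
    using Factorial_Ring.irreducibleD[OF m(1) v] const[of \<mu> a] \<mu>(2) by blast
  then have "poly (map_poly \<iota> \<mu>) b = 0"
    using m(3) const[of v b] by (simp add: v map_poly_emb_mult)
  moreover obtain w where "Z = \<mu> * w" using dvd[OF assms(2)] by (elim dvdE)
  ultimately show ?thesis by (simp add: map_poly_emb_mult)
qed

end

text \<open>The scalars act through \<kappa> and \<iota>; their images lie in the base field and are
  fixed by automorphisms, which makes the action linear. It is faithful because the space of roots
  contains the generators of L.\<close>

theorem galois_group_linearized_embeds:
  fixes \<iota> :: "'f::field \<Rightarrow> 'o::field" and \<kappa> :: "'k::field \<Rightarrow> 'f" and c :: "nat \<Rightarrow> 'f" and a :: 'o
  assumes \<iota>: "field_embedding \<iota>" and \<kappa>: "field_embedding \<kappa>"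
    and fin: "finite (UNIV :: 'k set)" and q: "q = CARD('k)" and frob_k: "\<And>x :: 'k. x ^ q = x"
    and frob_add: "\<And>x y :: 'o. (x + y) ^ q = x ^ q + y ^ q"
    and Z: "Z = (\<Sum>i\<le>n. Polynomial.monom (c i) (q ^ i))" "Z \<noteq> 0" "poly (map_poly \<iota> Z) a = 0"
  shows "\<exists>h. h \<in> mon (galois_group_of \<iota> a) (GL n :: 'k mat monoid)"
proof -
  interpret i: field_embedding \<iota> by (rule \<iota>)
  interpret k: field_embedding \<kappa> by (rule \<kappa>)
  have q2: "q \<ge> 2"
  proof -
    have "card {0, 1 :: 'k} \<le> q" unfolding q using fin by (intro card_mono) auto
    then show ?thesis by simp
  qed
  define s where "s x = \<iota> (\<kappa> x)" for x
  have s_simps: "s (x + y) = s x + s y" "s (x * y) = s x * s y" "s 0 = 0" "s 1 = 1" for x y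
    by (simp_all add: s_def k.emb_add i.emb_add k.emb_mult i.emb_mult k.emb_0 i.emb_0 k.emb_1 i.emb_1)
  have s_power: "s x ^ q = s x" for x
    by (simp add: s_def frob_k flip: i.emb_power k.emb_power)
  interpret V: vector_space "\<lambda>x v. s x * v"
    by unfold_locales (simp_all add: s_simps algebra_simps)
  define S where "S = insert a (conjugates \<iota> a)"
  define L where "L = gen_field (range \<iota> \<union> S)"
  define G where "G = galois_group (range \<iota>) L"
  have G_eq: "galois_group_of \<iota> a = G"
    by (simp add: galois_group_of_def G_def L_def S_def)
  have range_L: "\<iota> x \<in> L" for x by (simp add: L_def gen_field_incl)
  have L_closed: "x + y \<in> L" "x * y \<in> L" if "x \<in> L" "y \<in> L" for x y
    using that by (simp_all add: L_def gen_field_add gen_field_mult)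
  have L_01: "0 \<in> L" "1 \<in> L" by (simp_all add: L_def gen_field_0 gen_field_1)
  have sL: "s x \<in> L" for x by (simp add: s_def range_L)

  define ev where "ev y = (\<Sum>i\<le>n. \<iota> (c i) * y ^ (q ^ i))" for y
  have ev: "poly (map_poly \<iota> Z) y = ev y" for y
    unfolding Z(1) ev_def by (rule i.poly_map_poly_sum_monom)
  have frob_add': "(x + y :: 'o) ^ (q ^ j) = x ^ (q ^ j) + y ^ (q ^ j)" for x y j
    by (induction j) (simp_all add: power_mult frob_add mult.commute[of q])
  have s_power': "s x ^ (q ^ j) = s x" for x j
    by (induction j) (simp_all add: power_mult s_power)
  have ev_add: "ev (x + y) = ev x + ev y" for x y
    by (simp add: ev_def frob_add' distrib_left sum.distrib)
  have ev_scale: "ev (s x * y) = s x * ev y" for x y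
    by (simp add: ev_def power_mult_distrib s_power' sum_distrib_left mult.left_commute)
  \<comment> \<open>Automorphisms act on L only, so the roots outside L are left out.\<close>
  define W where "W = {y. ev y = 0} \<inter> L"
  have map_Z: "map_poly \<iota> Z \<noteq> 0" using Z(2) by (simp add: i.map_poly_emb_eq_0_iff)
  have finite_roots: "finite {y. ev y = 0}"
    using poly_roots_finite[OF map_Z] by (simp add: ev)
  then have finW: "finite W" by (simp add: W_def)
  have cardW: "card W \<le> q ^ n"
  proof -
    have "card W \<le> card {y. ev y = 0}" unfolding W_def by (rule card_mono[OF finite_roots]) blast
    also have "\<dots> \<le> degree (map_poly \<iota> Z)"
      using card_poly_roots_bound[OF map_Z] by (simp add: ev)
    also have "\<dots> \<le> degree Z" by (rule map_poly_degree_leq)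
    also have "\<dots> \<le> q ^ n"
      unfolding Z(1)
      by (intro degree_sum_le) (use q2 in \<open>auto intro!: order.trans[OF degree_monom_le] power_increasing\<close>)
    finally show ?thesis .
  qed
  have "ev 0 = 0" using ev_scale[of 0 0] by (simp add: s_simps)
  then have subspW: "V.subspace W"
    by (simp add: V.subspace_def W_def L_01 L_closed sL ev_add ev_scale)
  have SW: "S \<subseteq> W"
  proof
    fix b assume b: "b \<in> S"
    have "poly (map_poly \<iota> Z) b = 0"
      using b Z(2,3) i.conjugate_root by (auto simp: S_def)
    then show "b \<in> W" using b by (simp add: W_def ev L_def gen_field_incl)
  qed
  obtain B where B: "B \<subseteq> W" "V.independent B" "W \<subseteq> V.span B"
    by (rule V.maximal_independent_subset)
  have finB: "finite B" using B(1) finW by (rule finite_subset)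
  have spanB: "V.span B = W" using B subspW V.span_minimal by blast
  define m where "m = card B"
  have "m \<le> n"
  proof -
    \<comment> \<open>Combinations of the basis with different coefficients are different elements
      of W. Counting gives q^m \<le> q^n.\<close>
    define \<phi> where "\<phi> f = (\<Sum>b\<in>B. s (f b) * b)" for f
    have "inj_on \<phi> (B \<rightarrow>\<^sub>E UNIV)"
    proof (rule inj_onI)
      fix f g assume fg: "f \<in> B \<rightarrow>\<^sub>E UNIV" "g \<in> B \<rightarrow>\<^sub>E UNIV" "\<phi> f = \<phi> g"
      have "s (f b - g b) = s (f b) - s (g b)" for b
        using s_simps(1)[of "f b - g b" "g b"] by simp
      then have "(\<Sum>b\<in>B. s (f b - g b) * b) = 0"
        using fg(3) by (simp add: \<phi>_def left_diff_distrib sum_subtractf)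
      then have "\<forall>b\<in>B. f b - g b = 0"
        using V.independentD[OF B(2) finB order.refl, of "\<lambda>b. f b - g b"] by blast
      then show "f = g" using fg(1,2) by (intro PiE_ext[of f B "\<lambda>_. UNIV" g]) auto
    qed
    moreover have "\<phi> ` (B \<rightarrow>\<^sub>E UNIV) \<subseteq> W"
    proof
      fix y assume "y \<in> \<phi> ` (B \<rightarrow>\<^sub>E UNIV)"
      then obtain f where f: "y = (\<Sum>b\<in>B. s (f b) * b)" by (auto simp: \<phi>_def)
      show "y \<in> W" unfolding f spanB[symmetric]
        by (rule V.span_sum, rule V.span_scale, rule V.span_base)
    qed
    ultimately have "card (B \<rightarrow>\<^sub>E (UNIV :: 'k set)) \<le> card W"
      using finW by (metis card_image card_mono)
    then have "q ^ m \<le> q ^ n" using cardW finB by (simp add: card_PiE q m_def)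
    then show ?thesis using q2 by (simp add: power_increasing_iff)
  qed
  obtain e where e: "bij_betw e {0..<m} B"
    using ex_bij_betw_nat_finite[OF finB] by (auto simp: m_def)
  have eB: "e j \<in> B" if "j < m" for j using e that by (auto simp: bij_betw_def)
  have e_inj: "e i = e j \<longleftrightarrow> i = j" if "i < m" "j < m" for i j
    using e that by (auto simp: bij_betw_def inj_on_def)
  define rep where "rep = V.representation B"
  have rep_sum: "v = (\<Sum>j<m. s (rep v (e j)) * e j)" if "v \<in> W" for v
  proof -
    have "v = (\<Sum>b\<in>B. s (rep v b) * b)"
      unfolding rep_def by (rule sym, rule V.sum_representation_eq) (use B(2) finB that spanB in auto)
    also have "\<dots> = (\<Sum>j\<in>{0..<m}. s (rep v (e j)) * e j)"
      by (rule sum.reindex_bij_betw[OF e, symmetric])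
    finally show ?thesis by (simp add: atLeast0LessThan)
  qed
  have rep_e: "rep (e j) (e i) = (if i = j then 1 else 0)" if "i < m" "j < m" for i j
    using V.representation_basis[OF B(2) eB[OF that(2)]] e_inj[OF that] by (simp add: rep_def)
  have WL: "v \<in> L" if "v \<in> W" for v using that by (simp add: W_def)

  have aut: "type_field_aut L (range \<iota>) \<sigma>" if "\<sigma> \<in> carrier G" for \<sigma>
    using that by unfold_locales (simp add: G_def)
  have \<sigma>_sum: "\<sigma> (\<Sum>j\<in>J. s (x j) * v j) = (\<Sum>j\<in>J. s (x j) * \<sigma> (v j))"
    if \<sigma>: "\<sigma> \<in> carrier G" and v: "\<And>j. j \<in> J \<Longrightarrow> v j \<in> L" for \<sigma> and J :: "nat set" and x v
  proof -
    interpret type_field_aut L "range \<iota>" \<sigma> by (rule aut[OF \<sigma>])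
    have \<sigma>0: "\<sigma> 0 = 0" using fixed[OF rangeI[of \<iota> 0]] by (simp add: i.emb_0)
    have \<sigma>s: "\<sigma> (s x) = s x" for x using fixed by (simp add: s_def)
    have "\<sigma> (\<Sum>j\<in>J. s (x j) * v j) = (\<Sum>j\<in>J. s (x j) * \<sigma> (v j)) \<and> (\<Sum>j\<in>J. s (x j) * v j) \<in> L"
      using v by (induction J rule: infinite_finite_induct)
        (simp_all add: \<sigma>0 add mult sL L_closed L_01 \<sigma>s)
    then show ?thesis ..
  qed
  have \<sigma>W: "\<sigma> v \<in> W" if \<sigma>: "\<sigma> \<in> carrier G" and v: "v \<in> W" for \<sigma> v
  proof -
    interpret type_field_aut L "range \<iota>" \<sigma> by (rule aut[OF \<sigma>])
    have vL: "v \<in> L" using v WL by blast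
    have pow: "v ^ j \<in> L \<and> \<sigma> (v ^ j) = \<sigma> v ^ j" for j
      by (induction j) (simp_all add: one mult vL L_closed L_01)
    have "(\<Sum>i\<in>I. \<iota> (c i) * v ^ (q ^ i)) \<in> L \<and>
        \<sigma> (\<Sum>i\<in>I. \<iota> (c i) * v ^ (q ^ i)) = (\<Sum>i\<in>I. \<iota> (c i) * \<sigma> v ^ (q ^ i))" for I
    proof (induction I rule: infinite_finite_induct)
      case (insert j I)
      then show ?case using pow[of "q ^ j"] range_L[of "c j"] fixed[OF rangeI[of \<iota> "c j"]]
        by (simp add: add mult L_closed)
    qed (use L_01 fixed[OF rangeI[of \<iota> 0]] i.emb_0 in auto)
    then have "ev (\<sigma> v) = \<sigma> (ev v)" by (simp add: ev_def)
    also have "\<dots> = 0" using v fixed[OF rangeI[of \<iota> 0]] i.emb_0 by (simp add: W_def)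
    finally show ?thesis using closed[OF vL] by (simp add: W_def)
  qed
  \<comment> \<open>The basis has m \<le> n elements; an identity block completes the matrix of
    \<sigma> to size n.\<close>
  define M where "M \<sigma> = mat n n (\<lambda>(i, j). if i < m \<and> j < m then rep (\<sigma> (e j)) (e i)
    else if i = j then 1 else 0)" for \<sigma>
  have eW: "e j \<in> W" if "j < m" for j using eB[OF that] B(1) by blast
  have M_mult: "M (compose L \<sigma> \<tau>) = M \<sigma> * M \<tau>" if \<sigma>: "\<sigma> \<in> carrier G" and \<tau>: "\<tau> \<in> carrier G" for \<sigma> \<tau>
  proof (rule eq_matI)
    fix i j assume "i < dim_row (M \<sigma> * M \<tau>)" "j < dim_col (M \<sigma> * M \<tau>)"
    then have ij: "i < n" "j < n" by (simp_all add: M_def)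
    have "(M \<sigma> * M \<tau>) $$ (i, j) = (\<Sum>l<n. M \<sigma> $$ (i, l) * M \<tau> $$ (l, j))"
      using ij by (simp add: M_def scalar_prod_def atLeast0LessThan)
    also have "\<dots> = M (compose L \<sigma> \<tau>) $$ (i, j)"
    proof (cases "j < m")
      case True
      have "(\<Sum>l<n. M \<sigma> $$ (i, l) * M \<tau> $$ (l, j)) = (\<Sum>l<m. M \<sigma> $$ (i, l) * M \<tau> $$ (l, j))"
        using \<open>m \<le> n\<close> ij True by (intro sum.mono_neutral_right) (auto simp: M_def)
      also have "\<dots> = M (compose L \<sigma> \<tau>) $$ (i, j)"
      proof (cases "i < m")
        case im: True
        have "\<sigma> (\<tau> (e j)) = \<sigma> (\<Sum>l<m. s (rep (\<tau> (e j)) (e l)) * e l)"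
          using rep_sum[OF \<sigma>W[OF \<tau> eW[OF True]]] by simp
        also have "\<dots> = (\<Sum>l<m. s (rep (\<tau> (e j)) (e l)) * \<sigma> (e l))"
          using eW WL by (intro \<sigma>_sum[OF \<sigma>]) auto
        finally have *: "\<sigma> (\<tau> (e j)) = (\<Sum>l<m. s (rep (\<tau> (e j)) (e l)) * \<sigma> (e l))" .
        have span: "\<sigma> (e l) \<in> V.span B" if "l < m" for l
          using \<sigma>W[OF \<sigma> eW[OF that]] spanB by simp
        have "rep (\<sigma> (\<tau> (e j))) (e i) = (\<Sum>l<m. rep (\<tau> (e j)) (e l) * rep (\<sigma> (e l)) (e i))"
        proof -
          let ?x = "\<lambda>l. rep (\<tau> (e j)) (e l)"
          have "V.representation B (\<Sum>l<m. s (?x l) * \<sigma> (e l)) =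
              (\<lambda>b. \<Sum>l<m. V.representation B (s (?x l) * \<sigma> (e l)) b)"
            by (rule V.representation_sum[OF B(2)]) (rule V.span_scale, rule span, simp)
          moreover have "V.representation B (s (?x l) * \<sigma> (e l)) (e i) = ?x l * rep (\<sigma> (e l)) (e i)"
            if "l < m" for l
            using V.representation_scale[OF B(2) span[OF that], of "?x l"] by (simp add: rep_def)
          ultimately show ?thesis unfolding * rep_def[symmetric] by (simp add: rep_def)
        qed
        then show ?thesis
          using True im ij \<open>m \<le> n\<close> eW WL by (simp add: M_def compose_def mult.commute)
      next
        case False
        then show ?thesis using True ij \<open>m \<le> n\<close> by (auto simp: M_def intro!: sum.neutral)
      qed
      finally show ?thesis .
    next
      case False
      have "(\<Sum>l<n. M \<sigma> $$ (i, l) * M \<tau> $$ (l, j)) = (\<Sum>l<n. if l = j then M \<sigma> $$ (i, l) else 0)"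
        using False ij by (intro sum.cong) (auto simp: M_def)
      then show ?thesis using False ij by (simp add: M_def)
    qed
    finally show "M (compose L \<sigma> \<tau>) $$ (i, j) = (M \<sigma> * M \<tau>) $$ (i, j)" by simp
  qed (simp_all add: M_def)
  have M_id: "M (\<lambda>x\<in>L. x) = 1\<^sub>m n"
    by (rule eq_matI) (use rep_e eW WL in \<open>auto simp: M_def\<close>)
  have M_unit: "M \<sigma> \<in> Units (ring_mat TYPE('k) n ())" if \<sigma>: "\<sigma> \<in> carrier G" for \<sigma>
  proof -
    obtain \<tau> where \<tau>: "\<tau> \<in> carrier G" "\<And>x. x \<in> L \<Longrightarrow> \<sigma> (\<tau> x) = x" "\<And>x. x \<in> L \<Longrightarrow> \<tau> (\<sigma> x) = x"
      using \<sigma> unfolding G_def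
      by (rule galois_group_inverse) (use range_L L_01 L_closed in auto)
    have "compose L \<sigma> \<tau> = (\<lambda>x\<in>L. x)" "compose L \<tau> \<sigma> = (\<lambda>x\<in>L. x)"
      using \<tau> by (auto simp: compose_def restrict_def)
    then have "M \<sigma> * M \<tau> = 1\<^sub>m n" "M \<tau> * M \<sigma> = 1\<^sub>m n"
      using M_mult[OF \<sigma> \<tau>(1)] M_mult[OF \<tau>(1) \<sigma>] M_id by simp_all
    moreover have "M \<sigma> \<in> carrier_mat n n" "M \<tau> \<in> carrier_mat n n" by (simp_all add: M_def)
    ultimately show ?thesis
      unfolding Units_def by (auto simp: ring_mat_simps)
  qed
  have "M \<in> hom G (GL n :: 'k mat monoid)"
    using M_unit M_mult
    by (auto simp: hom_def GL_def units_of_def ring_mat_simps G_def galois_group_mult)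
  moreover have "inj_on M (carrier G)"
  proof (rule inj_onI)
    fix \<sigma> \<tau> assume \<sigma>: "\<sigma> \<in> carrier G" and \<tau>: "\<tau> \<in> carrier G" and eq: "M \<sigma> = M \<tau>"
    have ee: "\<sigma> (e j) = \<tau> (e j)" if j: "j < m" for j
    proof -
      have "rep (\<sigma> (e j)) (e i) = rep (\<tau> (e j)) (e i)" if "i < m" for i
      proof -
        have "M \<sigma> $$ (i, j) = M \<tau> $$ (i, j)" using eq by simp
        then show ?thesis using that j \<open>m \<le> n\<close> by (simp add: M_def)
      qed
      then show ?thesis
        using rep_sum[OF \<sigma>W[OF \<sigma> eW[OF j]]] rep_sum[OF \<sigma>W[OF \<tau> eW[OF j]]] by simp
    qed
    have "\<sigma> v = \<tau> v" if v: "v \<in> W" for v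
    proof -
      have *: "\<rho> v = (\<Sum>j<m. s (rep v (e j)) * \<rho> (e j))" if "\<rho> \<in> carrier G" for \<rho>
        using rep_sum[OF v] \<sigma>_sum[OF that, of "{..<m}" e "\<lambda>j. rep v (e j)"] eW WL by auto
      show ?thesis unfolding *[OF \<sigma>] *[OF \<tau>] using ee by simp
    qed
    then show "\<sigma> = \<tau>"
      using \<sigma> \<tau> SW unfolding G_def L_def by (intro galois_group_eqI) auto
  qed
  ultimately have "M \<in> mon G (GL n :: 'k mat monoid)" by (simp add: mon_def)
  then show ?thesis unfolding G_eq by blast
qed

section \<open>Algebraic integers\<close>

text \<open>Here z is an eigenvalue of an integer matrix, hence a root of its characteristic
  polynomial, which is monic with integer coefficients.\<close>

lemma algebraic_int_if_matrix:
  fixes z :: complex and v :: "nat \<Rightarrow> complex" and A :: "nat \<Rightarrow> nat \<Rightarrow> int"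
  assumes "\<And>i. i < n \<Longrightarrow> z * v i = (\<Sum>j<n. of_int (A i j) * v j)" "i0 < n" "v i0 \<noteq> 0"
  shows "algebraic_int z"
proof -
  define M where "M = mat n n (\<lambda>(i, j). A i j)"
  have M: "M \<in> carrier_mat n n" by (simp add: M_def)
  define M' where "M' = (map_mat of_int M :: complex mat)"
  have M': "M' \<in> carrier_mat n n" using M by (simp add: M'_def)
  define w where "w = Matrix.vec n v"
  have "w \<noteq> 0\<^sub>v n"
    using assms(2,3) by (metis index_vec index_zero_vec(1) w_def)
  moreover have "M' *\<^sub>v w = z \<cdot>\<^sub>v w"
  proof (rule eq_vecI)
    fix i assume "i < dim_vec (z \<cdot>\<^sub>v w)"
    then have i: "i < n" by (simp add: w_def)
    have "(M' *\<^sub>v w) $ i = (\<Sum>j<n. of_int (A i j) * v j)"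
      using i by (simp add: M'_def M_def w_def scalar_prod_def atLeast0LessThan)
    then show "(M' *\<^sub>v w) $ i = (z \<cdot>\<^sub>v w) $ i"
      using i assms(1) by (simp add: w_def)
  qed (simp add: M'_def M_def w_def)
  ultimately have "eigenvalue M' z"
    unfolding eigenvalue_def eigenvector_def using M' by (intro exI[of _ w]) (auto simp: w_def)
  then have "poly (char_poly M') z = 0" using eigenvalue_root_char_poly[OF M'] by simp
  moreover have "char_poly M' = map_poly of_int (char_poly M)"
    unfolding M'_def by (rule of_int_hom.char_poly_hom[OF M])
  moreover have "lead_coeff (char_poly M) = 1" using degree_monic_char_poly[OF M] by simp
  ultimately show ?thesis unfolding algebraic_int_altdef_ipoly by metis
qed

text \<open>Generators form a family rather than a set, because products of powers such as x^i y^j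
  may coincide.\<close>

definition int_span :: "('i \<Rightarrow> complex) \<Rightarrow> 'i set \<Rightarrow> complex set" where
  "int_span v J = {\<Sum>i\<in>J. of_int (c i) * v i | c. True}"

lemma int_spanI: "(\<Sum>i\<in>J. of_int (c i) * v i) \<in> int_span v J"
  unfolding int_span_def by blast

lemma int_span_add: "x \<in> int_span v J \<Longrightarrow> y \<in> int_span v J \<Longrightarrow> x + y \<in> int_span v J"
proof -
  assume "x \<in> int_span v J" "y \<in> int_span v J"
  then obtain c e where "x = (\<Sum>i\<in>J. of_int (c i) * v i)" "y = (\<Sum>i\<in>J. of_int (e i) * v i)"
    by (auto simp: int_span_def)
  then have "x + y = (\<Sum>i\<in>J. of_int (c i + e i) * v i)"
    by (simp add: sum.distrib distrib_right)
  then show ?thesis using int_spanI[of "\<lambda>i. c i + e i" v J] by simp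
qed

lemma int_span_scale: "x \<in> int_span v J \<Longrightarrow> of_int k * x \<in> int_span v J"
proof -
  assume "x \<in> int_span v J"
  then obtain c where "x = (\<Sum>i\<in>J. of_int (c i) * v i)" by (auto simp: int_span_def)
  then have "of_int k * x = (\<Sum>i\<in>J. of_int (k * c i) * v i)"
    by (simp add: sum_distrib_left mult.assoc)
  then show ?thesis using int_spanI[of "\<lambda>i. k * c i" v J] by simp
qed

lemma int_span_0: "0 \<in> int_span v J"
  unfolding int_span_def by (auto intro!: exI[of _ "\<lambda>_. 0"])

lemma int_span_sum: "(\<And>k. k \<in> K \<Longrightarrow> g k \<in> int_span v J) \<Longrightarrow> sum g K \<in> int_span v J"
  by (induction K rule: infinite_finite_induct) (auto simp: int_span_0 int_span_add)

lemma int_span_base: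
  assumes "finite J" "i \<in> J"
  shows "v i \<in> int_span v J"
proof -
  have "(\<Sum>j\<in>J. of_int (if j = i then 1 else 0) * v j) = (\<Sum>j\<in>J. if j = i then v j else 0)"
    by (intro sum.cong) auto
  also have "\<dots> = v i" using assms by simp
  finally show ?thesis using int_spanI[of "\<lambda>j. if j = i then 1 else 0" v J] by simp
qed

lemma int_span_stable:
  assumes "\<And>i. i \<in> J \<Longrightarrow> x * v i \<in> int_span v J" "y \<in> int_span v J"
  shows "x * y \<in> int_span v J"
proof -
  obtain c where y: "y = (\<Sum>i\<in>J. of_int (c i) * v i)" using assms(2) by (auto simp: int_span_def)
  have "x * y = (\<Sum>i\<in>J. of_int (c i) * (x * v i))"
    by (simp add: y sum_distrib_left mult.left_commute)
  then show ?thesis using assms(1) by (simp add: int_span_sum int_span_scale)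
qed

lemma algebraic_int_if_int_span:
  assumes "finite J" "i0 \<in> J" "v i0 \<noteq> 0" "\<And>i. i \<in> J \<Longrightarrow> z * v i \<in> int_span v J"
  shows "algebraic_int z"
proof -
  obtain e where e: "bij_betw e {0..<card J} J" using ex_bij_betw_nat_finite[OF assms(1)] by blast
  have "\<exists>c :: 'a \<Rightarrow> int. z * v i = (\<Sum>j\<in>J. of_int (c j) * v j)" if "i \<in> J" for i
    using assms(4)[OF that] by (auto simp: int_span_def)
  then obtain c where c: "\<And>i. i \<in> J \<Longrightarrow> z * v i = (\<Sum>j\<in>J. of_int (c i j) * v j)" by metis
  have "i0 \<in> e ` {0..<card J}" using e assms(2) by (simp add: bij_betw_def)
  then obtain k where k: "k < card J" "e k = i0" by auto
  show ?thesis
  proof (rule algebraic_int_if_matrix)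
    fix i assume "i < card J"
    then have "e i \<in> J" using e by (auto simp: bij_betw_def)
    from c[OF this] show "z * v (e i) = (\<Sum>j<card J. of_int (c (e i) (e j)) * v (e j))"
      using sum.reindex_bij_betw[OF e, of "\<lambda>j. of_int (c (e i) j) * v j"]
      by (simp add: atLeast0LessThan)
  qed (use k assms(3) in auto)
qed

lemma algebraic_int_monic_relation:
  assumes "algebraic_int (x :: complex)"
  obtains n c where "n > 0" "x ^ n = (\<Sum>i<n. of_int (c i) * x ^ i)"
proof -
  obtain p where p: "poly (map_poly of_int p) x = 0" "lead_coeff p = 1"
    using assms by (auto simp: algebraic_int_altdef_ipoly)
  have deg: "degree (map_poly of_int p :: complex poly) = degree p"
    by (rule degree_map_poly) simp
  have "(\<Sum>i\<le>degree p. of_int (Polynomial.coeff p i) * x ^ i) = 0"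
    using p(1) by (simp add: poly_altdef deg coeff_map_poly)
  moreover have "{..degree p} = insert (degree p) {..<degree p}" by auto
  ultimately have eq: "(\<Sum>i<degree p. of_int (Polynomial.coeff p i) * x ^ i) + x ^ degree p = 0"
    using p(2) by (simp add: add.commute)
  then have "degree p > 0" by (intro Nat.gr0I) auto
  moreover have "x ^ degree p = (\<Sum>i<degree p. of_int (- Polynomial.coeff p i) * x ^ i)"
    using eq by (simp add: sum_negf eq_neg_iff_add_eq_0 add.commute)
  ultimately show ?thesis by (rule that)
qed

text \<open>The products x^i y^j with i < m and j < n generate a module that is stable under x and
  y: the monic relations rewrite x^m and y^n.\<close>

lemma algebraic_int_add_mult:
  assumes "algebraic_int (x :: complex)" "algebraic_int y"
  shows "algebraic_int (x + y) \<and> algebraic_int (x * y)"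
proof -
  obtain m c where c: "m > 0" "x ^ m = (\<Sum>i<m. of_int (c i) * x ^ i)"
    using assms(1) by (rule algebraic_int_monic_relation)
  obtain n e where e: "n > 0" "y ^ n = (\<Sum>i<n. of_int (e i) * y ^ i)"
    using assms(2) by (rule algebraic_int_monic_relation)
  define J where "J = {..<m} \<times> {..<n}"
  define v where "v = (\<lambda>(i, j). x ^ i * y ^ j)"
  have J: "finite J" "(0, 0) \<in> J" "v (0, 0) \<noteq> 0" using c(1) e(1) by (auto simp: J_def v_def)
  have base: "x ^ i * y ^ j \<in> int_span v J" if "i < m" "j < n" for i j
    using int_span_base[OF J(1), of "(i, j)" v] that by (simp add: J_def v_def)
  have x: "x * v k \<in> int_span v J" if kJ: "k \<in> J" for k
  proof -
    obtain i j where k: "k = (i, j)" "i < m" "j < n" using kJ by (auto simp: J_def)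
    show ?thesis
    proof (cases "Suc i < m")
      case True
      then show ?thesis using base[OF True k(3)] by (simp add: k v_def mult.assoc)
    next
      case False
      then have "m = Suc i" using k by simp
      then have "x * v k = x ^ m * y ^ j" by (simp add: k v_def)
      also have "\<dots> = (\<Sum>i<m. of_int (c i) * (x ^ i * y ^ j))"
        unfolding c(2) by (simp add: sum_distrib_right mult.assoc)
      also have "\<dots> \<in> int_span v J"
        using base k(3) by (intro int_span_sum int_span_scale) auto
      finally show ?thesis .
    qed
  qed
  have y: "y * v k \<in> int_span v J" if kJ: "k \<in> J" for k
  proof -
    obtain i j where k: "k = (i, j)" "i < m" "j < n" using kJ by (auto simp: J_def)
    show ?thesis
    proof (cases "Suc j < n")
      case True
      then show ?thesis using base[OF k(2) True] by (simp add: k v_def mult.left_commute)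
    next
      case False
      then have "n = Suc j" using k by simp
      then have "y * v k = x ^ i * y ^ n" by (simp add: k v_def)
      also have "\<dots> = (\<Sum>j<n. of_int (e j) * (x ^ i * y ^ j))"
        unfolding e(2) by (simp add: sum_distrib_left mult.left_commute)
      also have "\<dots> \<in> int_span v J"
        using base k(2) by (intro int_span_sum int_span_scale) auto
      finally show ?thesis .
    qed
  qed
  have "algebraic_int (x + y)"
    using J x y by (intro algebraic_int_if_int_span[of J "(0, 0)" v]) (auto simp: distrib_right int_span_add)
  moreover have "algebraic_int (x * y)"
    using J x y int_span_stable[OF x]
    by (intro algebraic_int_if_int_span[of J "(0, 0)" v]) (auto simp: mult.assoc)
  ultimately show ?thesis ..
qed

lemmas algebraic_int_add = algebraic_int_add_mult[THEN conjunct1]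
lemmas algebraic_int_mult = algebraic_int_add_mult[THEN conjunct2]

lemma algebraic_int_of_int: "algebraic_int (of_int k :: complex)"
  by (rule int_imp_algebraic_int) simp

lemma algebraic_int_sum:
  "(\<And>i. i \<in> J \<Longrightarrow> algebraic_int (g i :: complex)) \<Longrightarrow> algebraic_int (sum g J)"
  by (induction J rule: infinite_finite_induct) (auto simp: algebraic_int_add)

lemma algebraic_int_power: "algebraic_int (x :: complex) \<Longrightarrow> algebraic_int (x ^ n)"
  using algebraic_int_of_int[of 1] by (induction n) (simp_all add: algebraic_int_mult)

lemma algebraic_int_diff: "algebraic_int (x :: complex) \<Longrightarrow> algebraic_int y \<Longrightarrow> algebraic_int (x - y)"
  using algebraic_int_add[of x "- y"] by simp

lemma algebraic_int_root_of_unity: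
  assumes "(x :: complex) ^ d = 1" "d > 0"
  shows "algebraic_int x"
proof (rule algebraic_int.intros)
  let ?p = "Polynomial.monom 1 d + [:-1:] :: complex poly"
  have "degree ?p = d" using assms(2) by (subst degree_add_eq_left) (simp_all add: degree_monom_eq)
  then show "lead_coeff ?p = 1" using assms(2) by (auto simp: coeff_pCons split: nat.splits)
  show "\<forall>i. Polynomial.coeff ?p i \<in> \<int>" by (auto simp: coeff_pCons split: nat.splits)
  show "poly ?p x = 0" using assms(1) by (simp add: poly_monom)
qed

section \<open>Primes lying above the kernel of a residue map\<close>

text \<open>Primes are taken in the ring of all algebraic integers because it contains the roots of
  unity to be compared, so that no intermediate number field has to be chosen.\<close>

locale alg_int_prime =
  fixes I :: "complex set"
  assumes I_int: "x \<in> I \<Longrightarrow> algebraic_int x" and I_0: "0 \<in> I" and I_1: "1 \<notin> I"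
    and I_add: "x \<in> I \<Longrightarrow> y \<in> I \<Longrightarrow> x + y \<in> I"
    and I_mult: "x \<in> I \<Longrightarrow> algebraic_int y \<Longrightarrow> y * x \<in> I"
    and I_prime: "algebraic_int x \<Longrightarrow> algebraic_int y \<Longrightarrow> x * y \<in> I \<Longrightarrow> x \<in> I \<or> y \<in> I"

text \<open>R will be the ring of integers of K and \<phi> the reduction at the place. As a total
  function \<phi> also has values outside R, which carry no meaning, except that 1 lies in
  R.\<close>

locale residue_map =
  fixes R :: "complex set" and \<phi> :: "complex \<Rightarrow> 'k::field"
  assumes R_int: "x \<in> R \<Longrightarrow> algebraic_int x" and R_1: "1 \<in> R"
    and R_add: "x \<in> R \<Longrightarrow> y \<in> R \<Longrightarrow> x + y \<in> R" and R_mult: "x \<in> R \<Longrightarrow> y \<in> R \<Longrightarrow> x * y \<in> R"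
    and R_minus: "x \<in> R \<Longrightarrow> - x \<in> R"
    and \<phi>_1: "\<phi> 1 = 1" and \<phi>_add: "x \<in> R \<Longrightarrow> y \<in> R \<Longrightarrow> \<phi> (x + y) = \<phi> x + \<phi> y"
    and \<phi>_mult: "x \<in> R \<Longrightarrow> y \<in> R \<Longrightarrow> \<phi> (x * y) = \<phi> x * \<phi> y"
begin

lemma R_0: "0 \<in> R"
  using R_add[OF R_1 R_minus[OF R_1]] by simp

lemma \<phi>_0: "\<phi> 0 = 0"
  using \<phi>_add[OF R_0 R_0] by (metis add.right_neutral add_left_cancel)

lemma \<phi>_minus: "x \<in> R \<Longrightarrow> \<phi> (- x) = - \<phi> x"
  using \<phi>_add[OF _ R_minus, of x x] by (simp add: \<phi>_0 eq_neg_iff_add_eq_0 add.commute)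

lemma R_diff: "x \<in> R \<Longrightarrow> y \<in> R \<Longrightarrow> x - y \<in> R"
  using R_add[OF _ R_minus, of x y] by simp

lemma \<phi>_diff: "x \<in> R \<Longrightarrow> y \<in> R \<Longrightarrow> \<phi> (x - y) = \<phi> x - \<phi> y"
  using \<phi>_add[OF _ R_minus, of x y] by (simp add: \<phi>_minus)

lemma R_power: "x \<in> R \<Longrightarrow> x ^ n \<in> R"
  by (induction n) (simp_all add: R_1 R_mult)

lemma \<phi>_power: "x \<in> R \<Longrightarrow> \<phi> (x ^ n) = \<phi> x ^ n"
  by (induction n) (simp_all add: \<phi>_1 \<phi>_mult R_power)

lemma of_nat_R: "of_nat n \<in> R \<and> \<phi> (of_nat n) = of_nat n"
  by (induction n) (simp_all add: R_0 \<phi>_0 R_1 R_add \<phi>_add \<phi>_1)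

lemma of_int_R: "of_int k \<in> R \<and> \<phi> (of_int k) = of_int k"
  by (cases k) (simp_all add: of_nat_R R_minus \<phi>_minus del: of_nat_Suc)

lemma sum_R: "(\<And>i. i \<in> J \<Longrightarrow> g i \<in> R) \<Longrightarrow> sum g J \<in> R \<and> \<phi> (sum g J) = (\<Sum>i\<in>J. \<phi> (g i))"
  by (induction J rule: infinite_finite_induct) (auto simp: R_0 \<phi>_0 R_add \<phi>_add)

text \<open>
  The prime is an ideal of the ring of all algebraic integers which is maximal among those
  that meet \<open>R\<close> inside the kernel; it contains the kernel by integrality.
\<close>

lemma lying_over:
  obtains I where "alg_int_prime I" "\<And>x. x \<in> R \<Longrightarrow> x \<in> I \<longleftrightarrow> \<phi> x = 0"
proof -
  define ideal where "ideal J \<longleftrightarrow> (\<forall>x\<in>J. algebraic_int x) \<and> 0 \<in> J \<and> (\<forall>x\<in>J. \<forall>y\<in>J. x + y \<in> J) \<and>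
    (\<forall>x\<in>J. \<forall>y. algebraic_int y \<longrightarrow> y * x \<in> J) \<and> (\<forall>x\<in>J \<inter> R. \<phi> x = 0)" for J :: "complex set"
  have "\<exists>M\<in>{J. ideal J}. \<forall>N\<in>{J. ideal J}. M \<subseteq> N \<longrightarrow> N = M"
  proof (rule subset_Zorn_nonempty)
    show "{J. ideal J} \<noteq> {}" by (auto simp: ideal_def \<phi>_0 intro!: exI[of _ "{0}"])
    fix C assume C: "C \<noteq> {}" "subset.chain {J. ideal J} C"
    have ch: "ideal J" if "J \<in> C" for J using C(2) that by (auto simp: subset.chain_def)
    have chain: "algebraic_int x" "y \<in> J \<Longrightarrow> x + y \<in> J" "algebraic_int z \<Longrightarrow> z * x \<in> J" "x \<in> R \<Longrightarrow> \<phi> x = 0"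
      if "J \<in> C" "x \<in> J" for J x y z
      using ch[OF that(1)] that(2) by (auto simp: ideal_def)
    have U_add: "\<forall>x\<in>\<Union> C. \<forall>y\<in>\<Union> C. x + y \<in> \<Union> C"
    proof (intro ballI)
      fix x y assume "x \<in> \<Union> C" "y \<in> \<Union> C"
      then obtain J J' where J: "x \<in> J" "y \<in> J'" "J \<in> C" "J' \<in> C" by blast
      then have "J \<subseteq> J' \<or> J' \<subseteq> J" using C(2) by (auto simp: subset_chain_def)
      then show "x + y \<in> \<Union> C"
      proof
        assume "J \<subseteq> J'"
        then have "x + y \<in> J'" using J chain(2)[of J' x y] by blast
        then show ?thesis using J(4) by blast
      next
        assume "J' \<subseteq> J"
        then have "x + y \<in> J" using J chain(2)[of J x y] by blast
        then show ?thesis using J(3) by blast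
      qed
    qed
    have U_0: "0 \<in> \<Union> C" using ch C(1) by (auto simp: ideal_def)
    have U_mult: "\<forall>x\<in>\<Union> C. \<forall>y. algebraic_int y \<longrightarrow> y * x \<in> \<Union> C"
      using chain(3) by blast
    have U_int: "\<forall>x\<in>\<Union> C. algebraic_int x" using chain(1) by blast
    have U_R: "\<forall>x\<in>\<Union> C \<inter> R. \<phi> x = 0" using chain(4) by blast
    have "ideal (\<Union> C)"
      unfolding ideal_def by (intro conjI U_int U_0 U_add U_mult U_R)
    then show "\<Union> C \<in> {J. ideal J}" by simp
  qed
  then obtain I where I: "ideal I" and max: "\<And>J. ideal J \<Longrightarrow> I \<subseteq> J \<Longrightarrow> J = I" by blast
  have I_int: "algebraic_int x" if "x \<in> I" for x using I that by (auto simp: ideal_def)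
  have I_0: "0 \<in> I" using I by (auto simp: ideal_def)
  have I_add: "x + y \<in> I" if "x \<in> I" "y \<in> I" for x y using I that by (auto simp: ideal_def)
  have I_mult: "y * x \<in> I" if "x \<in> I" "algebraic_int y" for x y using I that by (auto simp: ideal_def)
  have I_R: "\<phi> x = 0" if "x \<in> I" "x \<in> R" for x using I that by (auto simp: ideal_def)
  have I_minus: "- x \<in> I" if "x \<in> I" for x
    using I_mult[OF that, of "-1"] algebraic_int_of_int[of "-1"] by simp
  \<comment> \<open>By maximality, the ideal generated by I and x meets R outside the
    kernel.\<close>
  have extend: "\<exists>i s. i \<in> I \<and> algebraic_int s \<and> i + s * x \<in> R \<and> \<phi> (i + s * x) \<noteq> 0"
    if x: "algebraic_int x" "x \<notin> I" for x
  proof (rule ccontr)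
    assume no: "\<not> ?thesis"
    define J where "J = {i + s * x | i s. i \<in> I \<and> algebraic_int s}"
    have JI: "i + s * x \<in> J" if "i \<in> I" "algebraic_int s" for i s
      using that by (auto simp: J_def)
    have J1: "\<forall>y\<in>J. algebraic_int y"
      using x(1) by (auto simp: J_def I_int algebraic_int_add algebraic_int_mult)
    have J2: "\<forall>y\<in>J. \<forall>z\<in>J. y + z \<in> J"
    proof (intro ballI)
      fix y z assume "y \<in> J" "z \<in> J"
      then obtain i s i' s' where yz: "y = i + s * x" "z = i' + s' * x" "i \<in> I" "i' \<in> I"
        "algebraic_int s" "algebraic_int s'" by (auto simp: J_def)
      have "y + z = (i + i') + (s + s') * x" by (simp add: yz algebra_simps)
      then show "y + z \<in> J" using JI[OF I_add[OF yz(3,4)] algebraic_int_add[OF yz(5,6)]] by simp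
    qed
    have J3: "\<forall>y\<in>J. \<forall>z. algebraic_int z \<longrightarrow> z * y \<in> J"
    proof (intro ballI allI impI)
      fix y z :: complex assume "y \<in> J" and z: "algebraic_int z"
      then obtain i s where y: "y = i + s * x" "i \<in> I" "algebraic_int s" by (auto simp: J_def)
      have "z * y = z * i + (z * s) * x" by (simp add: y algebra_simps)
      then show "z * y \<in> J" using JI[OF I_mult[OF y(2) z] algebraic_int_mult[OF z y(3)]] by simp
    qed
    have J4: "0 \<in> J" using JI[OF I_0, of 0] by simp
    have J5: "\<forall>y\<in>J \<inter> R. \<phi> y = 0" using no by (auto simp: J_def)
    have "ideal J" unfolding ideal_def by (intro conjI J1 J4 J2 J3 J5)
    moreover have "I \<subseteq> J" using JI[of _ 0] by auto
    ultimately have "J = I" by (rule max)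
    moreover have "x \<in> J" using JI[OF I_0, of 1] algebraic_int_of_int[of 1] by simp
    ultimately show False using x by blast
  qed
  \<comment> \<open>Two witnesses in R outside the kernel have a product in I, although the target
    of \<phi> is a field.\<close>
  have prime: "x \<in> I \<or> y \<in> I" if xy: "algebraic_int x" "algebraic_int y" "x * y \<in> I" for x y
  proof (rule ccontr)
    assume "\<not> (x \<in> I \<or> y \<in> I)"
    then have ndvd: "x \<notin> I" "y \<notin> I" by blast+
    obtain i s where *: "i \<in> I" "algebraic_int s" "i + s * x \<in> R" "\<phi> (i + s * x) \<noteq> 0"
      using extend[OF xy(1) ndvd(1)] by blast
    obtain i' s' where **: "i' \<in> I" "algebraic_int s'" "i' + s' * y \<in> R" "\<phi> (i' + s' * y) \<noteq> 0"
      using extend[OF xy(2) ndvd(2)] by blast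
    have "(i + s * x) * (i' + s' * y) = i' * i + (s' * y) * i + (s * x) * i' + (s * s') * (x * y)"
      by (simp add: algebra_simps)
    also have "\<dots> \<in> I"
      using I_mult[OF *(1) I_int[OF **(1)]] I_mult[OF *(1) algebraic_int_mult[OF **(2) xy(2)]]
        I_mult[OF **(1) algebraic_int_mult[OF *(2) xy(1)]] I_mult[OF xy(3) algebraic_int_mult[OF *(2) **(2)]]
      by (intro I_add)
    finally have "(i + s * x) * (i' + s' * y) \<in> I" .
    then have "\<phi> ((i + s * x) * (i' + s' * y)) = 0" using * ** R_mult by (intro I_R) auto
    then show False using * ** by (simp add: \<phi>_mult)
  qed
  \<comment> \<open>Suppose r = i + s u lies in R but outside the kernel. A monic equation of degree
    n for s, multiplied by u^n, becomes a monic equation for s u with lower coefficients divisible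
    by u. Modulo I it holds for r as well; inside R it reduces to \<phi>(r)^n = 0.\<close>
  have kernel: "u \<in> I" if u: "u \<in> R" "\<phi> u = 0" for u
  proof (rule ccontr)
    assume "u \<notin> I"
    then obtain i s where iu: "i \<in> I" "algebraic_int s" "i + s * u \<in> R" "\<phi> (i + s * u) \<noteq> 0"
      using extend[OF R_int[OF u(1)]] by blast
    define r where "r = i + s * u"
    obtain n c where n: "n > 0" "s ^ n = (\<Sum>k<n. of_int (c k) * s ^ k)"
      using iu(2) by (rule algebraic_int_monic_relation)
    have int_u: "algebraic_int u" "algebraic_int r" using u(1) iu(3) R_int by (auto simp: r_def)
    have pow: "(s * u) ^ k - r ^ k \<in> I" for k
    proof (induction k)
      case (Suc k)
      have "(s * u) ^ Suc k - r ^ Suc k = (s * u) * ((s * u) ^ k - r ^ k) + r ^ k * (- i)"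
        by (simp add: r_def algebra_simps)
      also have "\<dots> \<in> I"
        using Suc iu(1,2) int_u by (intro I_add I_mult I_minus algebraic_int_mult algebraic_int_power)
      finally show ?case .
    qed (simp add: I_0)
    have su: "(s * u) ^ n = (\<Sum>k<n. of_int (c k) * u ^ (n - k) * (s * u) ^ k)"
    proof -
      have "(s * u) ^ n = (\<Sum>k<n. of_int (c k) * s ^ k * u ^ n)"
        by (simp add: power_mult_distrib n(2) sum_distrib_right)
      also have "\<dots> = (\<Sum>k<n. of_int (c k) * u ^ (n - k) * (s * u) ^ k)"
        by (intro sum.cong refl) (simp add: power_mult_distrib mult_ac flip: power_add)
      finally show ?thesis .
    qed
    define t where "t = r ^ n - (\<Sum>k<n. of_int (c k) * u ^ (n - k) * r ^ k)"
    have "t = - ((s * u) ^ n - r ^ n) + (\<Sum>k<n. of_int (c k) * u ^ (n - k) * ((s * u) ^ k - r ^ k))"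
      by (simp add: t_def su sum_subtractf right_diff_distrib)
    also have "\<dots> \<in> I"
    proof (intro I_add I_minus pow)
      have I_sum: "sum g J \<in> I" if "\<And>k. k \<in> J \<Longrightarrow> g k \<in> I" for g and J :: "nat set"
        using that by (induction J rule: infinite_finite_induct) (auto simp: I_0 I_add)
      show "(\<Sum>k<n. of_int (c k) * u ^ (n - k) * ((s * u) ^ k - r ^ k)) \<in> I"
        by (intro I_sum I_mult pow algebraic_int_mult algebraic_int_power int_u algebraic_int_of_int)
    qed
    finally have tI: "t \<in> I" .
    have rR: "r \<in> R" using iu(3) by (simp add: r_def)
    have terms: "of_int (c k) * u ^ (n - k) * r ^ k \<in> R \<and> \<phi> (of_int (c k) * u ^ (n - k) * r ^ k) = 0"
      if "k \<in> {..<n}" for k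
      using that u rR of_int_R[of "c k"] by (simp add: R_mult R_power \<phi>_mult \<phi>_power power_0_left)
    have "(\<Sum>k<n. of_int (c k) * u ^ (n - k) * r ^ k) \<in> R \<and>
        \<phi> (\<Sum>k<n. of_int (c k) * u ^ (n - k) * r ^ k) = 0"
      using sum_R[of "{..<n}" "\<lambda>k. of_int (c k) * u ^ (n - k) * r ^ k"] terms by simp
    then have "t \<in> R" "\<phi> t = \<phi> r ^ n"
      using rR by (simp_all add: t_def R_diff R_power \<phi>_diff \<phi>_power)
    then have "\<phi> r ^ n = 0" using I_R[OF tI] by simp
    then show False using iu(4) by (simp add: r_def)
  qed
  have "1 \<notin> I" using I_R[of 1] R_1 \<phi>_1 by auto
  then have "alg_int_prime I"
    using I_int I_0 I_add I_mult prime by unfold_locales auto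
  then show ?thesis using that kernel I_R by blast
qed

end

section \<open>Polynomials with given roots modulo a prime\<close>

definition root_poly :: "'a::comm_ring_1 list \<Rightarrow> 'a poly" where
  "root_poly xs = (\<Prod>x\<leftarrow>xs. [:- x, 1:])"

lemma root_poly_simps [simp]:
  "root_poly [] = 1" "root_poly (x # xs) = [:- x, 1:] * root_poly xs"
  by (simp_all add: root_poly_def)

lemma root_poly_cong_mset: "mset xs = mset ys \<Longrightarrow> root_poly xs = root_poly ys"
  unfolding root_poly_def by (metis mset_map prod_mset_prod_list)

lemma coeff_linear_mult:
  "Polynomial.coeff ([:- x, 1:] * r) k =
    (case k of 0 \<Rightarrow> 0 | Suc j \<Rightarrow> Polynomial.coeff r j) - x * Polynomial.coeff r k"
  for x :: "'a::comm_ring_1"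
  by (simp add: coeff_pCons)

lemma poly_root_poly_eq_0: "x \<in> set xs \<Longrightarrow> poly (root_poly xs) x = 0"
  by (induction xs) auto

lemma algebraic_int_coeff_root_poly:
  fixes xs :: "complex list"
  assumes "\<forall>x\<in>set xs. algebraic_int x"
  shows "algebraic_int (Polynomial.coeff (root_poly xs) k)"
  using assms
proof (induction xs arbitrary: k)
  case Nil
  then show ?case by (simp add: coeff_pCons one_pCons split: nat.splits)
next
  case (Cons x xs)
  then have "algebraic_int (Polynomial.coeff (root_poly xs) j)" for j by simp
  then show ?case
    using Cons.prems unfolding root_poly_simps coeff_linear_mult
    by (intro algebraic_int_diff algebraic_int_mult) (auto split: nat.splits)
qed

context alg_int_prime
begin

lemma I_minus: "x \<in> I \<Longrightarrow> - x \<in> I"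
  using I_mult[of x "-1"] algebraic_int_of_int[of "-1"] by simp

lemma I_diff: "x \<in> I \<Longrightarrow> y \<in> I \<Longrightarrow> x - y \<in> I"
  using I_add[OF _ I_minus, of x y] by simp

lemma I_sum: "(\<And>i. i \<in> J \<Longrightarrow> g i \<in> I) \<Longrightarrow> sum g J \<in> I"
  by (induction J rule: infinite_finite_induct) (auto simp: I_0 I_add)

lemma cong_mult:
  assumes "x - y \<in> I" "u - v \<in> I" "algebraic_int y" "algebraic_int u"
  shows "x * u - y * v \<in> I"
proof -
  have "x * u - y * v = u * (x - y) + y * (u - v)" by (simp add: algebra_simps)
  then show ?thesis using assms by (simp add: I_add I_mult)
qed

lemma cong_power:
  assumes "x - y \<in> I" "algebraic_int x" "algebraic_int y"
  shows "x ^ n - y ^ n \<in> I"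
proof (induction n)
  case (Suc n)
  then show ?case using assms by (simp add: cong_mult algebraic_int_power)
qed (simp add: I_0)

lemma frobenius_cong_prime:
  assumes p: "Factorial_Ring.prime p" "of_nat p \<in> I" and xy: "algebraic_int x" "algebraic_int y"
  shows "(x + y) ^ p - (x ^ p + y ^ p) \<in> I"
proof -
  have p0: "p > 0" using p(1) by (simp add: prime_gt_0_nat)
  have "{..p} = {0, p} \<union> {1..<p}" using p0 by auto
  then have "(x + y) ^ p = (\<Sum>k\<in>{0, p} \<union> {1..<p}. of_nat (p choose k) * x ^ k * y ^ (p - k))"
    by (simp add: binomial_ring)
  also have "\<dots> = x ^ p + y ^ p + (\<Sum>k\<in>{1..<p}. of_nat (p choose k) * x ^ k * y ^ (p - k))"
    using p0 by (subst sum.union_disjoint) (auto simp: add.commute)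
  finally have "(x + y) ^ p - (x ^ p + y ^ p) = (\<Sum>k\<in>{1..<p}. of_nat (p choose k) * x ^ k * y ^ (p - k))"
    by simp
  also have "\<dots> \<in> I"
  proof (rule I_sum)
    fix k assume k: "k \<in> {1..<p}"
    then have "p dvd (p choose k)" using dvd_choose_prime[of k p] p(1) by auto
    then obtain m where "p choose k = p * m" by (elim dvdE)
    then have "of_nat (p choose k) * x ^ k * y ^ (p - k) = (of_int (int m) * x ^ k * y ^ (p - k)) * of_nat p"
      by simp
    also have "\<dots> \<in> I"
      using p(2) xy by (intro I_mult algebraic_int_mult algebraic_int_power algebraic_int_of_int)
    finally show "of_nat (p choose k) * x ^ k * y ^ (p - k) \<in> I" .
  qed
  finally show ?thesis .
qed

lemma frobenius_cong:
  assumes p: "Factorial_Ring.prime p" "of_nat p \<in> I" and xy: "algebraic_int x" "algebraic_int y"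
  shows "(x + y) ^ (p ^ s) - (x ^ (p ^ s) + y ^ (p ^ s)) \<in> I"
proof (induction s)
  case (Suc s)
  let ?x = "x ^ (p ^ s)" and ?y = "y ^ (p ^ s)"
  have int: "algebraic_int ?x" "algebraic_int ?y" "algebraic_int ((x + y) ^ (p ^ s))"
    using xy by (simp_all add: algebraic_int_power algebraic_int_add)
  have "((x + y) ^ (p ^ s)) ^ p - (?x + ?y) ^ p \<in> I"
    using Suc int by (intro cong_power) (auto simp: algebraic_int_add)
  moreover have "(?x + ?y) ^ p - (?x ^ p + ?y ^ p) \<in> I"
    using int by (intro frobenius_cong_prime p)
  ultimately have "(((x + y) ^ (p ^ s)) ^ p - (?x + ?y) ^ p) + ((?x + ?y) ^ p - (?x ^ p + ?y ^ p)) \<in> I"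
    by (rule I_add)
  also have "(((x + y) ^ (p ^ s)) ^ p - (?x + ?y) ^ p) + ((?x + ?y) ^ p - (?x ^ p + ?y ^ p)) =
      ((x + y) ^ (p ^ s)) ^ p - (?x ^ p + ?y ^ p)" by (simp add: algebra_simps)
  finally show ?case unfolding power_Suc2 power_mult .
qed (simp add: I_0)

lemma frobenius_cong_diff:
  assumes p: "Factorial_Ring.prime p" "of_nat p \<in> I" and xy: "algebraic_int x" "algebraic_int y"
  shows "(x - y) ^ (p ^ s) - (x ^ (p ^ s) - y ^ (p ^ s)) \<in> I"
proof -
  have "- (((x - y) + y) ^ (p ^ s) - ((x - y) ^ (p ^ s) + y ^ (p ^ s))) \<in> I"
    using xy by (intro I_minus frobenius_cong p algebraic_int_diff)
  then show ?thesis by (simp add: algebra_simps)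
qed

text \<open>Powers with exponent p^s are additive modulo the prime, so they pass through the
  elementary symmetric polynomials, built up here one linear factor at a time.\<close>

lemma frobenius_root_poly:
  assumes p: "Factorial_Ring.prime p" "of_nat p \<in> I" and xs: "\<forall>x\<in>set xs. algebraic_int x"
  shows "Polynomial.coeff (root_poly xs) k ^ (p ^ s) -
    Polynomial.coeff (root_poly (map (\<lambda>x. x ^ (p ^ s)) xs)) k \<in> I"
  using xs
proof (induction xs arbitrary: k)
  case Nil
  have "p ^ s > 0" using p(1) by (simp add: prime_gt_0_nat)
  then have zero: "(0 :: complex) ^ (p ^ s) = 0" by (rule zero_power)
  show ?case by (cases k) (simp_all add: zero I_0 one_pCons)
next
  case (Cons x xs)
  let ?q = "p ^ s"
  let ?c = "Polynomial.coeff (root_poly xs)" and ?e = "Polynomial.coeff (root_poly (map (\<lambda>x. x ^ (p ^ s)) xs))"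
  define a where "a = (case k of 0 \<Rightarrow> 0 | Suc j \<Rightarrow> ?c j)"
  define a' where "a' = (case k of 0 \<Rightarrow> 0 | Suc j \<Rightarrow> ?e j)"
  have IH: "?c j ^ ?q - ?e j \<in> I" for j using Cons by simp
  have int: "algebraic_int (?c j)" "algebraic_int (?e j)" "algebraic_int x" for j
    using Cons.prems by (auto intro!: algebraic_int_coeff_root_poly algebraic_int_power)
  have q0: "?q > 0" using p(1) by (simp add: prime_gt_0_nat)
  have aI: "a ^ ?q - a' \<in> I"
    using IH q0 by (auto simp: a_def a'_def I_0 zero_power split: nat.splits)
  have int_a: "algebraic_int a" using int by (auto simp: a_def split: nat.splits)
  have xI: "x ^ ?q * ?c k ^ ?q - x ^ ?q * ?e k \<in> I"
    using IH[of k] int by (intro cong_mult) (auto simp: I_0 algebraic_int_power)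
  have diff: "(a - x * ?c k) ^ ?q - (a ^ ?q - (x * ?c k) ^ ?q) \<in> I"
    using int int_a by (intro frobenius_cong_diff p algebraic_int_mult)
  have "(a - x * ?c k) ^ ?q - (a' - x ^ ?q * ?e k) =
      ((a - x * ?c k) ^ ?q - (a ^ ?q - (x * ?c k) ^ ?q)) +
      ((a ^ ?q - a') - (x ^ ?q * ?c k ^ ?q - x ^ ?q * ?e k))"
    by (simp add: power_mult_distrib algebra_simps)
  also have "\<dots> \<in> I" by (rule I_add[OF diff I_diff[OF aI xI]])
  finally have "(a - x * ?c k) ^ ?q - (a' - x ^ ?q * ?e k) \<in> I" .
  then show ?case
    unfolding root_poly_simps list.map coeff_linear_mult a_def a'_def .
qed

text \<open>If w = x / y were different from 1, the sum of its first d powers would vanish. As w is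
  congruent to 1, this sum is also congruent to d, which is not in I.\<close>

lemma roots_of_unity_cong:
  assumes d: "d > 0" "of_nat d \<notin> I" and xy: "x ^ d = 1" "y ^ d = 1" "x - y \<in> I"
  shows "x = y"
proof (rule ccontr)
  assume "x \<noteq> y"
  have int: "algebraic_int x" "algebraic_int y"
    using xy d algebraic_int_root_of_unity by blast+
  define w where "w = x * y ^ (d - 1)"
  have yd: "y ^ (d - 1) * y = 1" using xy(2) d(1) by (metis power_minus_mult)
  have w_int: "algebraic_int w" using int by (simp add: w_def algebraic_int_mult algebraic_int_power)
  have "w * y = x" by (simp add: w_def yd[simplified] mult.assoc)
  then have "w \<noteq> 1" using \<open>x \<noteq> y\<close> by auto
  have "w ^ d = x ^ d * (y ^ d) ^ (d - 1)"
    by (simp add: w_def power_mult_distrib mult.commute flip: power_mult)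
  then have wd: "w ^ d = 1" using xy by simp
  have "y ^ (d - 1) * (x - y) = w - 1" using yd by (simp add: w_def algebra_simps)
  then have "w - 1 \<in> I" using I_mult[OF xy(3), of "y ^ (d - 1)"] int by (simp add: algebraic_int_power)
  then have pow: "w ^ k - 1 \<in> I" for k
    using cong_power[of w 1 k] w_int algebraic_int_of_int[of 1] by simp
  have "(\<Sum>k<d. w ^ k) = 0"
    using \<open>w \<noteq> 1\<close> wd by (simp add: sum_gp_strict)
  then have "of_nat d = - (\<Sum>k<d. w ^ k - 1)"
    by (simp add: sum_subtractf)
  also have "\<dots> \<in> I" using pow by (intro I_minus I_sum)
  finally show False using d(2) by blast
qed

lemma poly_in_I:
  assumes "\<And>k. Polynomial.coeff r k \<in> I" "algebraic_int x"
  shows "poly r x \<in> I"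
  unfolding poly_altdef using assms
  by (intro I_sum) (metis I_mult algebraic_int_power mult.commute)

text \<open>The coefficients of r are recovered from the top: that at j is the coefficient of the
  product at j + 1 plus x times the one of r at j + 1. The descent starts one above the degree,
  where the coefficient is 0.\<close>

lemma cancel_linear_factor:
  assumes "\<And>k. Polynomial.coeff ([:- x, 1:] * r) k \<in> I" "algebraic_int x"
  shows "Polynomial.coeff r k \<in> I"
proof -
  have "Polynomial.coeff r (degree r + 1 - i) \<in> I" if "i \<le> degree r + 1" for i
    using that
  proof (induction i)
    case 0
    then show ?case by (simp add: I_0 coeff_eq_0)
  next
    case (Suc i)
    define j where "j = degree r + 1 - Suc i"
    have j: "degree r + 1 - i = Suc j" using Suc.prems by (simp add: j_def)
    then have "x * Polynomial.coeff r (Suc j) \<in> I" using Suc assms(2) by (simp add: I_mult)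
    moreover have "Polynomial.coeff r j - x * Polynomial.coeff r (Suc j) \<in> I"
      using assms(1)[of "Suc j"] unfolding coeff_linear_mult by simp
    ultimately have "Polynomial.coeff r j - x * Polynomial.coeff r (Suc j) + x * Polynomial.coeff r (Suc j) \<in> I"
      by (intro I_add)
    then show ?case by (simp add: j_def)
  qed
  from this[of "degree r + 1 - k"] show ?thesis
    by (cases "k \<le> degree r") (simp_all add: I_0 coeff_eq_0)
qed

text \<open>Evaluated at a root x of the first polynomial, the second one lies in the prime, so one
  of its factors x - y does. Congruent roots of unity are equal, and the common linear factor is
  cancelled.\<close>

lemma roots_of_unity_mset_cong:
  assumes d: "d > 0" "of_nat d \<notin> I"
    and roots: "\<forall>x\<in>set xs. x ^ d = 1" "\<forall>y\<in>set ys. y ^ d = 1"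
    and cong: "\<And>k. Polynomial.coeff (root_poly xs - root_poly ys) k \<in> I"
  shows "mset xs = mset ys"
  using roots cong
proof (induction xs arbitrary: ys)
  case Nil
  have "ys = []"
  proof (rule ccontr)
    assume "ys \<noteq> []"
    then obtain y where y: "y \<in> set ys" using list.set_sel(1) by blast
    have "poly (root_poly [] - root_poly ys) y \<in> I"
      using Nil y d algebraic_int_root_of_unity by (intro poly_in_I) auto
    then show False using poly_root_poly_eq_0[OF y] I_1 by simp
  qed
  then show ?case by simp
next
  case (Cons x xs)
  have x: "x ^ d = 1" "algebraic_int x" using Cons.prems(1) d algebraic_int_root_of_unity by auto
  have int_ys: "algebraic_int y" if "y \<in> set ys" for y
    using that Cons.prems(2) d algebraic_int_root_of_unity by auto
  have "poly (root_poly (x # xs) - root_poly ys) x \<in> I"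
    using Cons.prems(3) x(2) by (rule poly_in_I)
  then have "- poly (root_poly ys) x \<in> I" by simp
  then have "poly (root_poly ys) x \<in> I" using I_minus by fastforce
  moreover have "\<exists>y\<in>set ys. x - y \<in> I" if "poly (root_poly ys) x \<in> I" "\<forall>y\<in>set ys. algebraic_int y" for ys
    using that
  proof (induction ys)
    case Nil
    then show ?case using I_1 by simp
  next
    case (Cons y ys)
    have "algebraic_int (poly (root_poly ys) x)"
      unfolding poly_altdef using Cons.prems(2) x(2)
      by (intro algebraic_int_sum algebraic_int_mult algebraic_int_coeff_root_poly algebraic_int_power) auto
    moreover have "(x - y) * poly (root_poly ys) x \<in> I" using Cons.prems(1) by (simp add: algebra_simps)
    ultimately have "x - y \<in> I \<or> poly (root_poly ys) x \<in> I"
      using Cons.prems(2) x(2) by (intro I_prime algebraic_int_diff) auto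
    then show ?case using Cons by auto
  qed
  ultimately obtain y where y: "y \<in> set ys" "x - y \<in> I" using int_ys by blast
  then have "x \<in> set ys" using roots_of_unity_cong[OF d x(1)] Cons.prems(2) by auto
  define zs where "zs = remove1 x ys"
  have ys: "mset ys = mset (x # zs)" using \<open>x \<in> set ys\<close> by (simp add: zs_def)
  have "root_poly (x # xs) - root_poly ys = [:- x, 1:] * (root_poly xs - root_poly zs)"
    unfolding root_poly_cong_mset[OF ys] by (simp only: root_poly_simps right_diff_distrib)
  then have "Polynomial.coeff ([:- x, 1:] * (root_poly xs - root_poly zs)) k \<in> I" for k
    using Cons.prems(3)[of k] by simp
  then have "Polynomial.coeff (root_poly xs - root_poly zs) k \<in> I" for k
    using x(2) by (rule cancel_linear_factor)
  moreover have "\<forall>z\<in>set zs. z ^ d = 1" using Cons.prems(2) by (auto simp: zs_def dest: notin_set_remove1)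
  ultimately have "mset xs = mset zs" using Cons by simp
  then show ?case using ys by simp
qed

end

section \<open>Roots of unity attached to rational numbers\<close>

definition unity :: "rat \<Rightarrow> complex" where
  "unity x = cis (2 * pi * of_rat x)"

lemma unity_power: "unity x ^ n = unity (of_nat n * x)"
  by (simp add: unity_def Complex.DeMoivre of_rat_mult mult_ac)

lemma unity_eq_iff: "unity x = unity y \<longleftrightarrow> frac x = frac y"
proof
  assume "unity x = unity y"
  then have "sin (2 * pi * of_rat x) = sin (2 * pi * of_rat y) \<and> cos (2 * pi * of_rat x) = cos (2 * pi * of_rat y)"
    by (auto simp: unity_def complex_eq_iff)
  then obtain n :: int where "2 * pi * of_rat x = 2 * pi * of_rat y + 2 * pi * of_int n"
    unfolding sin_cos_eq_iff by blast
  then have "2 * pi * of_rat x = 2 * pi * (of_rat y + of_int n)" by (simp add: distrib_left)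
  then have "(of_rat x :: real) = of_rat y + of_int n" by simp
  then have "(of_rat x :: real) = of_rat (y + of_int n)" by (simp add: of_rat_add)
  then have "x = y + of_int n" by (simp only: of_rat_eq_iff)
  then show "frac x = frac y" by (simp add: frac_def)
next
  assume "frac x = frac y"
  then have "x = y + of_int (\<lfloor>x\<rfloor> - \<lfloor>y\<rfloor>)" by (simp add: frac_def algebra_simps)
  then obtain n where x: "x = y + of_int n" by blast
  have "cis (2 * pi * of_int n) = 1" by (simp add: cis_multiple_2pi)
  then show "unity x = unity y"
    by (simp add: x unity_def of_rat_add distrib_left flip: cis_mult)
qed

lemma unity_root:
  assumes "of_nat d * x \<in> \<int>"
  shows "unity x ^ d = 1"
proof -
  have "frac (of_nat d * x) = frac 0" using assms by simp
  then have "unity (of_nat d * x) = unity 0" by (simp only: unity_eq_iff)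
  then show ?thesis by (simp add: unity_power) (simp add: unity_def)
qed

lemma residues_mod_Ints_eq_iff_unity:
  "residues_mod_Ints xs = residues_mod_Ints ys \<longleftrightarrow> mset (map unity xs) = mset (map unity ys)"
proof
  \<comment> \<open>A left inverse up to the fractional part: it recovers the class of x modulo the
    integers from its root of unity.\<close>
  define g where "g u = frac (SOME x. unity x = u)" for u
  have g: "g (unity x) = frac x" for x
    using someI[of "\<lambda>y. unity y = unity x" x] by (simp add: g_def unity_eq_iff)
  assume "mset (map unity xs) = mset (map unity ys)"
  then have "image_mset g (mset (map unity xs)) = image_mset g (mset (map unity ys))" by simp
  then show "residues_mod_Ints xs = residues_mod_Ints ys"
    by (simp add: residues_mod_Ints_def image_mset.compositionality o_def g)
next
  have u: "unity (frac x) = unity x" for x by (simp add: unity_eq_iff)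
  assume "residues_mod_Ints xs = residues_mod_Ints ys"
  then have "image_mset unity (residues_mod_Ints xs) = image_mset unity (residues_mod_Ints ys)" by simp
  then show "mset (map unity xs) = mset (map unity ys)"
    by (simp add: residues_mod_Ints_def image_mset.compositionality o_def u)
qed

theorem (in residue_map) frobenius_stabilizes_residues:
  assumes p: "Factorial_Ring.prime p" "CHAR('k) = p" and q: "q = p ^ s" and frob_k: "\<And>x :: 'k. x ^ q = x"
    and d: "d > 0" "\<not> p dvd d" "\<forall>x\<in>set xs. of_nat d * x \<in> \<int>"
    and R: "\<And>k. Polynomial.coeff (root_poly (map unity xs)) k \<in> R"
  shows "residues_mod_Ints (map ((*) (of_nat q)) xs) = residues_mod_Ints xs"
proof -
  obtain I where I: "alg_int_prime I" "\<And>x. x \<in> R \<Longrightarrow> x \<in> I \<longleftrightarrow> \<phi> x = 0"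
    by (rule lying_over) blast
  interpret alg_int_prime I by (rule I)
  have pI: "of_nat p \<in> I" using of_nat_R[of p] I(2)[of "of_nat p"] p(2) of_nat_CHAR[where ?'a = 'k] by simp
  have dI: "of_nat d \<notin> I"
    using of_nat_R[of d] I(2)[of "of_nat d"] p(2) d(2) by (simp add: of_nat_eq_0_iff_char_dvd)
  define us where "us = map unity xs"
  have us: "\<forall>u\<in>set us. u ^ d = 1" using d(3) by (auto simp: us_def unity_root)
  then have us_int: "\<forall>u\<in>set us. algebraic_int u" using d(1) algebraic_int_root_of_unity by blast
  define us' where "us' = map (\<lambda>u. u ^ q) us"
  have us': "\<forall>u\<in>set us'. u ^ d = 1" using us by (auto simp: us'_def mult.commute simp flip: power_mult) (simp add: power_mult)
  have "Polynomial.coeff (root_poly us' - root_poly us) k \<in> I" for k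
  proof -
    \<comment> \<open>Modulo I this coefficient agrees with its q-th power, as x^q = x holds in the
      residue field, and that power agrees with the coefficient formed from the q-th powers of the
      roots.\<close>
    let ?c = "Polynomial.coeff (root_poly us) k"
    have cR: "?c \<in> R" using R by (simp add: us_def)
    then have "\<phi> (?c ^ q - ?c) = 0" by (simp add: \<phi>_diff R_power \<phi>_power frob_k)
    then have 1: "?c ^ q - ?c \<in> I" using I(2) cR R_diff R_power by blast
    have 2: "?c ^ q - Polynomial.coeff (root_poly us') k \<in> I"
      unfolding us'_def q using frobenius_root_poly[OF p(1) pI us_int] .
    show ?thesis using I_diff[OF 1 2] by simp
  qed
  then have "mset us' = mset us" by (rule roots_of_unity_mset_cong[OF d(1) dI us' us])
  moreover have "us' = map unity (map ((*) (of_nat q)) xs)"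
    by (simp add: us'_def us_def unity_power)
  ultimately show ?thesis unfolding residues_mod_Ints_eq_iff_unity by (simp add: us_def)
qed

section \<open>Integers of the cyclotomic field\<close>

interpretation of_rat_emb: field_embedding "of_rat :: rat \<Rightarrow> complex"
  by unfold_locales (simp_all add: of_rat_add of_rat_mult)

lemma zeta_conv_unity: "zeta d = unity (1 / of_nat d)"
  by (simp add: zeta_def unity_def of_rat_divide)

lemma zeta_power: "zeta d ^ k = unity (of_nat k / of_nat d)"
  by (simp add: zeta_conv_unity unity_power)

lemma zeta_power_eq_1_iff:
  assumes "d > 0"
  shows "zeta d ^ k = 1 \<longleftrightarrow> d dvd k"
proof -
  have "zeta d ^ k = 1 \<longleftrightarrow> unity (of_nat k / of_nat d) = unity 0"
    unfolding zeta_power by (simp add: unity_def)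
  also have "\<dots> \<longleftrightarrow> of_nat k / of_nat d \<in> (\<int> :: rat set)"
    by (simp add: unity_eq_iff)
  also have "\<dots> \<longleftrightarrow> d dvd k"
  proof
    assume "of_nat k / of_nat d \<in> (\<int> :: rat set)"
    then obtain z where "of_nat k / of_nat d = (of_int z :: rat)" by (elim Ints_cases)
    then have "(of_int (int k) :: rat) = of_int (z * int d)" using assms by (simp add: field_simps)
    then have "int k = z * int d" by (simp only: of_int_eq_iff)
    then have "int d dvd int k" by simp
    then show "d dvd k" by simp
  qed (use assms in \<open>auto elim!: dvdE\<close>)
  finally show ?thesis .
qed

lemma zeta_power_self: "d > 0 \<Longrightarrow> zeta d ^ d = 1"
  by (simp add: zeta_power_eq_1_iff)

lemma sum_zeta_powers:
  assumes "d > 0"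
  shows "(\<Sum>l<d. zeta d ^ (l * k)) = (if d dvd k then of_nat d else 0)"
proof (cases "d dvd k")
  case True
  then have "zeta d ^ (l * k) = 1" for l using assms by (simp add: zeta_power_eq_1_iff)
  then show ?thesis using True by simp
next
  case False
  have "(\<Sum>l<d. zeta d ^ (l * k)) = (\<Sum>l<d. (zeta d ^ k) ^ l)"
    by (simp add: mult.commute flip: power_mult)
  also have "\<dots> = 0"
    using False assms
    by (simp add: sum_gp_strict zeta_power_eq_1_iff zeta_power_self mult.commute[of k] power_mult flip: power_mult[of _ k d])
  finally show ?thesis using False by simp
qed

section \<open>Rational polynomials evaluated at roots of unity\<close>

abbreviation rat_ev :: "rat poly \<Rightarrow> complex \<Rightarrow> complex" where
  "rat_ev g y \<equiv> poly (map_poly of_rat g) y"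

lemma map_poly_of_rat_pCons: "map_poly of_rat (pCons a g) = pCons (of_rat a) (map_poly of_rat g)"
  by (rule poly_eqI) (simp add: coeff_map_poly coeff_pCons split: nat.splits)

lemma map_poly_of_int_pCons: "map_poly of_int (pCons a g) = pCons (of_int a) (map_poly of_int g)"
  by (rule poly_eqI) (simp add: coeff_map_poly coeff_pCons split: nat.splits)

lemma rat_ev_simps:
  "rat_ev (g + h) y = rat_ev g y + rat_ev h y" "rat_ev (g * h) y = rat_ev g y * rat_ev h y"
  "rat_ev 1 y = 1" "rat_ev [:a:] y = of_rat a"
  by (simp_all add: of_rat_emb.map_poly_emb_add of_rat_emb.map_poly_emb_mult map_poly_of_rat_pCons)

lemma rat_ev_pcompose_int:
  "rat_ev (pcompose (map_poly of_int m) g) y = poly (map_poly of_int m) (rat_ev g y)"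
  by (induction m) (simp_all add: pcompose_pCons map_poly_of_int_pCons rat_ev_simps)

text \<open>\<mu> is the minimal polynomial of \<open>zeta d\<close> and \<nu> its cofactor in x^d -
  1, so \<nu> vanishes at those d-th roots of unity at which \<mu> does not. Irreducibility of \<mu>
  is recorded as a Bezout identity.\<close>

lemma cyclotomic_minimal_polyE:
  assumes d: "d > 0"
  obtains \<mu> :: "rat poly" and \<nu> where "rat_ev \<mu> (zeta d) = 0"
    "\<And>u. rat_ev u (zeta d) = 0 \<Longrightarrow> \<mu> dvd u" "\<And>g. rat_ev g (zeta d) \<noteq> 0 \<Longrightarrow> \<exists>u v. u * g + v * \<mu> = 1"
    "\<And>w. w ^ d = 1 \<Longrightarrow> rat_ev \<mu> w = 0 \<or> rat_ev \<nu> w = 0" "rat_ev \<nu> (zeta d) \<noteq> 0"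
proof -
  define T where "T = (Polynomial.monom 1 d - 1 :: rat poly)"
  have map_T: "map_poly of_rat T = (Polynomial.monom 1 d - 1 :: complex poly)"
    by (rule poly_eqI) (simp add: T_def coeff_map_poly of_rat_diff one_pCons coeff_pCons split: nat.splits)
  have T_ev: "rat_ev T w = w ^ d - 1" for w by (simp add: map_T poly_monom)
  have "Polynomial.coeff T d = 1" using d by (simp add: T_def one_pCons coeff_pCons split: nat.splits)
  then have "T \<noteq> 0" by auto
  obtain \<mu> where \<mu>: "\<mu> \<noteq> 0" "rat_ev \<mu> (zeta d) = 0" "\<And>u. rat_ev u (zeta d) = 0 \<Longrightarrow> \<mu> dvd u"
    by (rule of_rat_emb.minimal_polyE[OF \<open>T \<noteq> 0\<close>, of "zeta d"])
      (use d in \<open>simp add: T_ev zeta_power_self\<close>, blast)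
  have bezout: "\<exists>u v. u * g + v * \<mu> = 1" if g: "rat_ev g (zeta d) \<noteq> 0" for g
  proof -
    \<comment> \<open>h is nonzero at \<open>zeta d\<close> because g is. So the cofactor of h in
      \<mu> vanishes there and is a multiple of \<mu>, which leaves only a unit for h.\<close>
    define h where "h = gcd g \<mu>"
    obtain t where "g = h * t" unfolding h_def by (metis dvdE gcd_dvd1)
    then have hz: "rat_ev h (zeta d) \<noteq> 0" using g by (auto simp: rat_ev_simps)
    obtain r where r: "\<mu> = h * r" unfolding h_def by (metis dvdE gcd_dvd2)
    then have "rat_ev r (zeta d) = 0" using \<mu>(2) hz by (simp add: rat_ev_simps)
    then obtain t where t: "r = \<mu> * t" using \<mu>(3) by (metis dvdE)
    then have "\<mu> * 1 = \<mu> * (h * t)" using r by (simp add: algebra_simps)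
    then have "1 = h * t" using \<mu>(1) by (simp only: mult_cancel_left) simp
    then have "is_unit (gcd g \<mu>)" unfolding h_def by (metis dvd_triv_left)
    then have "gcd g \<mu> = 1" by (simp only: is_unit_gcd coprime_imp_gcd_eq_1)
    then show ?thesis using bezout_coefficients_fst_snd[of g \<mu>] by metis
  qed
  obtain \<nu> where \<nu>: "T = \<mu> * \<nu>" using \<mu>(3)[of T] d by (auto simp: T_ev zeta_power_self elim: dvdE)
  have "rat_ev \<mu> w = 0 \<or> rat_ev \<nu> w = 0" if "w ^ d = 1" for w
    using T_ev[of w] that unfolding \<nu> rat_ev_simps by simp
  moreover have "rat_ev \<nu> (zeta d) \<noteq> 0"
  proof
    \<comment> \<open>A common zero of \<mu> and \<nu> would be a zero of the derivative d x^(d-1)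
      of x^d - 1.\<close>
    assume "rat_ev \<nu> (zeta d) = 0"
    then have "poly (pderiv (map_poly of_rat \<mu> * map_poly of_rat \<nu>)) (zeta d) = (0 :: complex)"
      using \<mu>(2) by (simp add: pderiv_mult)
    moreover have "map_poly of_rat \<mu> * map_poly of_rat \<nu> = (Polynomial.monom 1 d - 1 :: complex poly)"
      using map_T unfolding \<nu> of_rat_emb.map_poly_emb_mult .
    ultimately have "of_nat d * zeta d ^ (d - 1) = 0"
      by (simp add: pderiv_diff pderiv_monom poly_monom)
    then show False using d by (simp add: zeta_def)
  qed
  ultimately show ?thesis using that \<mu>(2,3) bezout by blast
qed

text \<open>The polynomial values at \<open>zeta d\<close> already form a field, since the Bezout
  identity with \<mu> provides inverses.\<close>

lemma cyclotomic_field_rep: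
  assumes "d > 0" "z \<in> cyclotomic_field d"
  obtains g where "z = rat_ev g (zeta d)"
proof -
  obtain \<mu> :: "rat poly" and \<nu> where \<mu>: "rat_ev \<mu> (zeta d) = 0"
    and bezout: "\<And>g. rat_ev g (zeta d) \<noteq> 0 \<Longrightarrow> \<exists>u v. u * g + v * \<mu> = 1"
    by (rule cyclotomic_minimal_polyE[OF assms(1)]) blast
  have "\<exists>g. z = rat_ev g (zeta d)"
    using assms(2) unfolding cyclotomic_field_def
  proof (induction rule: gen_field_induct)
    case one
    then show ?case by (intro exI[of _ 1]) (simp add: rat_ev_simps)
  next
    case (incl z)
    then show ?case by (intro exI[of _ "[:0, 1:]"]) (simp add: map_poly_of_rat_pCons)
  next
    case (uminus z)
    then obtain g where "z = rat_ev g (zeta d)" by blast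
    then show ?case by (intro exI[of _ "[:-1:] * g"]) (simp only: rat_ev_simps, simp)
  next
    case (inverse z)
    then obtain g where g: "z = rat_ev g (zeta d)" by blast
    then obtain u v where "u * g + v * \<mu> = 1" using bezout inverse(2) by blast
    then have "rat_ev (u * g + v * \<mu>) (zeta d) = 1" by (simp add: rat_ev_simps)
    then have "rat_ev u (zeta d) * z = 1" unfolding rat_ev_simps \<mu> g by simp
    then have "inverse z = rat_ev u (zeta d)" by (metis inverse_unique mult.commute)
    then show ?case by blast
  next
    case (add x y)
    then show ?case by (metis rat_ev_simps(1))
  next
    case (mult x y)
    then show ?case by (metis rat_ev_simps(2))
  qed
  then show ?thesis using that by blast
qed

text \<open>
  The polynomial \<open>g\<close> representing \<open>z\<close> is chosen to vanish at the \<open>d\<close>-th roots of unity that are not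
  conjugate to \<open>\<zeta>\<^sub>d\<close>. Its values at all \<open>d\<close>-th roots of unity are then algebraic integers, and so are
  the discrete Fourier coefficients of these values.
\<close>

lemma cyclotomic_integer_rep:
  assumes d: "d > 0" and z: "z \<in> cyclotomic_field d" "algebraic_int z"
  obtains n :: "nat \<Rightarrow> int" where "of_nat d * z = (\<Sum>j<d. of_int (n j) * zeta d ^ j)"
proof -
  obtain \<mu> :: "rat poly" and \<nu> where \<mu>: "rat_ev \<mu> (zeta d) = 0" "\<And>u. rat_ev u (zeta d) = 0 \<Longrightarrow> \<mu> dvd u"
    and bezout: "\<And>g. rat_ev g (zeta d) \<noteq> 0 \<Longrightarrow> \<exists>u v. u * g + v * \<mu> = 1"
    and roots: "\<And>w. w ^ d = 1 \<Longrightarrow> rat_ev \<mu> w = 0 \<or> rat_ev \<nu> w = 0" and \<nu>: "rat_ev \<nu> (zeta d) \<noteq> 0"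
    by (rule cyclotomic_minimal_polyE[OF d]) blast
  obtain g0 where g0: "z = rat_ev g0 (zeta d)" using d z(1) by (rule cyclotomic_field_rep)
  obtain u v where uv: "u * \<nu> + v * \<mu> = 1" using bezout[OF \<nu>] by blast
  have uv_ev: "rat_ev u w * rat_ev \<nu> w + rat_ev v w * rat_ev \<mu> w = 1" for w
    using arg_cong[OF uv, of "\<lambda>r. rat_ev r w"] by (simp only: rat_ev_simps)
  \<comment> \<open>The factor u \<nu> is 1 at the zeros of \<mu> and 0 at those of \<nu>: it keeps
    the values at the conjugates of \<open>zeta d\<close> and erases the others.\<close>
  define g where "g = g0 * (u * \<nu>)"
  have g_at: "rat_ev g w = rat_ev g0 w" if "rat_ev \<mu> w = 0" for w
    using uv_ev[of w] that by (simp add: g_def rat_ev_simps)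
  obtain m where m: "poly (map_poly of_int m) z = 0" "lead_coeff m = 1"
    using z(2) by (auto simp: algebraic_int_altdef_ipoly)
  have g_int: "algebraic_int (rat_ev g w)" if w: "w ^ d = 1" for w
  proof (cases "rat_ev \<mu> w = 0")
    case True
    \<comment> \<open>Composed with g0, the monic integer polynomial m of z becomes a multiple of
      \<mu>. It therefore also vanishes at w, and the value at w is a root of m.\<close>
    have "rat_ev (pcompose (map_poly of_int m) g0) (zeta d) = 0"
      unfolding rat_ev_pcompose_int using m(1) g0 by simp
    then obtain t where "pcompose (map_poly of_int m) g0 = \<mu> * t" using \<mu>(2) by (metis dvdE)
    then have "rat_ev (pcompose (map_poly of_int m) g0) w = 0" using True by (simp add: rat_ev_simps)
    then have "poly (map_poly of_int m) (rat_ev g0 w) = 0" by (simp only: rat_ev_pcompose_int)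
    then show ?thesis unfolding g_at[OF True] algebraic_int_altdef_ipoly using m(2) by blast
  next
    case False
    then have "rat_ev g w = 0" using roots[OF w] by (simp add: g_def rat_ev_simps)
    then show ?thesis by simp
  qed
  \<comment> \<open>Exponents are reduced modulo d, which does not change values at d-th roots of
    unity.\<close>
  define c where "c j = (\<Sum>i\<in>{i \<in> {..degree g}. i mod d = j}. Polynomial.coeff g i)" for j
  have deg: "degree (map_poly of_rat g :: complex poly) = degree g" by (rule degree_map_poly) simp
  have g_c: "rat_ev g w = (\<Sum>j<d. of_rat (c j) * w ^ j)" if w: "w ^ d = 1" for w
  proof -
    have wi: "w ^ i = w ^ (i mod d)" for i
    proof -
      have "w ^ i = (w ^ d) ^ (i div d) * w ^ (i mod d)"
        by (simp flip: power_mult power_add)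
      then show ?thesis using w by simp
    qed
    have "rat_ev g w = (\<Sum>i\<le>degree g. of_rat (Polynomial.coeff g i) * w ^ i)"
      by (simp add: poly_altdef deg coeff_map_poly)
    also have "\<dots> = (\<Sum>j<d. \<Sum>i\<in>{i \<in> {..degree g}. i mod d = j}. of_rat (Polynomial.coeff g i) * w ^ i)"
      using d by (intro sum.group[symmetric]) auto
    also have "\<dots> = (\<Sum>j<d. of_rat (c j) * w ^ j)"
    proof (intro sum.cong refl)
      fix j
      have "(\<Sum>i\<in>{i \<in> {..degree g}. i mod d = j}. of_rat (Polynomial.coeff g i) * w ^ i) =
          (\<Sum>i\<in>{i \<in> {..degree g}. i mod d = j}. of_rat (Polynomial.coeff g i) * w ^ j)"
      proof (intro sum.cong refl)
        fix i assume "i \<in> {i \<in> {..degree g}. i mod d = j}"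
        then show "of_rat (Polynomial.coeff g i) * w ^ i = of_rat (Polynomial.coeff g i) * w ^ j"
          using wi[of i] by simp
      qed
      then show "(\<Sum>i\<in>{i \<in> {..degree g}. i mod d = j}. of_rat (Polynomial.coeff g i) * w ^ i) =
          of_rat (c j) * w ^ j"
        by (simp add: c_def of_rat_sum sum_distrib_right)
    qed
    finally show ?thesis .
  qed
  have root: "(zeta d ^ l) ^ d = 1" for l
    using zeta_power_self[OF d] by (simp add: mult.commute power_mult flip: power_mult[of _ l d])
  have "\<exists>n. of_nat d * of_rat (c j) = (of_int n :: complex)" if j: "j < d" for j
  proof -
    \<comment> \<open>Fourier inversion on the d-th roots of unity. The exponent l (d - j) replaces
      -l j, which is not a natural number.\<close>
    have "(\<Sum>l<d. rat_ev g (zeta d ^ l) * zeta d ^ (l * (d - j))) =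
        (\<Sum>l<d. \<Sum>i<d. of_rat (c i) * zeta d ^ (l * (i + (d - j))))"
      by (simp add: g_c[OF root] sum_distrib_right mult.assoc distrib_left power_add flip: power_mult)
    also have "\<dots> = (\<Sum>i<d. of_rat (c i) * (\<Sum>l<d. zeta d ^ (l * (i + (d - j)))))"
      by (subst sum.swap) (simp add: sum_distrib_left)
    also have "\<dots> = (\<Sum>i<d. if i = j then of_nat d * of_rat (c j) else 0)"
    proof (intro sum.cong refl)
      fix i assume "i \<in> {..<d}"
      then have i: "i < d" by simp
      have "d dvd i + (d - j) \<longleftrightarrow> i = j"
      proof
        assume "d dvd i + (d - j)"
        then obtain t where t: "i + (d - j) = d * t" by (elim dvdE)
        have "0 < d * t" "d * t < d * 2" using t i j by linarith+
        then have "0 < t" "t < 2" by simp_all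
        then have "t = 1" by simp
        then show "i = j" using t j by simp
      qed (use j in simp)
      then show "of_rat (c i) * (\<Sum>l<d. zeta d ^ (l * (i + (d - j)))) =
          (if i = j then of_nat d * of_rat (c j) else 0 :: complex)"
        by (simp add: sum_zeta_powers[OF d])
    qed
    also have "\<dots> = of_nat d * of_rat (c j)" using j by simp
    finally have eq: "(\<Sum>l<d. rat_ev g (zeta d ^ l) * zeta d ^ (l * (d - j))) = of_nat d * of_rat (c j)" .
    have "algebraic_int (\<Sum>l<d. rat_ev g (zeta d ^ l) * zeta d ^ (l * (d - j)))"
      using g_int[OF root] algebraic_int_root_of_unity[OF zeta_power_self[OF d] d]
      by (intro algebraic_int_sum algebraic_int_mult algebraic_int_power)
    then have "algebraic_int (of_nat d * of_rat (c j) :: complex)" unfolding eq .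
    moreover have "of_nat d * of_rat (c j) \<in> (\<rat> :: complex set)"
      by (intro Rats_mult) simp_all
    ultimately have "of_nat d * of_rat (c j) \<in> (\<int> :: complex set)" by (rule rational_algebraic_int_is_int)
    then show ?thesis by (auto elim: Ints_cases)
  qed
  then obtain n where n: "\<And>j. j < d \<Longrightarrow> of_nat d * of_rat (c j) = (of_int (n j) :: complex)" by metis
  have "z = rat_ev g (zeta d)" using g_at[OF \<mu>(1)] g0 by simp
  then have "of_nat d * z = (\<Sum>j<d. (of_nat d * of_rat (c j)) * zeta d ^ j)"
    using g_c[OF zeta_power_self[OF d]] by (simp add: sum_distrib_left mult.assoc)
  also have "\<dots> = (\<Sum>j<d. of_int (n j) * zeta d ^ j)" using n by simp
  finally show ?thesis by (rule that)
qed

section \<open>The residue field\<close>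

text \<open>If the integer coordinates of d z and d z' agree modulo p, then d (z - z') = p w with an
  algebraic integer w, which lies in R by \<open>divide\<close>. Applying \<phi> gives equal
  residues, as d is invertible. So there are at most p^d residues.\<close>

lemma (in residue_map) finite_residue_field:
  assumes d: "d > 0" "\<not> p dvd d" and p: "CHAR('k) = p" "p > 0" and surj: "\<phi> ` R = UNIV"
    and cyc: "R \<subseteq> cyclotomic_field d"
    and divide: "\<And>w. algebraic_int w \<Longrightarrow> of_nat p * w \<in> R \<Longrightarrow> w \<in> R"
  shows "finite (UNIV :: 'k set)"
proof -
  have "\<exists>n :: nat \<Rightarrow> int. of_nat d * z = (\<Sum>j<d. of_int (n j) * zeta d ^ j)" if "z \<in> R" for z
    using cyclotomic_integer_rep[OF d(1)] cyc R_int that by (metis subsetD)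
  then obtain n :: "complex \<Rightarrow> nat \<Rightarrow> int" where
    n: "\<And>z. z \<in> R \<Longrightarrow> of_nat d * z = (\<Sum>j<d. of_int (n z j) * zeta d ^ j)" by metis
  \<comment> \<open>The coordinates may fail to be unique; \<open>n\<close> fixes a choice for each
    z.\<close>
  define cls where "cls z = (\<lambda>j\<in>{..<d}. n z j mod int p)" for z
  have \<phi>_cls: "\<phi> z = \<phi> z'" if z: "z \<in> R" "z' \<in> R" "cls z = cls z'" for z z'
  proof -
    have dvd: "int p dvd n z j - n z' j" if "j < d" for j
      using fun_cong[OF z(3), of j] that by (simp add: cls_def mod_eq_dvd_iff)
    define t where "t j = (n z j - n z' j) div int p" for j
    have t: "n z j - n z' j = int p * t j" if "j < d" for j
      using dvd[OF that] by (simp add: t_def)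
    define w where "w = (\<Sum>j<d. of_int (t j) * zeta d ^ j)"
    have w_int: "algebraic_int w"
      unfolding w_def using algebraic_int_root_of_unity[OF zeta_power_self[OF d(1)] d(1)]
      by (intro algebraic_int_sum algebraic_int_mult algebraic_int_power algebraic_int_of_int)
    have "of_nat d * (z - z') = (\<Sum>j<d. of_int (n z j - n z' j) * zeta d ^ j)"
      using n z by (simp add: right_diff_distrib left_diff_distrib sum_subtractf)
    also have "\<dots> = (\<Sum>j<d. of_int (int p * t j) * zeta d ^ j)" using t by simp
    also have "\<dots> = of_nat p * w" by (simp add: w_def sum_distrib_left mult.assoc)
    finally have eq: "of_nat d * (z - z') = of_nat p * w" .
    have "of_nat p * w \<in> R" unfolding eq[symmetric] using of_nat_R z by (intro R_mult R_diff) auto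
    then have wR: "w \<in> R" using divide w_int by blast
    have "\<phi> (of_nat d * (z - z')) = \<phi> (of_nat p * w)" by (simp only: eq)
    then have "of_nat d * (\<phi> z - \<phi> z') = of_nat p * \<phi> w"
      using wR z by (simp add: \<phi>_mult \<phi>_diff R_diff of_nat_R)
    moreover have "of_nat p = (0 :: 'k)" using of_nat_CHAR[where ?'a = 'k] p(1) by simp
    moreover have "of_nat d \<noteq> (0 :: 'k)" using d(2) p(1) by (simp add: of_nat_eq_0_iff_char_dvd)
    ultimately show ?thesis by simp
  qed
  have "cls ` R \<subseteq> {..<d} \<rightarrow>\<^sub>E {0..<int p}"
    using p(2) by (auto simp: cls_def)
  then have fin: "finite (cls ` R)" by (rule finite_subset) (simp add: finite_PiE)
  have "UNIV \<subseteq> (\<lambda>t. \<phi> (SOME z. z \<in> R \<and> cls z = t)) ` cls ` R"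
  proof
    fix y :: 'k
    have "y \<in> \<phi> ` R" using surj by simp
    then obtain z where z: "z \<in> R" "y = \<phi> z" by blast
    have "(SOME z'. z' \<in> R \<and> cls z' = cls z) \<in> R \<and> cls (SOME z'. z' \<in> R \<and> cls z' = cls z) = cls z"
      by (rule someI[of _ z]) (use z in simp)
    then have "y = \<phi> (SOME z'. z' \<in> R \<and> cls z' = cls z)" using \<phi>_cls z by metis
    then show "y \<in> (\<lambda>t. \<phi> (SOME z. z \<in> R \<and> cls z = t)) ` cls ` R" using z(1) by blast
  qed
  then show ?thesis using fin finite_surj by blast
qed

section \<open>Finite fields\<close>

lemma field_power_CARD:
  fixes x :: "'k::field"
  assumes fin: "finite (UNIV :: 'k set)"
  shows "x ^ CARD('k) = x"
proof (cases "x = 0")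
  case True
  then show ?thesis using fin by (simp add: zero_power finite_UNIV_card_ge_0)
next
  case False
  have "(\<Prod>y\<in>UNIV - {0}. x * y) = (\<Prod>y\<in>UNIV - {0}. y)"
    by (rule prod.reindex_bij_witness[of _ "\<lambda>y. y / x" "\<lambda>y. x * y"]) (use False in auto)
  moreover have "(\<Prod>y\<in>UNIV - {0 :: 'k}. x * y) = x ^ (CARD('k) - 1) * (\<Prod>y\<in>UNIV - {0}. y)"
    using fin by (simp add: prod.distrib card_Diff_singleton)
  moreover have "(\<Prod>y\<in>UNIV - {0 :: 'k}. y) \<noteq> 0" using fin by simp
  ultimately have "x ^ (CARD('k) - 1) = 1" by simp
  moreover have "CARD('k) = Suc (CARD('k) - 1)" using fin by (simp add: finite_UNIV_card_ge_0)
  ultimately show ?thesis by (metis mult.right_neutral power_Suc)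
qed

text \<open>A prime l that divides the order gives a subgroup of order l in the additive group. A
  nonzero element x of it satisfies l x = 0, so the characteristic p divides l.\<close>

lemma field_CARD_prime_power:
  assumes fin: "finite (UNIV :: 'k::field set)" and p: "Factorial_Ring.prime p" "CHAR('k) = p"
  obtains s where "CARD('k) = p ^ Suc s"
proof -
  define G :: "'k monoid" where "G = \<lparr>carrier = UNIV, monoid.mult = (+), one = 0\<rparr>"
  have G: "Group.group G"
  proof (rule groupI)
    fix x assume "x \<in> carrier G"
    show "\<exists>y\<in>carrier G. y \<otimes>\<^bsub>G\<^esub> x = \<one>\<^bsub>G\<^esub>" by (intro bexI[of _ "- x"]) (simp_all add: G_def)
  qed (simp_all add: G_def add.assoc)
  have only_p: "l = p" if l: "Factorial_Ring.prime l" "l dvd CARD('k)" for l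
  proof (rule ccontr)
    assume "l \<noteq> p"
    obtain m where m: "CARD('k) = l * m" using l(2) by (elim dvdE)
    have "\<exists>H. subgroup H G \<and> card H = l ^ 1"
      by (rule sylow_thm[OF l(1) G, of _ m]) (use fin m in \<open>simp_all add: Coset.order_def G_def\<close>)
    then obtain H where H: "subgroup H G" "card H = l" by auto
    have finH: "finite H" using fin by (rule finite_subset[rotated]) simp
    have "0 \<in> H" using subgroup.one_closed[OF H(1)] by (simp add: G_def)
    have "\<exists>x\<in>H. x \<noteq> 0"
    proof (rule ccontr)
      assume "\<not> ?thesis"
      then have "H = {0}" using \<open>0 \<in> H\<close> by auto
      then show False using H(2) prime_gt_1_nat[OF l(1)] by simp
    qed
    then obtain x where x: "x \<in> H" "x \<noteq> 0" by blast
    interpret HG: Group.group "G\<lparr>carrier := H\<rparr>" using H(1) G by (rule subgroup.subgroup_is_group)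
    have pow: "x [^]\<^bsub>G\<lparr>carrier := H\<rparr>\<^esub> (k :: nat) = of_nat k * x" for k
      by (induction k) (simp_all add: G_def algebra_simps)
    have "x [^]\<^bsub>G\<lparr>carrier := H\<rparr>\<^esub> Coset.order (G\<lparr>carrier := H\<rparr>) = \<one>\<^bsub>G\<lparr>carrier := H\<rparr>\<^esub>"
      using x(1) by (intro HG.pow_order_eq_1) simp
    then have "of_nat l * x = 0" by (simp add: pow Coset.order_def H(2)) (simp add: G_def)
    then have "of_nat l = (0 :: 'k)" using x(2) by simp
    then have "p dvd l" using p(2) by (simp add: of_nat_eq_0_iff_char_dvd)
    then show False using \<open>l \<noteq> p\<close> l(1) p(1) primes_dvd_imp_eq by blast
  qed
  have pos: "CARD('k) > 0" using fin by (simp add: finite_UNIV_card_ge_0)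
  then obtain m where m: "CARD('k) = p ^ multiplicity p CARD('k) * m" "\<not> p dvd m"
    using p(1) multiplicity_decompose'[of "CARD('k)" p] by (metis not_gr_zero not_prime_unit)
  have "m = 1"
  proof (rule ccontr)
    assume "m \<noteq> 1"
    then obtain l where l: "Factorial_Ring.prime l" "l dvd m" using prime_factor_nat by blast
    then have "l dvd CARD('k)" by (subst m(1)) simp
    with l m(2) only_p show False by blast
  qed
  moreover have "CARD('k) \<noteq> 1"
  proof -
    have "card {0, 1 :: 'k} \<le> CARD('k)" using fin by (intro card_mono) auto
    then show ?thesis by simp
  qed
  ultimately obtain s where "multiplicity p CARD('k) = Suc s"
    using m(1) by (metis mult_1_right not0_implies_Suc power_0)
  then show ?thesis using that m(1) \<open>m = 1\<close> by (metis mult_1_right)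
qed

section \<open>The number field and its places\<close>

lemma common_denom:
  assumes "finite A"
  shows "common_denom A > 0" "\<forall>a\<in>A. of_nat (common_denom A) * a \<in> \<int>"
proof -
  have "\<exists>d. d > 0 \<and> (\<forall>a\<in>A. of_nat d * a \<in> \<int>)"
    using finite_rat_common_denominator[OF assms] by blast
  from LeastI_ex[OF this] show "common_denom A > 0" "\<forall>a\<in>A. of_nat (common_denom A) * a \<in> \<int>"
    unfolding common_denom_def by blast+
qed

lemma unity_eq_zeta_power:
  assumes "d > 0" "of_nat d * x \<in> \<int>"
  obtains m where "unity x = zeta d ^ m"
proof -
  obtain z where z: "of_nat d * x = of_int z" using assms(2) by (elim Ints_cases)
  define m where "m = nat (z mod int d)"
  have "z = int m + int d * (z div int d)" using assms(1) by (simp add: m_def)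
  then have "x * of_nat d = of_int (int m + int d * (z div int d))" using z by (simp add: mult.commute)
  then have "x = of_int (int m + int d * (z div int d)) / of_nat d"
    using assms(1) by (simp only: eq_divide_eq) simp
  also have "\<dots> = of_nat m / of_nat d + of_int (z div int d)"
    using assms(1) by (simp only: of_int_add of_int_mult add_divide_distrib of_int_of_nat_eq) simp
  finally have "x = of_nat m / of_nat d + of_int (z div int d)" .
  then have "frac x = frac (of_nat m / of_nat d)" by (simp add: frac_def)
  then have "unity x = zeta d ^ m" by (simp add: zeta_power unity_eq_iff)
  then show ?thesis by (rule that)
qed

lemma coeff_root_poly_gen_field:
  assumes "set us \<subseteq> gen_field A"
  shows "Polynomial.coeff (root_poly us) k \<in> gen_field A"
  using assms
proof (induction us arbitrary: k)
  case Nil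
  then show ?case by (cases k) (simp_all add: one_pCons gen_field_0 gen_field_1)
next
  case (Cons u us)
  have "(case k of 0 \<Rightarrow> 0 | Suc j \<Rightarrow> Polynomial.coeff (root_poly us) j) +
      - (u * Polynomial.coeff (root_poly us) k) \<in> gen_field A"
    using Cons by (intro gen_field_add gen_field_uminus gen_field_mult)
      (auto simp: gen_field_0 split: nat.splits)
  then show ?case unfolding root_poly_simps coeff_linear_mult by simp
qed

lemma (in type_field_aut) coeff_root_poly:
  assumes L: "L = gen_field A" and us: "set us \<subseteq> L"
  shows "\<sigma> (Polynomial.coeff (root_poly us) k) = Polynomial.coeff (root_poly (map \<sigma> us)) k"
  using us
proof (induction us arbitrary: k)
  case Nil
  show ?case by (cases k) (simp_all add: one_pCons L gen_field_0 zero[unfolded L] one[unfolded L])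
next
  case (Cons u us)
  let ?c = "Polynomial.coeff (root_poly us)"
  have c: "?c j \<in> L" for j
    unfolding L by (rule coeff_root_poly_gen_field) (use Cons.prems L in simp)
  have IH: "\<sigma> (?c j) = Polynomial.coeff (root_poly (map \<sigma> us)) j" for j using Cons by simp
  define a where "a = (case k of 0 \<Rightarrow> 0 | Suc j \<Rightarrow> ?c j)"
  have a: "\<sigma> a = (case k of 0 \<Rightarrow> 0 | Suc j \<Rightarrow> Polynomial.coeff (root_poly (map \<sigma> us)) j)"
    using IH by (auto simp: a_def L gen_field_0 zero[unfolded L] split: nat.splits)
  have u: "u \<in> L" using Cons.prems by simp
  have uc: "u * ?c k \<in> L" using u c[of k] by (simp add: L gen_field_mult)
  have diff: "a - u * ?c k \<in> L"
    using coeff_root_poly_gen_field[of "u # us" A k] Cons.prems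
    unfolding root_poly_simps coeff_linear_mult a_def L by blast
  have "\<sigma> (a - u * ?c k) + \<sigma> u * \<sigma> (?c k) = \<sigma> a"
    using add[OF diff uc] mult[OF u c[of k]] by simp
  then have "\<sigma> (a - u * ?c k) = \<sigma> a - \<sigma> u * \<sigma> (?c k)" by (simp only: eq_diff_eq)
  then show ?case
    unfolding root_poly_simps list.map coeff_linear_mult a_def[symmetric] a IH .
qed

text \<open>An automorphism that raises \<open>zeta d\<close> to the power l raises all d-th roots
  of unity to it, so it multiplies the exponents by l. For l in D this permutes the roots of the
  polynomial and fixes its coefficients.\<close>

lemma coeff_root_poly_fixed:
  assumes d: "d > 0" and xs: "\<forall>x\<in>set xs. of_nat d * x \<in> \<int>"
    and D: "\<And>l. l \<in> D \<Longrightarrow> residues_mod_Ints (map ((*) (of_nat l)) xs) = residues_mod_Ints xs"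
  shows "Polynomial.coeff (root_poly (map unity xs)) k \<in> cyclotomic_fixed_field d D"
proof -
  let ?L = "cyclotomic_field d"
  have zeta_L: "zeta d \<in> ?L" unfolding cyclotomic_field_def by (rule gen_field_incl) simp
  have pow_L: "zeta d ^ m \<in> ?L" for m
    using zeta_L unfolding cyclotomic_field_def by (rule gen_field_power)
  have us_L: "set (map unity xs) \<subseteq> ?L"
  proof
    fix u assume "u \<in> set (map unity xs)"
    then obtain x where x: "x \<in> set xs" "u = unity x" by auto
    obtain m where "unity x = zeta d ^ m" using unity_eq_zeta_power[OF d] xs x(1) by blast
    then show "u \<in> ?L" using x(2) pow_L by simp
  qed
  have "\<sigma> (Polynomial.coeff (root_poly (map unity xs)) k) = Polynomial.coeff (root_poly (map unity xs)) k"
    if \<sigma>: "\<sigma> \<in> carrier (galois_group \<rat> ?L)" and l: "l \<in> D" "\<sigma> (zeta d) = zeta d ^ l" for \<sigma> l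
  proof -
    interpret type_field_aut ?L \<rat> \<sigma> by unfold_locales (rule \<sigma>)
    have pow: "\<sigma> (zeta d ^ m) = \<sigma> (zeta d) ^ m" for m
      by (induction m) (simp_all add: one mult zeta_L pow_L)
    have \<sigma>_unity: "\<sigma> (unity x) = unity (of_nat l * x)" if x: "x \<in> set xs" for x
    proof -
      obtain m where m: "unity x = zeta d ^ m" using unity_eq_zeta_power[OF d] xs x by blast
      then have "\<sigma> (unity x) = unity x ^ l" by (simp add: pow l(2) mult.commute flip: power_mult)
      then show ?thesis by (simp only: unity_power)
    qed
    have "map \<sigma> (map unity xs) = map unity (map ((*) (of_nat l)) xs)"
      unfolding map_map o_def by (rule map_cong[OF refl]) (rule \<sigma>_unity)
    moreover have "mset (map unity (map ((*) (of_nat l)) xs)) = mset (map unity xs)"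
      using D[OF l(1)] unfolding residues_mod_Ints_eq_iff_unity .
    ultimately have "mset (map \<sigma> (map unity xs)) = mset (map unity xs)" by (simp only:)
    then have "root_poly (map \<sigma> (map unity xs)) = root_poly (map unity xs)"
      by (rule root_poly_cong_mset)
    then show ?thesis using coeff_root_poly[OF cyclotomic_field_def us_L, of k] by (simp only:)
  qed
  then show ?thesis using coeff_root_poly_gen_field us_L
    unfolding cyclotomic_fixed_field_def cyclotomic_field_def by blast
qed

text \<open>Serves the finiteness of the residue field: a quotient by p that is an algebraic integer
  stays among the integers of K.\<close>

lemma cyclotomic_fixed_field_divide:
  assumes "p > 0" "of_nat p * w \<in> cyclotomic_fixed_field d D"
  shows "w \<in> cyclotomic_fixed_field d D"
proof -
  let ?L = "cyclotomic_field d"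
  have pw: "of_nat p * w \<in> ?L"
    using assms(2) by (simp add: cyclotomic_fixed_field_def)
  have p_L: "of_nat n \<in> ?L" for n
    unfolding cyclotomic_field_def by (induction n) (simp_all add: gen_field_0 gen_field_1 gen_field_add)
  then have "inverse (of_nat p) * (of_nat p * w) \<in> ?L"
    using pw unfolding cyclotomic_field_def by (metis gen_field_mult gen_field_inverse)
  moreover have "inverse (of_nat p) * (of_nat p * w) = w" using assms(1) by simp
  ultimately have w: "w \<in> ?L" by simp
  have "\<sigma> w = w" if \<sigma>: "\<sigma> \<in> carrier (galois_group \<rat> ?L)" and l: "l \<in> D" "\<sigma> (zeta d) = zeta d ^ l" for \<sigma> l
  proof -
    interpret type_field_aut ?L \<rat> \<sigma> by unfold_locales (rule \<sigma>)
    have "\<sigma> (of_nat p * w) = of_nat p * w"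
      using assms(2) \<sigma> l by (auto simp: cyclotomic_fixed_field_def)
    moreover have "\<sigma> (of_nat p * w) = of_nat p * \<sigma> w"
      using mult[OF p_L w] fixed[of "of_nat p"] by simp
    ultimately show ?thesis using assms(1) by simp
  qed
  with w show ?thesis by (auto simp: cyclotomic_fixed_field_def)
qed

text \<open>The quotient map by the place is followed by the assumed isomorphism. The place and its
  residue field enter the proof only through the resulting map \<phi>.\<close>

lemma residue_map_of_place:
  fixes K :: "complex set"
  assumes "place_above K p P" "is_residue_field TYPE('k::field) K P"
  obtains \<phi> :: "complex \<Rightarrow> 'k::field" where "residue_map {z \<in> K. algebraic_int z} \<phi>"
    "\<phi> ` {z \<in> K. algebraic_int z} = UNIV" "\<phi> (of_nat p) = 0"
proof -
  define OK where "OK = ring_of_integers K"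
  define R where "R = {z \<in> K. algebraic_int z}"
  have OK_simps: "carrier OK = R" "monoid.mult OK = (*)" "ring.add OK = (+)" "one OK = 1" "ring.zero OK = 0"
    by (simp_all add: OK_def ring_of_integers_def R_def ring_of_type_algebra_def)
  interpret primeideal P OK using assms(1) by (simp add: place_above_def OK_def)
  obtain h where h: "h \<in> ring_iso (OK Quot P) (ring_of_type_algebra :: 'k ring)"
    using assms(2) by (auto simp: is_residue_field_def is_ring_iso_def OK_def)
  have h_hom: "h \<in> Ring.ring_hom (OK Quot P) (ring_of_type_algebra :: 'k ring)"
    and h_surj: "h ` carrier (OK Quot P) = UNIV"
    using h by (auto simp: ring_iso_def bij_betw_def ring_of_type_algebra_def)
  define \<phi> where "\<phi> = h \<circ> (+>\<^bsub>OK\<^esub>) P"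
  have \<phi>: "\<phi> \<in> Ring.ring_hom OK (ring_of_type_algebra :: 'k ring)"
    unfolding \<phi>_def using rcos_ring_hom h_hom by (rule ring_hom_trans)
  have "residue_map R \<phi>"
  proof
    fix x y assume x: "x \<in> R"
    show "algebraic_int x" using x by (simp add: R_def)
    have "\<ominus>\<^bsub>OK\<^esub> x \<in> R" using a_inv_closed[of x] x by (simp add: OK_simps)
    moreover have "x + \<ominus>\<^bsub>OK\<^esub> x = 0" using r_neg[of x] x by (simp add: OK_simps)
    then have "\<ominus>\<^bsub>OK\<^esub> x = - x" by (simp add: add_eq_0_iff)
    ultimately show "- x \<in> R" by simp
    assume y: "y \<in> R"
    show "x + y \<in> R" "x * y \<in> R" using a_closed[of x y] m_closed[of x y] x y by (simp_all add: OK_simps)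
    show "\<phi> (x + y) = \<phi> x + \<phi> y" "\<phi> (x * y) = \<phi> x * \<phi> y"
      using ring_hom_add[OF \<phi>, of x y] ring_hom_mult[OF \<phi>, of x y] x y
      by (simp_all add: OK_simps) (simp_all add: ring_of_type_algebra_def)
  next
    show "1 \<in> R" using one_closed by (simp add: OK_simps)
    show "\<phi> 1 = 1" using ring_hom_one[OF \<phi>] by (simp add: OK_simps) (simp add: ring_of_type_algebra_def)
  qed
  moreover have "\<phi> ` R = UNIV"
  proof -
    have "carrier (OK Quot P) = (+>\<^bsub>OK\<^esub>) P ` R"
      by (auto simp: FactRing_def A_RCOSETS_def' OK_simps)
    then show ?thesis using h_surj by (simp add: \<phi>_def image_comp)
  qed
  moreover have "\<phi> (of_nat p) = 0"
  proof -
    interpret residue_map R \<phi> by fact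
    have "P +>\<^bsub>OK\<^esub> of_nat p = P" "P +>\<^bsub>OK\<^esub> 0 = P"
      using assms(1) a_rcos_const[of "of_nat p"] a_rcos_const[of 0] additive_subgroup.zero_closed[OF is_additive_subgroup]
      by (simp_all add: place_above_def OK_simps)
    then have "\<phi> (of_nat p) = \<phi> 0" by (simp add: \<phi>_def)
    then show ?thesis by (simp add: \<phi>_0)
  qed
  ultimately show ?thesis using that unfolding R_def by blast
qed

theorem theorem1p1:
  fixes n d p q :: nat
    and \<alpha> \<beta> :: "rat list"
    and K P :: "complex set"
    and F :: "rat fps"
    and f :: "'k::field fps"
  assumes "n > 0"
    and "length \<alpha> = n" and "length \<beta> = n - 1"
    and "set \<alpha> \<inter> \<int>\<^sub>\<le>\<^sub>0 = {}" and "set \<beta> \<inter> \<int>\<^sub>\<le>\<^sub>0 = {}"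
    and "d = common_denom (set \<alpha> \<union> set \<beta>)"
    and "K = hypergeom_field \<alpha> \<beta>"
    and "Factorial_Ring.prime p"
    and "of_nat p > 2 * of_nat d * Max ((\<lambda>a. \<bar>a\<bar> + 1) ` (set \<alpha> \<union> set \<beta>))"
    and "F = fps_hypergeo \<alpha> \<beta> 1"
    and "\<forall>k. fps_nth F k \<in> Zloc p"
    and "place_above K p P"
    and "is_residue_field TYPE('k) K P"
    and "q = CARD('k)"
    and "f = reduce_fps F"
  shows "(\<exists>c :: nat \<Rightarrow> 'k poly fract. \<exists>Z.
           Z = (\<Sum>i\<le>n. Polynomial.monom (c i) (q ^ i)) \<and> Z \<noteq> 0 \<and>
           poly (map_poly fls_of_ratfun Z) (fps_to_fls f) = 0) \<and>
         (\<exists>h. h \<in> mon (galois_group_of ac_of_ratfun (ac_of_fps f)) (GL n :: 'k mat monoid))"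
proof -
  let ?S = "set \<alpha> \<union> set \<beta>"
  define R where "R = {z \<in> K. algebraic_int z}"
  define D where "D = stab_group d \<alpha> \<beta>"
  have K: "K = cyclotomic_fixed_field d D"
    unfolding assms(7) hypergeom_field_def Let_def D_def assms(6) ..
  have d: "d > 0" "\<forall>x\<in>?S. of_nat d * x \<in> \<int>"
    using common_denom[of ?S] assms(6) by auto
  have len: "length \<alpha> = Suc (length \<beta>)" using assms(1-3) by simp
  have big: "of_nat p > 2 * of_nat d * (\<bar>x\<bar> + 1)" if "x \<in> ?S" for x
  proof -
    have "\<bar>x\<bar> + 1 \<le> Max ((\<lambda>a. \<bar>a\<bar> + 1) ` ?S)" using that by (intro Max_ge) auto
    then have "2 * of_nat d * (\<bar>x\<bar> + 1) \<le> 2 * of_nat d * Max ((\<lambda>a. \<bar>a\<bar> + 1) ` ?S)"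
      by (intro mult_left_mono) auto
    then show ?thesis using assms(9) by linarith
  qed
  \<comment> \<open>There is at least one parameter, so the bound gives p > 2 d.\<close>
  have "\<not> p dvd d"
  proof
    assume "p dvd d"
    then have "p \<le> d" using d(1) by (rule dvd_imp_le)
    then have pd: "(of_nat p :: rat) \<le> of_nat d" by simp
    obtain x where x: "x \<in> ?S" using assms(1,2) by (cases \<alpha>) auto
    have "of_nat d * 1 \<le> of_nat d * (2 * (\<bar>x\<bar> + 1))" by (intro mult_left_mono) auto
    also have "\<dots> = 2 * of_nat d * (\<bar>x\<bar> + 1)" by (simp only: ac_simps)
    finally show False using big[OF x] pd by linarith
  qed
  obtain \<phi> :: "complex \<Rightarrow> 'k" where \<phi>: "residue_map R \<phi>" "\<phi> ` R = UNIV" "\<phi> (of_nat p) = 0"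
    using residue_map_of_place[OF assms(12,13)] unfolding R_def by blast
  interpret residue_map R \<phi> by (rule \<phi>)
  have "of_nat p = (0 :: 'k)" using \<phi>(3) of_nat_R by metis
  then have "CHAR('k) dvd p" by (simp add: of_nat_eq_0_iff_char_dvd)
  then have CHAR_k: "CHAR('k) = p"
    using assms(8) by (auto simp: prime_nat_iff)
  \<comment> \<open>\<open>CARD\<close> of an infinite type is 0, so finiteness has to precede every
    use of q.\<close>
  have fin: "finite (UNIV :: 'k set)"
  proof (rule finite_residue_field[OF d(1) \<open>\<not> p dvd d\<close> CHAR_k])
    show "p > 0" using assms(8) by (rule prime_gt_0_nat)
    show "\<phi> ` R = UNIV" by (rule \<phi>)
    show "R \<subseteq> cyclotomic_field d" by (auto simp: R_def K cyclotomic_fixed_field_def)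
    show "w \<in> R" if "algebraic_int w" "of_nat p * w \<in> R" for w
      using that cyclotomic_fixed_field_divide[OF \<open>p > 0\<close>] by (auto simp: R_def K)
  qed
  obtain s where s: "CARD('k) = p ^ Suc s" using field_CARD_prime_power[OF fin assms(8) CHAR_k] .
  have q: "q = p ^ Suc s" using s assms(14) by simp
  have frob_k: "x ^ q = x" for x :: 'k unfolding assms(14) by (rule field_power_CARD[OF fin])
  have res: "residues_mod_Ints (map ((*) (of_nat q)) xs) = residues_mod_Ints xs"
    if xs: "set xs \<subseteq> ?S" and D: "\<And>l. l \<in> D \<Longrightarrow> residues_mod_Ints (map ((*) (of_nat l)) xs) = residues_mod_Ints xs"
    for xs
  proof (rule frobenius_stabilizes_residues[OF assms(8) CHAR_k q frob_k d(1) \<open>\<not> p dvd d\<close>])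
    show xs_d: "\<forall>x\<in>set xs. of_nat d * x \<in> \<int>" using xs d(2) by blast
    fix k
    have "\<forall>u\<in>set (map unity xs). algebraic_int u"
      using xs_d unity_root algebraic_int_root_of_unity[OF _ d(1)] by auto
    then show "Polynomial.coeff (root_poly (map unity xs)) k \<in> R"
      unfolding R_def K using coeff_root_poly_fixed[OF d(1) xs_d D] algebraic_int_coeff_root_poly by blast
  qed
  have res_\<alpha>: "residues_mod_Ints (map ((*) (of_nat q)) \<alpha>) = residues_mod_Ints \<alpha>"
    and res_\<beta>: "residues_mod_Ints (map ((*) (of_nat q)) \<beta>) = residues_mod_Ints \<beta>"
    by (rule res; simp add: D_def stab_group_def)+
  interpret residue_char p "TYPE('k)" by unfold_locales (rule assms(8), rule CHAR_k)
  have int: "integral (fps_hypergeo \<alpha> \<beta> 1)" using assms(10,11) by (simp add: integral_def)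
  obtain c where c: "(\<Sum>i\<le>n. fls_of_ratfun (c i) * fps_to_fls f ^ (q ^ i)) = 0" "\<exists>i\<le>n. c i \<noteq> 0"
    by (rule hypergeometric_frobenius_relation[OF len d _ assms(4,5) int q res_\<alpha> res_\<beta>])
      (use big assms(2,10,15) in auto)
  define Z where "Z = (\<Sum>i\<le>n. Polynomial.monom (c i) (q ^ i))"
  have "q > 1" using q p_gt_1 by (metis one_less_power zero_less_Suc)
  have "Z \<noteq> 0"
  proof
    assume "Z = 0"
    \<comment> \<open>The exponents q^i are distinct because q > 1, so no two terms of Z
      merge.\<close>
    have "Polynomial.coeff Z (q ^ i) = c i" if "i \<le> n" for i
    proof -
      have "Polynomial.coeff Z (q ^ i) = (\<Sum>j\<le>n. if j = i then c j else 0)"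
        using \<open>q > 1\<close> by (simp add: Z_def coeff_sum)
      then show ?thesis using that by simp
    qed
    then show False using c(2) \<open>Z = 0\<close> by auto
  qed
  \<comment> \<open>Two embeddings of k(x) are used: the relation lives in k((x)), while conjugates
    are taken in the algebraic closure.\<close>
  interpret fls: field_embedding "fls_of_ratfun :: 'k poly fract \<Rightarrow> 'k fls"
    by unfold_locales (simp_all add: fls_of_ratfun_add fls_of_ratfun_mult)
  interpret ac: field_embedding "ac_of_ratfun :: 'k poly fract \<Rightarrow> 'k fls alg_closure"
    by unfold_locales (simp_all add: ac_of_ratfun_def fls_of_ratfun_add fls_of_ratfun_mult)
  have root: "poly (map_poly fls_of_ratfun Z) (fps_to_fls f) = 0"
    unfolding Z_def fls.poly_map_poly_sum_monom by (rule c(1))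
  have "poly (map_poly ac_of_ratfun Z) (ac_of_fps f) = to_ac (\<Sum>i\<le>n. fls_of_ratfun (c i) * fps_to_fls f ^ (q ^ i))"
    unfolding Z_def ac.poly_map_poly_sum_monom by (simp add: ac_of_ratfun_def ac_of_fps_def to_ac_sum)
  then have root_ac: "poly (map_poly ac_of_ratfun Z) (ac_of_fps f) = 0" by (simp add: c(1))
  \<comment> \<open>Through the constants of k(x) the residue field acts on the space of
    roots.\<close>
  have const: "field_embedding (\<lambda>x :: 'k. to_fract [:x:])"
    by unfold_locales (simp_all flip: to_fract_add to_fract_mult add: one_pCons[symmetric])
  have frob: "(x + y) ^ q = x ^ q + y ^ q" for x y :: "'k fls alg_closure"
    unfolding q by (rule freshmans_dream'[where n = "Suc s"]) (use assms(8) CHAR_k in simp_all)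
  have "\<exists>h. h \<in> mon (galois_group_of ac_of_ratfun (ac_of_fps f)) (GL n :: 'k mat monoid)"
    by (rule galois_group_linearized_embeds[OF ac.field_embedding_axioms const fin assms(14) frob_k frob
          Z_def \<open>Z \<noteq> 0\<close> root_ac])
  with Z_def \<open>Z \<noteq> 0\<close> root show ?thesis by blast
qed

end
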